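(* Let $n\ge3$ and let $m_1<\cdots<m_n$ be a generalized arithmetic sequence of positive integers, i.e. $m_i=h\,m_1+(i-1)d$ for all $i\in\{2,\ldots,n\}$ with $h,d\in\mathbb{Z}^+$, and suppose $\gcd\{m_1,d\}=1$, $h>1$ and $h$ divides $d$. Set $\delta:=\lfloor(m_1-1)/(n-1)\rfloor h+d+h$. Then $$\mathrm{reg}(K[\mathcal{C}])=\begin{cases}\delta-1&\text{if }n-1\text{ does not divide }m_1,\\ \delta&\text{if }n-1\text{ divides }m_1.\end{cases}$$
   Context: $K$ is an infinite field and $R=K[x_1,\ldots,x_{n+1}]$ with its standard grading. For positive integers $m_1<\cdots<m_n$, the associated projective monomial curve $\mathcal{C}\subset\mathbb{P}^n_K$ is parametrically defined by $x_i=u^{m_i}v^{m_n-m_i}$ for $1\le i\le n$ and $x_{n+1}=v^{m_n}$. Its vanishing ideal $I(\mathcal{C})\subset R$ is the kernel of the $K$-algebra homomorphism $R\to K[u,v]$, $x_i\mapsto u^{m_i}v^{m_n-m_i}$ ($1\le i\le n$), $x_{n+1}\mapsto v^{m_n}$, and $K[\mathcal{C}]=R/I(\mathcal{C})$. If $0\to\bigoplus_{j=1}^{\beta_p}R(-e_{pj})\to\cdots\to\bigoplus_{j=1}^{\beta_1}R(-e_{1j})\to R\to K[\mathcal{C}]\to0$ is a minimal graded free resolution of $K[\mathcal{C}]$ over $R$, the Castelnuovo-Mumford regularity is $\mathrm{reg}(K[\mathcal{C}])=\max\{e_{ij}-i:1\le i\le p,\ 1\le j\le\beta_i\}$. *)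

theory Defs
  imports
    "HOL-Library.Poly_Mapping"
    "HOL-Algebra.Algebra"
    "Jordan_Normal_Form.Missing_VectorSpace"
begin

text \<open>
  Exponent vectors are finitely supported maps from indices to exponents, so an element of
  \<open>'a mpoly\<close> is a polynomial over \<open>'a\<close> in indeterminates indexed by \<^typ>\<open>nat\<close>. The polynomial
  ring in the indeterminates indexed by \<open>V\<close> is cut out of this type by its carrier.
\<close>

type_synonym 'a mpoly = "(nat \<Rightarrow>\<^sub>0 nat) \<Rightarrow>\<^sub>0 'a"

definition mpoly_ring :: "nat set \<Rightarrow> 'a::field mpoly ring" where
  "mpoly_ring V =
    \<lparr>carrier = {p. \<forall>t\<in>Poly_Mapping.keys p. Poly_Mapping.keys t \<subseteq> V},
     monoid.mult = (*), one = 1, ring.zero = 0, ring.add = (+)\<rparr>"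

definition mvar :: "nat \<Rightarrow> 'a::field mpoly" where
  "mvar i = Poly_Mapping.single (Poly_Mapping.single i 1) 1"

definition monomial_degree :: "(nat \<Rightarrow>\<^sub>0 nat) \<Rightarrow> nat" where
  "monomial_degree t = (\<Sum>i\<in>Poly_Mapping.keys t. Poly_Mapping.lookup t i)"

text \<open>Standard grading, indexed by \<^typ>\<open>int\<close>; the zero polynomial is homogeneous of every degree.\<close>

definition homogeneous :: "int \<Rightarrow> 'a::field mpoly \<Rightarrow> bool" where
  "homogeneous k p \<longleftrightarrow> (\<forall>t\<in>Poly_Mapping.keys p. int (monomial_degree t) = k)"

text \<open>The \<open>'a\<close>-algebra homomorphism sending the \<open>i\<close>-th indeterminate to \<open>f i\<close>.\<close>

definition mpoly_subst :: "(nat \<Rightarrow> 'a::field mpoly) \<Rightarrow> 'a mpoly \<Rightarrow> 'a mpoly" where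
  "mpoly_subst f p =
    (\<Sum>t\<in>Poly_Mapping.keys p. Poly_Mapping.single 0 (Poly_Mapping.lookup p t) *
       (\<Prod>i\<in>Poly_Mapping.keys t. f i ^ Poly_Mapping.lookup t i))"


text \<open>
  In the target ring \<open>K[u,v]\<close> we take \<open>u\<close> and \<open>v\<close> to be the indeterminates with indices 1 and 2.
\<close>

definition curve_param :: "nat \<Rightarrow> (nat \<Rightarrow> nat) \<Rightarrow> nat \<Rightarrow> 'a::field mpoly" where
  "curve_param n m i =
    (if i = n + 1 then mvar 2 ^ m n else mvar 1 ^ m i * mvar 2 ^ (m n - m i))"

definition vanishing_ideal :: "nat \<Rightarrow> (nat \<Rightarrow> nat) \<Rightarrow> 'a::field mpoly set" where
  "vanishing_ideal n m =
    a_kernel (mpoly_ring {1..n+1}) (mpoly_ring {1,2}) (mpoly_subst (curve_param n m))"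


text \<open>
  The free module \<open>R\<^sup>b\<close>, with elements \<open>f\<close> given by their coordinates \<open>f 0, \<dots>, f (b - 1)\<close> and
  padded with 0. The ring multiplication and unit inherited from the record type play no role
  in a module.
\<close>

definition free_module :: "nat set \<Rightarrow> nat \<Rightarrow> ('a::field mpoly, nat \<Rightarrow> 'a mpoly) module" where
  "free_module V b =
    \<lparr>carrier = {f. (\<forall>j<b. f j \<in> carrier (mpoly_ring V)) \<and> (\<forall>j\<ge>b. f j = 0)},
     monoid.mult = undefined, one = undefined,
     ring.zero = (\<lambda>_. 0), ring.add = (\<lambda>f g j. f j + g j), smult = (\<lambda>a f j. a * f j)\<rparr>"

text \<open>
  For a list of shifts \<open>es\<close>, the component of degree \<open>k\<close> of the direct sum of the \<open>R(-es ! j)\<close>,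
  using \<open>R(-e)\<^sub>k = R\<^bsub>k-e\<^esub>\<close>.
\<close>

definition graded_component :: "nat set \<Rightarrow> int list \<Rightarrow> int \<Rightarrow> (nat \<Rightarrow> 'a::field mpoly) set" where
  "graded_component V es k =
    {f \<in> carrier (free_module V (length es)). \<forall>j<length es. homogeneous (k - es ! j) (f j)}"

definition graded_hom ::
  "nat set \<Rightarrow> int list \<Rightarrow> int list \<Rightarrow> ((nat \<Rightarrow> 'a::field mpoly) \<Rightarrow> (nat \<Rightarrow> 'a mpoly)) \<Rightarrow> bool" where
  "graded_hom V es es' \<phi> \<longleftrightarrow>
    mod_hom (mpoly_ring V) (free_module V (length es)) (free_module V (length es')) \<phi> \<and>
    (\<forall>k. \<phi> ` graded_component V es k \<subseteq> graded_component V es' k)"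

text \<open>The canonical map from \<open>R\<close>, seen as the free module \<open>R\<^sup>1\<close>, onto \<open>R/I\<close>.\<close>

definition augmentation ::
  "nat set \<Rightarrow> 'a::field mpoly set \<Rightarrow> (nat \<Rightarrow> 'a mpoly) \<Rightarrow> 'a mpoly set" where
  "augmentation V I f = I +>\<^bsub>mpoly_ring V\<^esub> f 0"

text \<open>
  A graded free resolution of \<open>R/I\<close>
    \<open>0 \<rightarrow> F\<^sub>p \<rightarrow> \<dots> \<rightarrow> F\<^sub>1 \<rightarrow> F\<^sub>0 = R \<rightarrow> R/I \<rightarrow> 0\<close>,
  where \<open>F\<^sub>i\<close> is the direct sum of the \<open>R(-e i ! j)\<close> for \<open>j < length (e i)\<close> and
  \<open>\<phi> i : F\<^sub>i \<rightarrow> F\<^bsub>i-1\<^esub>\<close>. Injectivity at the left end is part of exactness, since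
  \<open>F\<^bsub>p+1\<^esub> = 0\<close>.
\<close>

definition graded_free_resolution ::
  "nat set \<Rightarrow> 'a::field mpoly set \<Rightarrow> nat \<Rightarrow> (nat \<Rightarrow> int list) \<Rightarrow>
    (nat \<Rightarrow> (nat \<Rightarrow> 'a mpoly) \<Rightarrow> (nat \<Rightarrow> 'a mpoly)) \<Rightarrow> bool" where
  "graded_free_resolution V I p e \<phi> \<longleftrightarrow>
    (let R = mpoly_ring V; F = (\<lambda>i. free_module V (length (e i))) in
      e 0 = [0] \<and> (\<forall>i>p. e i = []) \<and>
      (\<forall>i\<ge>1. graded_hom V (e i) (e (i - 1)) (\<phi> i)) \<and>
      augmentation V I ` carrier (F 0) = carrier (R Quot I) \<and>
      a_kernel (F 0) (R Quot I) (augmentation V I) = \<phi> 1 ` carrier (F 1) \<and>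
      (\<forall>i\<ge>1. a_kernel (F i) (F (i - 1)) (\<phi> i) = \<phi> (i + 1) ` carrier (F (i + 1))))"

text \<open>
  Minimality: \<open>\<phi> i\<close> maps \<open>F\<^sub>i\<close> into \<open>\<mm> F\<^bsub>i-1\<^esub>\<close>, where \<open>\<mm>\<close> is the ideal generated by the
  indeterminates; as \<open>F\<^bsub>i-1\<^esub>\<close> is free, this says that all coordinates lie in \<open>\<mm>\<close>.
\<close>

definition minimal_graded_free_resolution ::
  "nat set \<Rightarrow> 'a::field mpoly set \<Rightarrow> nat \<Rightarrow> (nat \<Rightarrow> int list) \<Rightarrow>
    (nat \<Rightarrow> (nat \<Rightarrow> 'a mpoly) \<Rightarrow> (nat \<Rightarrow> 'a mpoly)) \<Rightarrow> bool" where
  "minimal_graded_free_resolution V I p e \<phi> \<longleftrightarrow>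
    graded_free_resolution V I p e \<phi> \<and>
    (\<forall>i\<ge>1. \<forall>f\<in>carrier (free_module V (length (e i))). \<forall>j<length (e (i - 1)).
       \<phi> i f j \<in> Idl\<^bsub>mpoly_ring V\<^esub> (mvar ` V))"

text \<open>
  Castelnuovo-Mumford regularity of \<open>R/I\<close>. The definite description asserts that a minimal graded
  free resolution exists and that the number does not depend on it.
\<close>

definition regularity :: "nat set \<Rightarrow> 'a::field mpoly set \<Rightarrow> int" where
  "regularity V I = (THE r. \<exists>p e \<phi>. minimal_graded_free_resolution V I p e \<phi> \<and>
     r = Max {e i ! j - int i | i j. 1 \<le> i \<and> i \<le> p \<and> j < length (e i)})"


lemma cring_mpoly_ring: "cring (mpoly_ring V :: 'a::field mpoly ring)"
proof -
  have add: "p + q \<in> carrier (mpoly_ring V)"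
    if "p \<in> carrier (mpoly_ring V)" "q \<in> carrier (mpoly_ring V)" for p q :: "'a mpoly"
    using that Poly_Mapping.keys_add[of p q] by (fastforce simp: mpoly_ring_def)
  have mult: "p * q \<in> carrier (mpoly_ring V)"
    if "p \<in> carrier (mpoly_ring V)" "q \<in> carrier (mpoly_ring V)" for p q :: "'a mpoly"
  proof -
    have "Poly_Mapping.keys t \<subseteq> V" if "t \<in> Poly_Mapping.keys (p * q)" for t
    proof -
      from that Poly_Mapping.keys_mult[of p q] obtain a b where
        "t = a + b" "a \<in> Poly_Mapping.keys p" "b \<in> Poly_Mapping.keys q" by blast
      with \<open>p \<in> _\<close> \<open>q \<in> _\<close> Poly_Mapping.keys_add[of a b] show ?thesis
        by (fastforce simp: mpoly_ring_def)
    qed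
    then show ?thesis by (simp add: mpoly_ring_def)
  qed
  have neg: "- p \<in> carrier (mpoly_ring V)" if "p \<in> carrier (mpoly_ring V)" for p :: "'a mpoly"
    using that by (simp add: mpoly_ring_def in_keys_iff)
  have units01: "0 \<in> carrier (mpoly_ring V :: 'a mpoly ring)" "1 \<in> carrier (mpoly_ring V :: 'a mpoly ring)"
    by (simp_all add: mpoly_ring_def)
  have ops: "x \<oplus>\<^bsub>mpoly_ring V\<^esub> y = x + y" "x \<otimes>\<^bsub>mpoly_ring V\<^esub> y = x * y"
    "\<one>\<^bsub>mpoly_ring V\<^esub> = (1 :: 'a mpoly)" "\<zero>\<^bsub>mpoly_ring V\<^esub> = (0 :: 'a mpoly)" for x y :: "'a mpoly"
    by (simp_all add: mpoly_ring_def)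
  show ?thesis
  proof (rule cringI)
    show "abelian_group (mpoly_ring V :: 'a mpoly ring)"
    proof (rule abelian_groupI)
      fix x :: "'a mpoly" assume "x \<in> carrier (mpoly_ring V)"
      with neg[OF this] show "\<exists>y\<in>carrier (mpoly_ring V). y \<oplus>\<^bsub>mpoly_ring V\<^esub> x = \<zero>\<^bsub>mpoly_ring V\<^esub>"
        by (intro bexI[of _ "- x"]) (simp_all add: ops)
    qed (simp_all add: add units01 ops ac_simps)
    show "comm_monoid (mpoly_ring V :: 'a mpoly ring)"
      by (rule comm_monoidI) (simp_all add: mult units01 ops ac_simps)
  qed (simp add: ops distrib_right)
qed

lemma module_free_module:
  "module (mpoly_ring V) (free_module V b :: ('a::field mpoly, nat \<Rightarrow> 'a mpoly) module)"
proof -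
  interpret R: cring "mpoly_ring V :: 'a mpoly ring" by (rule cring_mpoly_ring)
  have add: "p + q \<in> carrier (mpoly_ring V)"
    if "p \<in> carrier (mpoly_ring V)" "q \<in> carrier (mpoly_ring V)" for p q :: "'a mpoly"
    using R.a_closed[OF that] by (simp add: mpoly_ring_def)
  have mult: "p * q \<in> carrier (mpoly_ring V)"
    if "p \<in> carrier (mpoly_ring V)" "q \<in> carrier (mpoly_ring V)" for p q :: "'a mpoly"
    using R.m_closed[OF that] by (simp add: mpoly_ring_def)
  have zero: "(0 :: 'a mpoly) \<in> carrier (mpoly_ring V)"
    by (simp add: mpoly_ring_def)
  have neg: "- p \<in> carrier (mpoly_ring V)" if "p \<in> carrier (mpoly_ring V)" for p :: "'a mpoly"
    using that by (simp add: mpoly_ring_def in_keys_iff)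
  have R_simps: "x \<oplus>\<^bsub>mpoly_ring V\<^esub> y = x + y" "x \<otimes>\<^bsub>mpoly_ring V\<^esub> y = x * y"
    "\<one>\<^bsub>mpoly_ring V\<^esub> = (1 :: 'a mpoly)" for x y :: "'a mpoly"
    by (simp_all add: mpoly_ring_def)
  show ?thesis
  proof (rule moduleI)
    show "abelian_group (free_module V b :: ('a mpoly, nat \<Rightarrow> 'a mpoly) module)"
    proof (rule abelian_groupI)
      fix x :: "nat \<Rightarrow> 'a mpoly" assume "x \<in> carrier (free_module V b)"
      with neg show "\<exists>y\<in>carrier (free_module V b). y \<oplus>\<^bsub>free_module V b\<^esub> x = \<zero>\<^bsub>free_module V b\<^esub>"
        by (intro bexI[of _ "\<lambda>j. - x j"]) (auto simp: free_module_def)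
    qed (use add zero in \<open>auto simp: free_module_def algebra_simps\<close>)
  qed (use mult R.cring_axioms in \<open>auto simp: free_module_def R_simps algebra_simps\<close>)
qed

end

theory Submission
  imports Defs "HOL-Library.Function_Algebras"
begin

text \<open>
  Let \<open>R/I\<close> be graded and let \<open>Z\<^sub>i\<close> be its \<open>i\<close>-th syzygy module in a free resolution. For a set
  \<open>W\<close> of indeterminates, \<open>Tor\<^sub>i(R/I, R/(W))\<close> vanishes in degree \<open>j\<close> iff every element of \<open>Z\<^sub>i\<close> of
  degree \<open>j\<close> with coordinates in \<open>(W)\<close> lies in \<open>W Z\<^sub>i\<close>. When an indeterminate is added to \<open>W\<close>, the
  long exact sequence of \<open>Tor\<close> shows that the largest \<open>j - i\<close> with \<open>Tor\<^sub>i \<noteq> 0\<close> in degree \<open>j\<close> does not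
  change. For \<open>W = V\<close> these degrees are the shifts of any minimal resolution, so the regularity can
  be read off from \<open>W = {x\<^sub>n, x\<^bsub>n+1\<^esub>}\<close>. The same vanishing bounds the degrees of the generators of each
  \<open>Z\<^sub>i\<close> and makes \<open>Z\<^sub>i\<close> vanish for \<open>i > n + 1\<close>, so a finite minimal resolution exists.

  For the curve, the condition on \<open>{x\<^sub>n, x\<^bsub>n+1\<^esub>}\<close> speaks about the semigroup of the pairs
  \<open>(v, j)\<close> such that \<open>v\<close> is a sum of at most \<open>j\<close> of the \<open>m\<^sub>i\<close>: the regularity is the least \<open>r\<close>
  such that for \<open>j > r\<close> every such pair \<open>(v, j)\<close> stems from \<open>(v, j - 1)\<close> or \<open>(v - m\<^sub>n, j - 1)\<close>, and
  \<open>(v, j)\<close>, \<open>(v + m\<^sub>n, j)\<close> only both occur if \<open>(v, j - 1)\<close> does. As \<open>h\<close> divides \<open>d\<close>, every attained \<open>v\<close> has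
  a canonical representation whose cost is the least possible \<open>j\<close>; maximising the cost over the
  relevant range gives the formula.
\<close>

subsection \<open>Exponents and polynomials\<close>

text \<open>No complexes or tensor products are formed: each exactness argument for Tor becomes a
  statement about the coordinates of elements of the syzygy modules.

  The indeterminates x_n and x_{n+1} are singled out because they map to u^{m_n} and v^{m_n}, a
  system of parameters of K[C]. The ring is a domain, so one parameter alone is harmless, but for h
  > 1 it is not Cohen-Macaulay: the regularity is attained by a nonzero class of Tor_1 for this
  pair. Of the two semigroup conditions, the first is the vanishing of Tor_0 for the pair; the
  second is that of Tor_1, i.e. that every relation x_n a = x_{n+1} b between monomials is trivial.

  Why h has to divide d: a value v can be rewritten only by trading d copies of m_1 against m_1
  copies of d. This changes the number of copies of m_1 by a multiple of h, so its remainder modulo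
  h is an invariant of v, and the least number of summands has a closed form.\<close>

lemma poly_mapping_sum_keys:
  "p = (\<Sum>t\<in>Poly_Mapping.keys p. Poly_Mapping.single t (Poly_Mapping.lookup p t))"
  by (rule poly_mapping_eqI) (simp add: lookup_sum lookup_single when_def in_keys_iff)

lemma lookup_single_times_add:
  "Poly_Mapping.lookup (Poly_Mapping.single s c * p) (s + t) = c * Poly_Mapping.lookup p t"
  for p :: "'a::field mpoly"
proof -
  have eq: "(s + t = s + q) = (t = q)" for q by simp
  have "Poly_Mapping.lookup (Poly_Mapping.single s c * p) (s + t) =
    (\<Sum>l. (c when s = l) * (\<Sum>q. Poly_Mapping.lookup p q when s + t = l + q))"
    by (simp add: lookup_mult lookup_single)
  also have "\<dots> = (\<Sum>l. c * (\<Sum>q. Poly_Mapping.lookup p q when s + t = l + q) when s = l)"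
    by (simp add: when_mult)
  also have "\<dots> = c * (\<Sum>q. Poly_Mapping.lookup p q when t = q)"
    by (simp only: Sum_any_when_equal' eq)
  also have "\<dots> = c * Poly_Mapping.lookup p t" by simp
  finally show ?thesis .
qed

lemma in_keys_mvar_times_iff:
  "t + Poly_Mapping.single x 1 \<in> Poly_Mapping.keys (mvar x * p) \<longleftrightarrow> t \<in> Poly_Mapping.keys p"
  for p :: "'a::field mpoly"
  using lookup_single_times_add[of "Poly_Mapping.single x 1" 1 p t]
  by (simp add: mvar_def in_keys_iff add.commute)

lemma mvar_times_single:
  "mvar x * Poly_Mapping.single t c = (Poly_Mapping.single (t + Poly_Mapping.single x 1) c :: 'a::field mpoly)"
  by (simp add: mvar_def mult_single add.commute)

lemma keys_add_nat: "Poly_Mapping.keys (s + t) = Poly_Mapping.keys s \<union> Poly_Mapping.keys (t :: nat \<Rightarrow>\<^sub>0 nat)"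
  by (auto simp: in_keys_iff lookup_add)

lemma exponent_split:
  fixes t :: "nat \<Rightarrow>\<^sub>0 nat"
  assumes "x \<in> Poly_Mapping.keys t"
  obtains s where "t = s + Poly_Mapping.single x 1"
proof -
  have "t = (t - Poly_Mapping.single x 1) + Poly_Mapping.single x 1"
    using assms by (intro poly_mapping_eqI) (auto simp: lookup_add lookup_minus lookup_single when_def in_keys_iff)
  then show ?thesis using that by blast
qed

lemma monomial_degree_superset:
  "finite A \<Longrightarrow> Poly_Mapping.keys t \<subseteq> A \<Longrightarrow> monomial_degree t = (\<Sum>i\<in>A. Poly_Mapping.lookup t i)"
  unfolding monomial_degree_def by (rule sum.mono_neutral_left) (auto simp: in_keys_iff)

lemma monomial_degree_add: "monomial_degree (s + t) = monomial_degree s + monomial_degree t"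
proof -
  let ?A = "Poly_Mapping.keys s \<union> Poly_Mapping.keys t"
  have "monomial_degree u = (\<Sum>i\<in>?A. Poly_Mapping.lookup u i)" if "Poly_Mapping.keys u \<subseteq> ?A" for u
    using that by (intro monomial_degree_superset) auto
  then show ?thesis by (simp add: keys_add_nat lookup_add sum.distrib)
qed

lemma monomial_degree_single [simp]: "monomial_degree (Poly_Mapping.single x c) = c"
  by (simp add: monomial_degree_def)

lemma monomial_degree_zero [simp]: "monomial_degree 0 = 0"
  by (simp add: monomial_degree_def)

lemma monomial_degree_eq_0: "monomial_degree t = 0 \<longleftrightarrow> t = 0"
proof
  assume "monomial_degree t = 0"
  then have "\<forall>i\<in>Poly_Mapping.keys t. Poly_Mapping.lookup t i = 0"
    by (simp add: monomial_degree_def)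
  then show "t = 0" by (metis in_keys_iff keys_eq_empty ex_in_conv)
qed simp

lemma finite_exponents:
  assumes "finite V"
  shows "finite {t :: nat \<Rightarrow>\<^sub>0 nat. Poly_Mapping.keys t \<subseteq> V \<and> monomial_degree t = D}"
proof -
  let ?F = "{f. \<forall>i. (i \<in> V \<longrightarrow> f i \<in> {..D}) \<and> (i \<notin> V \<longrightarrow> f i = 0)}"
  have "finite ?F" by (rule finite_set_of_finite_funs) (use assms in auto)
  moreover have "Poly_Mapping.lookup ` {t :: nat \<Rightarrow>\<^sub>0 nat. Poly_Mapping.keys t \<subseteq> V \<and> monomial_degree t = D} \<subseteq> ?F"
  proof clarsimp
    fix t :: "nat \<Rightarrow>\<^sub>0 nat" and i assume t: "Poly_Mapping.keys t \<subseteq> V"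
    have "Poly_Mapping.lookup t i \<le> monomial_degree t" if "i \<in> V"
      unfolding monomial_degree_superset[OF assms t] using that assms by (intro member_le_sum) auto
    then show "(i \<in> V \<longrightarrow> Poly_Mapping.lookup t i \<le> monomial_degree t) \<and> (i \<notin> V \<longrightarrow> Poly_Mapping.lookup t i = 0)"
      using t by (auto simp: in_keys_iff)
  qed
  ultimately show ?thesis
    by (meson finite_subset finite_imageD poly_mapping.lookup_inject inj_onI)
qed

subsection \<open>Polynomials in a set of indeterminates\<close>

abbreviation polys :: "nat set \<Rightarrow> 'a::field mpoly set" where
  "polys V \<equiv> carrier (mpoly_ring V)"

lemma polys_iff: "p \<in> polys V \<longleftrightarrow> (\<forall>t\<in>Poly_Mapping.keys p. Poly_Mapping.keys t \<subseteq> V)"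
  by (simp add: mpoly_ring_def)

lemma mpoly_ring_ops [simp]:
  "x \<oplus>\<^bsub>mpoly_ring V\<^esub> y = x + y" "x \<otimes>\<^bsub>mpoly_ring V\<^esub> y = x * y"
  "\<one>\<^bsub>mpoly_ring V\<^esub> = 1" "\<zero>\<^bsub>mpoly_ring V\<^esub> = 0"
  by (simp_all add: mpoly_ring_def)

lemma polys_add: "p \<in> polys V \<Longrightarrow> q \<in> polys V \<Longrightarrow> p + q \<in> polys V"
  using cring_mpoly_ring[of V] by (metis mpoly_ring_ops(1) cring.cring_simprules(1))

lemma polys_mult: "p \<in> polys V \<Longrightarrow> q \<in> polys V \<Longrightarrow> p * q \<in> polys V"
  using cring_mpoly_ring[of V] by (metis mpoly_ring_ops(2) cring.cring_simprules(5))

lemma polys_zero [simp]: "0 \<in> polys V" and polys_one [simp]: "1 \<in> polys V"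
  by (simp_all add: polys_iff)

lemma polys_uminus: "p \<in> polys V \<Longrightarrow> - p \<in> polys V"
  by (simp add: polys_iff)

lemma polys_diff: "p \<in> polys V \<Longrightarrow> q \<in> polys V \<Longrightarrow> p - q \<in> polys V"
  using polys_add[of p V "- q"] by (simp add: polys_uminus)

lemma polys_sum: "(\<And>i. i \<in> A \<Longrightarrow> p i \<in> polys V) \<Longrightarrow> (\<Sum>i\<in>A. p i) \<in> polys V"
  by (induction A rule: infinite_finite_induct) (simp_all add: polys_add)

lemma polys_single: "Poly_Mapping.keys t \<subseteq> V \<Longrightarrow> Poly_Mapping.single t c \<in> polys V"
  by (simp add: polys_iff)

lemma polys_mvar: "x \<in> V \<Longrightarrow> mvar x \<in> polys V"
  by (simp add: mvar_def polys_single)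

subsection \<open>Homogeneous components\<close>

lemma homogeneous_zero [simp]: "homogeneous k 0"
  by (simp add: homogeneous_def)

lemma homogeneous_add: "homogeneous k p \<Longrightarrow> homogeneous k q \<Longrightarrow> homogeneous k (p + q)"
  using Poly_Mapping.keys_add[of p q] by (auto simp: homogeneous_def)

lemma homogeneous_uminus: "homogeneous k p \<Longrightarrow> homogeneous k (- p)"
  by (simp add: homogeneous_def)

lemma homogeneous_diff: "homogeneous k p \<Longrightarrow> homogeneous k q \<Longrightarrow> homogeneous k (p - q)"
  using homogeneous_add[of k p "- q"] by (simp add: homogeneous_uminus)

lemma homogeneous_sum: "(\<And>i. i \<in> A \<Longrightarrow> homogeneous k (p i)) \<Longrightarrow> homogeneous k (\<Sum>i\<in>A. p i)"
  by (induction A rule: infinite_finite_induct) (simp_all add: homogeneous_add)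

lemma homogeneous_single: "int (monomial_degree t) = k \<Longrightarrow> homogeneous k (Poly_Mapping.single t c)"
  by (simp add: homogeneous_def)

lemma homogeneous_mult: "homogeneous k p \<Longrightarrow> homogeneous l q \<Longrightarrow> homogeneous (k + l) (p * q)"
  using keys_mult[of p q] by (fastforce simp: homogeneous_def monomial_degree_add)

lemma homogeneous_neg: "homogeneous k p \<Longrightarrow> k < 0 \<Longrightarrow> p = 0"
  by (auto simp: homogeneous_def simp flip: keys_eq_empty)

definition hom_part :: "int \<Rightarrow> 'a::field mpoly \<Rightarrow> 'a mpoly" where
  "hom_part k p = (\<Sum>t\<in>{t\<in>Poly_Mapping.keys p. int (monomial_degree t) = k}.
     Poly_Mapping.single t (Poly_Mapping.lookup p t))"

lemma lookup_hom_part: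
  "Poly_Mapping.lookup (hom_part k p) t = (if int (monomial_degree t) = k then Poly_Mapping.lookup p t else 0)"
  by (auto simp: hom_part_def lookup_sum lookup_single when_def in_keys_iff)

lemma keys_hom_part: "Poly_Mapping.keys (hom_part k p) \<subseteq> Poly_Mapping.keys p"
  by (auto simp: in_keys_iff lookup_hom_part split: if_splits)

lemma hom_part_add: "hom_part k (p + q) = hom_part k p + hom_part k q"
  by (rule poly_mapping_eqI) (simp add: lookup_hom_part lookup_add)

lemma hom_part_zero [simp]: "hom_part k 0 = 0"
  by (simp add: hom_part_def)

lemma hom_part_polys: "p \<in> polys V \<Longrightarrow> hom_part k p \<in> polys V"
  using keys_hom_part[of k p] by (auto simp: polys_iff)

lemma homogeneous_hom_part: "homogeneous k (hom_part k p)"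
  by (auto simp: homogeneous_def in_keys_iff lookup_hom_part split: if_splits)

lemma hom_part_homogeneous: "homogeneous l p \<Longrightarrow> hom_part k p = (if k = l then p else 0)"
  by (rule poly_mapping_eqI) (auto simp: lookup_hom_part homogeneous_def in_keys_iff)

subsection \<open>Polynomials in the ideal generated by a set of indeterminates\<close>

definition in_vars :: "nat set \<Rightarrow> 'a::field mpoly \<Rightarrow> bool" where
  "in_vars W p \<longleftrightarrow> (\<forall>t\<in>Poly_Mapping.keys p. Poly_Mapping.keys t \<inter> W \<noteq> {})"

lemma in_vars_zero [simp]: "in_vars W 0"
  by (simp add: in_vars_def)

lemma in_vars_add: "in_vars W p \<Longrightarrow> in_vars W q \<Longrightarrow> in_vars W (p + q)"
  using Poly_Mapping.keys_add[of p q] by (auto simp: in_vars_def)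

lemma in_vars_uminus: "in_vars W p \<Longrightarrow> in_vars W (- p)"
  by (simp add: in_vars_def)

lemma in_vars_diff: "in_vars W p \<Longrightarrow> in_vars W q \<Longrightarrow> in_vars W (p - q)"
  using in_vars_add[of W p "- q"] by (simp add: in_vars_uminus)

lemma in_vars_sum: "(\<And>i. i \<in> A \<Longrightarrow> in_vars W (p i)) \<Longrightarrow> in_vars W (\<Sum>i\<in>A. p i)"
  by (induction A rule: infinite_finite_induct) (simp_all add: in_vars_add)

lemma in_vars_times: "in_vars W p \<Longrightarrow> in_vars W (q * p)"
  using keys_mult[of q p] by (fastforce simp: in_vars_def keys_add_nat)

lemma in_vars_times_right: "in_vars W p \<Longrightarrow> in_vars W (p * q)"
  using in_vars_times[of W p q] by (simp only: mult.commute)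

lemma in_vars_mvar: "x \<in> W \<Longrightarrow> in_vars W (mvar x)"
  by (simp add: mvar_def in_vars_def)

lemma in_vars_mvar_times: "x \<in> W \<Longrightarrow> in_vars W (mvar x * p)"
  by (intro in_vars_times_right in_vars_mvar)

lemma in_vars_mono: "in_vars W p \<Longrightarrow> W \<subseteq> W' \<Longrightarrow> in_vars W' p"
  by (fastforce simp: in_vars_def)

lemma in_vars_empty: "in_vars {} p \<longleftrightarrow> p = 0"
  by (auto simp: in_vars_def simp flip: keys_eq_empty)

text \<open>An indeterminate outside \<open>W\<close> is a nonzerodivisor modulo \<open>(W)\<close>:
  multiplication by it only shifts exponent vectors, and the shift adds no index from
  \<open>W\<close>. All steps that enlarge \<open>W\<close> by one indeterminate rest on
  this.\<close>

lemma in_vars_mvar_cancel: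
  assumes "in_vars W (mvar x * p)" "x \<notin> W"
  shows "in_vars W p"
  unfolding in_vars_def
proof
  fix t assume "t \<in> Poly_Mapping.keys p"
  then have "t + Poly_Mapping.single x 1 \<in> Poly_Mapping.keys (mvar x * p)"
    by (simp only: in_keys_mvar_times_iff)
  with assms show "Poly_Mapping.keys t \<inter> W \<noteq> {}" by (force simp: in_vars_def keys_add_nat)
qed

lemma in_vars_homogeneous:
  assumes "p \<in> polys V" "homogeneous k p" "k \<noteq> 0"
  shows "in_vars V p"
  unfolding in_vars_def
proof
  fix t assume t: "t \<in> Poly_Mapping.keys p"
  with assms have "monomial_degree t \<noteq> 0" by (auto simp: homogeneous_def)
  then have "t \<noteq> 0" by auto
  then have "Poly_Mapping.keys t \<noteq> {}" by simp
  moreover have "Poly_Mapping.keys t \<subseteq> V" using t assms by (simp add: polys_iff)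
  ultimately show "Poly_Mapping.keys t \<inter> V \<noteq> {}" by blast
qed

text \<open>The monomials divisible by \<open>x\<close> go into \<open>mvar x * g\<close>; each of
  the others must contain an indeterminate of \<open>W\<close>. Sorting monomials keeps both parts
  homogeneous.\<close>

lemma in_vars_insert_decompose:
  assumes p: "p \<in> polys V" "homogeneous k p" "in_vars (insert x W) p"
  obtains g w where "p = mvar x * g + w" "g \<in> polys V" "homogeneous (k - 1) g"
    "w \<in> polys V" "homogeneous k w" "in_vars W w"
proof -
  define A where "A = {t \<in> Poly_Mapping.keys p. x \<in> Poly_Mapping.keys t}"
  define s where "s = (\<lambda>t. Poly_Mapping.single t (Poly_Mapping.lookup p t))"
  define g where "g = (\<Sum>t\<in>A. Poly_Mapping.single (t - Poly_Mapping.single x 1) (Poly_Mapping.lookup p t))"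
  define w where "w = (\<Sum>t\<in>Poly_Mapping.keys p - A. s t)"
  have split: "t = (t - Poly_Mapping.single x 1) + Poly_Mapping.single x 1" if "t \<in> A" for t
    using that unfolding A_def by (elim CollectE conjE exponent_split) simp
  have "mvar x * g = (\<Sum>t\<in>A. s t)"
    unfolding g_def s_def sum_distrib_left mvar_times_single using split by (intro sum.cong) auto
  moreover have "p = (\<Sum>t\<in>A. s t) + w"
    unfolding w_def by (subst poly_mapping_sum_keys, subst sum.subset_diff[of A])
      (auto simp: A_def s_def)
  ultimately have "p = mvar x * g + w" by simp
  moreover have "g \<in> polys V"
    unfolding g_def
  proof (intro polys_sum polys_single)
    fix t assume t: "t \<in> A"
    then have "Poly_Mapping.keys t \<subseteq> V" using p by (simp add: A_def polys_iff)
    with split[OF t] show "Poly_Mapping.keys (t - Poly_Mapping.single x 1) \<subseteq> V"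
      by (metis keys_add_nat Un_subset_iff)
  qed
  moreover have "homogeneous (k - 1) g"
    unfolding g_def
  proof (intro homogeneous_sum homogeneous_single)
    fix t assume t: "t \<in> A"
    then have "int (monomial_degree t) = k" using p by (simp add: A_def homogeneous_def)
    moreover have "monomial_degree t = monomial_degree (t - Poly_Mapping.single x 1) + 1"
      using arg_cong[OF split[OF t], of monomial_degree] by (simp add: monomial_degree_add)
    ultimately show "int (monomial_degree (t - Poly_Mapping.single x 1)) = k - 1" by simp
  qed
  moreover have "w \<in> polys V"
    unfolding w_def s_def using p by (intro polys_sum polys_single) (auto simp: polys_iff)
  moreover have "homogeneous k w"
    unfolding w_def s_def using p by (intro homogeneous_sum homogeneous_single) (auto simp: homogeneous_def)
  moreover have "in_vars W w"
    unfolding w_def s_def using p by (intro in_vars_sum) (auto simp: in_vars_def A_def)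
  ultimately show ?thesis using that by blast
qed

text \<open>Bridge between the generated ideal, in which minimality is phrased, and the monomialwise
  predicate \<open>in_vars\<close>: a polynomial lies in a monomial ideal iff each of its monomials
  does.\<close>

lemma genideal_mvar:
  assumes "W \<subseteq> V" and "finite V"
  shows "Idl\<^bsub>mpoly_ring V\<^esub> (mvar ` W) = {p \<in> polys V. in_vars W (p :: 'a::field mpoly)}"
proof -
  interpret R: cring "mpoly_ring V :: 'a mpoly ring" by (rule cring_mpoly_ring)
  have sub: "mvar ` W \<subseteq> (polys V :: 'a mpoly set)" using assms by (auto intro: polys_mvar)
  interpret J: ideal "Idl\<^bsub>mpoly_ring V\<^esub> (mvar ` W)" "mpoly_ring V :: 'a mpoly ring"
    by (rule R.genideal_ideal[OF sub])
  have id: "ideal {p \<in> polys V. in_vars W (p :: 'a mpoly)} (mpoly_ring V)"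
  proof (rule idealI[OF R.ring_axioms])
    have inv: "\<ominus>\<^bsub>mpoly_ring V\<^esub> p = - p" if "p \<in> polys V" for p :: "'a mpoly"
      using that R.minus_equality[of "- p" p] by (simp add: polys_uminus)
    show "subgroup {p \<in> polys V. in_vars W (p :: 'a mpoly)} (add_monoid (mpoly_ring V))"
    proof (rule R.add.subgroupI)
      show "{p \<in> polys V. in_vars W (p :: 'a mpoly)} \<noteq> {}"
        by (auto intro: exI[of _ 0])
    qed (auto simp: inv a_inv_def[symmetric] in_vars_uminus polys_uminus in_vars_add polys_add)
  qed (auto simp: polys_mult in_vars_times in_vars_times_right)
  have "mvar ` W \<subseteq> {p \<in> polys V. in_vars W (p :: 'a mpoly)}"
    using assms by (auto intro: polys_mvar in_vars_mvar)
  then have "Idl\<^bsub>mpoly_ring V\<^esub> (mvar ` W) \<subseteq> {p \<in> polys V. in_vars W (p :: 'a mpoly)}"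
    by (rule R.genideal_minimal[OF id])
  moreover have "p \<in> Idl\<^bsub>mpoly_ring V\<^esub> (mvar ` W)" if p: "p \<in> polys V" "in_vars W p" for p :: "'a mpoly"
  proof -
    have mono: "Poly_Mapping.single t c \<in> Idl\<^bsub>mpoly_ring V\<^esub> (mvar ` W)"
      if t: "t \<in> Poly_Mapping.keys p" for t and c :: 'a
    proof -
      from p t obtain x where x: "x \<in> Poly_Mapping.keys t" "x \<in> W" by (fastforce simp: in_vars_def)
      then obtain s where s: "t = s + Poly_Mapping.single x 1" using exponent_split by blast
      have "Poly_Mapping.keys s \<subseteq> Poly_Mapping.keys t" using s by (auto simp: keys_add_nat)
      then have "Poly_Mapping.keys s \<subseteq> V" using p(1) t by (auto simp: polys_iff)
      then have "mvar x \<otimes>\<^bsub>mpoly_ring V\<^esub> Poly_Mapping.single s c \<in> Idl\<^bsub>mpoly_ring V\<^esub> (mvar ` W)"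
        using R.genideal_self[OF sub] x by (intro J.I_r_closed) (auto intro: polys_single)
      then show ?thesis by (simp add: s mvar_times_single)
    qed
    have "(\<Sum>t\<in>A. Poly_Mapping.single t (Poly_Mapping.lookup p t)) \<in> Idl\<^bsub>mpoly_ring V\<^esub> (mvar ` W)"
      if "A \<subseteq> Poly_Mapping.keys p" for A
      using finite_subset[OF that finite_keys] that
    proof (induction A rule: finite_induct)
      case empty
      then show ?case using J.zero_closed by simp
    next
      case (insert t A)
      then show ?case using J.a_closed[OF mono[of t]] by simp
    qed
    from this[OF subset_refl] show ?thesis by (simp only: poly_mapping_sum_keys[symmetric])
  qed
  ultimately show ?thesis by blast
qed

subsection \<open>Graded free modules\<close>

abbreviation frees :: "nat set \<Rightarrow> nat \<Rightarrow> (nat \<Rightarrow> 'a::field mpoly) set" where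
  "frees V b \<equiv> carrier (free_module V b)"

definition vscale :: "'a::field mpoly \<Rightarrow> (nat \<Rightarrow> 'a mpoly) \<Rightarrow> (nat \<Rightarrow> 'a mpoly)" where
  "vscale a f = (\<lambda>j. a * f j)"

lemma vscale_apply [simp]: "vscale a f j = a * f j"
  by (simp add: vscale_def)

lemma vscale_simps:
  "vscale a (f + g) = vscale a f + vscale a g" "vscale a (f - g) = vscale a f - vscale a g"
  "vscale (a + b) f = vscale a f + vscale b f" "vscale a (vscale b f) = vscale (a * b) f"
  "vscale 1 f = f" "vscale 0 f = 0" "vscale a 0 = 0"
  by (auto simp: fun_eq_iff algebra_simps)

lemma sum_fun_apply: "(\<Sum>i\<in>A. f i) x = (\<Sum>i\<in>A. f i x)"
  by (induction A rule: infinite_finite_induct) simp_all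

lemma vscale_sum: "vscale a (\<Sum>i\<in>A. f i) = (\<Sum>i\<in>A. vscale a (f i))"
  by (auto simp: fun_eq_iff sum_fun_apply sum_distrib_left)

lemma frees_iff: "f \<in> frees V b \<longleftrightarrow> (\<forall>j. f j \<in> polys V) \<and> (\<forall>j\<ge>b. f j = 0)"
  unfolding free_module_def by simp (metis linorder_not_le polys_zero)

lemma free_module_ops [simp]:
  "f \<oplus>\<^bsub>free_module V b\<^esub> g = f + g" "\<zero>\<^bsub>free_module V b\<^esub> = 0"
  "a \<odot>\<^bsub>free_module V b\<^esub> f = vscale a f"
  by (simp_all add: free_module_def fun_eq_iff)

lemma frees_zero [simp]: "0 \<in> frees V b"
  by (simp add: frees_iff)

lemma frees_add: "f \<in> frees V b \<Longrightarrow> g \<in> frees V b \<Longrightarrow> f + g \<in> frees V b"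
  by (simp add: frees_iff polys_add)

lemma frees_diff: "f \<in> frees V b \<Longrightarrow> g \<in> frees V b \<Longrightarrow> f - g \<in> frees V b"
  by (simp add: frees_iff polys_diff)

lemma frees_vscale: "a \<in> polys V \<Longrightarrow> f \<in> frees V b \<Longrightarrow> vscale a f \<in> frees V b"
  by (simp add: frees_iff polys_mult)

lemma frees_sum: "(\<And>i. i \<in> A \<Longrightarrow> f i \<in> frees V b) \<Longrightarrow> (\<Sum>i\<in>A. f i) \<in> frees V b"
  by (induction A rule: infinite_finite_induct) (simp_all add: frees_add)

lemma graded_component_iff:
  "f \<in> graded_component V es k \<longleftrightarrow>
    f \<in> frees V (length es) \<and> (\<forall>j<length es. homogeneous (k - es ! j) (f j))"
  by (simp add: graded_component_def)

lemma graded_component_frees: "f \<in> graded_component V es k \<Longrightarrow> f \<in> frees V (length es)"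
  by (simp add: graded_component_iff)

lemma graded_component_zero [simp]: "0 \<in> graded_component V es k"
  by (simp add: graded_component_iff)

lemma graded_component_add:
  "f \<in> graded_component V es k \<Longrightarrow> g \<in> graded_component V es k \<Longrightarrow> f + g \<in> graded_component V es k"
  by (simp add: graded_component_iff frees_add homogeneous_add)

lemma graded_component_diff:
  "f \<in> graded_component V es k \<Longrightarrow> g \<in> graded_component V es k \<Longrightarrow> f - g \<in> graded_component V es k"
  by (simp add: graded_component_iff frees_diff homogeneous_diff)

lemma graded_component_vscale:
  assumes "a \<in> polys V" "homogeneous l a" "f \<in> graded_component V es k"
  shows "vscale a f \<in> graded_component V es (l + k)"
  using assms homogeneous_mult[of l a]
  by (fastforce simp: graded_component_iff frees_vscale add_diff_eq[symmetric])

lemma graded_component_mvar: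
  assumes "x \<in> V" "f \<in> graded_component V es (k - 1)"
  shows "vscale (mvar x) f \<in> graded_component V es k"
  using graded_component_vscale[OF polys_mvar[OF assms(1)] _ assms(2), of 1]
  by (simp add: mvar_def homogeneous_single)

definition vec_part :: "int list \<Rightarrow> int \<Rightarrow> (nat \<Rightarrow> 'a::field mpoly) \<Rightarrow> (nat \<Rightarrow> 'a mpoly)" where
  "vec_part es k f = (\<lambda>j. if j < length es then hom_part (k - es ! j) (f j) else 0)"

lemma vec_part_graded: "f \<in> frees V (length es) \<Longrightarrow> vec_part es k f \<in> graded_component V es k"
  by (simp add: graded_component_iff frees_iff vec_part_def hom_part_polys homogeneous_hom_part)

lemma vec_part_of_graded:
  "f \<in> graded_component V es l \<Longrightarrow> vec_part es k f = (if k = l then f else 0)"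
  by (auto simp: graded_component_iff frees_iff vec_part_def fun_eq_iff hom_part_homogeneous)

lemma vec_part_zero [simp]: "vec_part es k 0 = 0"
  by (simp add: vec_part_def fun_eq_iff)

lemma vec_part_sum: "vec_part es k (\<Sum>i\<in>A. f i :: nat \<Rightarrow> 'a::field mpoly) = (\<Sum>i\<in>A. vec_part es k (f i))"
proof -
  have "hom_part l (\<Sum>i\<in>A. p i) = (\<Sum>i\<in>A. hom_part l (p i))" for l and p :: "_ \<Rightarrow> 'a::field mpoly"
    by (induction A rule: infinite_finite_induct) (simp_all add: hom_part_add)
  then show ?thesis by (simp add: vec_part_def fun_eq_iff sum_fun_apply)
qed

lemma sum_vec_part:
  assumes "f \<in> frees V (length es)"
  obtains K where "finite K" "f = (\<Sum>k\<in>K. vec_part es k f)"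
proof -
  define K where "K = (\<Union>j<length es. (\<lambda>t. int (monomial_degree t) + es ! j) ` Poly_Mapping.keys (f j))"
  have fin: "finite K" by (simp add: K_def)
  have "f j = (\<Sum>k\<in>K. vec_part es k f j)" for j
  proof (cases "j < length es")
    case True
    show ?thesis
    proof (rule poly_mapping_eqI)
      fix t
      have "(\<Sum>k\<in>K. Poly_Mapping.lookup (hom_part (k - es ! j) (f j)) t) =
        (\<Sum>k\<in>K. if int (monomial_degree t) + es ! j = k then Poly_Mapping.lookup (f j) t else 0)"
        by (intro sum.cong) (auto simp: lookup_hom_part)
      also have "\<dots> = (if int (monomial_degree t) + es ! j \<in> K then Poly_Mapping.lookup (f j) t else 0)"
        using fin by simp
      also have "\<dots> = Poly_Mapping.lookup (f j) t"
        using True by (force simp: K_def in_keys_iff)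
      finally show "Poly_Mapping.lookup (f j) t = Poly_Mapping.lookup (\<Sum>k\<in>K. vec_part es k f j) t"
        using True by (simp add: lookup_sum vec_part_def)
    qed
  next
    case False
    then show ?thesis using assms by (simp add: vec_part_def frees_iff)
  qed
  then have "f = (\<Sum>k\<in>K. vec_part es k f)" by (simp add: fun_eq_iff sum_fun_apply)
  with fin that show ?thesis by blast
qed

lemma vec_in_vars_decompose:
  assumes f: "f \<in> graded_component V es k" "\<forall>l. in_vars (insert x W) (f l)"
  obtains g w where "f = vscale (mvar x) g + w" "g \<in> graded_component V es (k - 1)"
    "w \<in> graded_component V es k" "\<forall>l. in_vars W (w l)"
proof -
  have "\<exists>g w. f l = mvar x * g + w \<and> g \<in> polys V \<and> homogeneous (k - 1 - es ! l) g \<and>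
      w \<in> polys V \<and> homogeneous (k - es ! l) w \<and> in_vars W w" if l: "l < length es" for l
  proof -
    have "f l \<in> polys V" "homogeneous (k - es ! l) (f l)"
      using f(1) l by (simp_all add: graded_component_iff frees_iff)
    then obtain g w where "f l = mvar x * g + w" "g \<in> polys V" "homogeneous (k - es ! l - 1) g"
      "w \<in> polys V" "homogeneous (k - es ! l) w" "in_vars W w"
      using in_vars_insert_decompose f(2) by blast
    moreover have "k - es ! l - 1 = k - 1 - es ! l" by simp
    ultimately show ?thesis by metis
  qed
  then obtain g w where gw: "\<And>l. l < length es \<Longrightarrow> f l = mvar x * g l + w l \<and> g l \<in> polys V \<and>
      homogeneous (k - 1 - es ! l) (g l) \<and> w l \<in> polys V \<and> homogeneous (k - es ! l) (w l) \<and> in_vars W (w l)"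
    by metis
  define g' where "g' l = (if l < length es then g l else 0)" for l
  define w' where "w' l = (if l < length es then w l else 0)" for l
  have "f = vscale (mvar x) g' + w'"
    using gw f(1) by (auto simp: fun_eq_iff g'_def w'_def graded_component_iff frees_iff)
  moreover have "g' \<in> graded_component V es (k - 1)" "w' \<in> graded_component V es k"
    using gw by (auto simp: g'_def w'_def graded_component_iff frees_iff)
  moreover have "\<forall>l. in_vars W (w' l)" using gw by (simp add: w'_def)
  ultimately show ?thesis using that by blast
qed

subsection \<open>Multiples of indeterminates in graded submodules\<close>

text \<open>For a graded submodule \<open>Z\<close> and finite \<open>W\<close> this is the degree
  \<open>j\<close> component of \<open>(W) Z\<close>. For such \<open>Z\<close> the homogeneity
  demanded of the factors is no restriction, and it keeps all constructions inside graded
  components.\<close>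

definition var_multiples ::
  "nat set \<Rightarrow> int list \<Rightarrow> nat set \<Rightarrow> (nat \<Rightarrow> 'a::field mpoly) set \<Rightarrow> int \<Rightarrow> (nat \<Rightarrow> 'a mpoly) set" where
  "var_multiples V es W Z j =
    {f. \<exists>z. (\<forall>w\<in>W. z w \<in> Z \<inter> graded_component V es (j - 1)) \<and> f = (\<Sum>w\<in>W. vscale (mvar w) (z w))}"

text \<open>
  For the \<open>i\<close>-th syzygy module \<open>Z\<close> of \<open>R/I\<close>, this says that \<open>Tor\<^sub>i(R/I, R/(W))\<close> vanishes in
  degree \<open>j\<close>.
\<close>

definition tight ::
  "nat set \<Rightarrow> int list \<Rightarrow> (nat \<Rightarrow> 'a::field mpoly) set \<Rightarrow> nat set \<Rightarrow> int \<Rightarrow> bool" where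
  "tight V es Z W j \<longleftrightarrow> (\<forall>f\<in>Z \<inter> graded_component V es j. (\<forall>l. in_vars W (f l)) \<longrightarrow> f \<in> var_multiples V es W Z j)"

lemma var_multiples_insert:
  assumes "finite W" "x \<notin> W"
  shows "f \<in> var_multiples V es (insert x W) Z j \<longleftrightarrow>
    (\<exists>z\<in>Z \<inter> graded_component V es (j - 1). \<exists>g\<in>var_multiples V es W Z j. f = vscale (mvar x) z + g)"
    (is "_ \<longleftrightarrow> ?R")
proof
  assume "f \<in> var_multiples V es (insert x W) Z j"
  then obtain z where z: "\<forall>w\<in>insert x W. z w \<in> Z \<inter> graded_component V es (j - 1)"
    "f = (\<Sum>w\<in>insert x W. vscale (mvar w) (z w))" by (auto simp: var_multiples_def)
  have "f = vscale (mvar x) (z x) + (\<Sum>w\<in>W. vscale (mvar w) (z w))" using z assms by simp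
  moreover have "(\<Sum>w\<in>W. vscale (mvar w) (z w)) \<in> var_multiples V es W Z j"
    using z by (auto simp: var_multiples_def)
  ultimately show ?R using z by blast
next
  assume ?R
  then obtain z\<^sub>0 z where z: "z\<^sub>0 \<in> Z \<inter> graded_component V es (j - 1)"
    "\<forall>w\<in>W. z w \<in> Z \<inter> graded_component V es (j - 1)"
    "f = vscale (mvar x) z\<^sub>0 + (\<Sum>w\<in>W. vscale (mvar w) (z w))" by (auto simp: var_multiples_def)
  let ?z = "z(x := z\<^sub>0)"
  have "(\<Sum>w\<in>W. vscale (mvar w) (?z w)) = (\<Sum>w\<in>W. vscale (mvar w) (z w))"
    using assms by (intro sum.cong) auto
  then have "f = (\<Sum>w\<in>insert x W. vscale (mvar w) (?z w))" using z assms by simp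
  moreover have "\<forall>w\<in>insert x W. ?z w \<in> Z \<inter> graded_component V es (j - 1)" using z by auto
  ultimately show "f \<in> var_multiples V es (insert x W) Z j" unfolding var_multiples_def by blast
qed

lemma var_multiples_empty: "var_multiples V es {} Z j = {0}"
  by (auto simp: var_multiples_def)

lemma tight_empty: "tight V es Z {} j"
  by (auto simp: tight_def var_multiples_empty in_vars_empty fun_eq_iff)

section \<open>Degree-preserving maps of free modules\<close>

locale graded_map =
  fixes V :: "nat set" and es es' :: "int list"
    and \<phi> :: "(nat \<Rightarrow> 'a::field mpoly) \<Rightarrow> (nat \<Rightarrow> 'a mpoly)"
  assumes graded_hom: "graded_hom V es es' \<phi>"
begin

lemma closed: "f \<in> frees V (length es) \<Longrightarrow> \<phi> f \<in> frees V (length es')"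
  using graded_hom unfolding graded_hom_def mod_hom_def mod_hom_axioms_def module_hom_def by auto

lemma map_add: "f \<in> frees V (length es) \<Longrightarrow> g \<in> frees V (length es) \<Longrightarrow> \<phi> (f + g) = \<phi> f + \<phi> g"
  using graded_hom unfolding graded_hom_def mod_hom_def mod_hom_axioms_def module_hom_def by auto

lemma map_vscale: "a \<in> polys V \<Longrightarrow> f \<in> frees V (length es) \<Longrightarrow> \<phi> (vscale a f) = vscale a (\<phi> f)"
  using graded_hom unfolding graded_hom_def mod_hom_def mod_hom_axioms_def module_hom_def by auto

lemma map_graded: "f \<in> graded_component V es k \<Longrightarrow> \<phi> f \<in> graded_component V es' k"
  using graded_hom unfolding graded_hom_def by blast

lemma map_zero [simp]: "\<phi> 0 = 0"
  using map_vscale[of 0 0] by (simp add: vscale_simps)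

lemma map_diff:
  assumes "f \<in> frees V (length es)" "g \<in> frees V (length es)"
  shows "\<phi> (f - g) = \<phi> f - \<phi> g"
  using map_add[of "f - g" g] assms by (simp add: frees_diff algebra_simps)

lemma map_sum: "(\<And>i. i \<in> A \<Longrightarrow> f i \<in> frees V (length es)) \<Longrightarrow> \<phi> (\<Sum>i\<in>A. f i) = (\<Sum>i\<in>A. \<phi> (f i))"
  by (induction A rule: infinite_finite_induct) (simp_all add: map_add frees_sum)

lemma map_vec_part:
  assumes f: "f \<in> frees V (length es)"
  shows "\<phi> (vec_part es k f) = vec_part es' k (\<phi> f)"
proof -
  obtain K where K: "finite K" "f = (\<Sum>k\<in>K. vec_part es k f)" using sum_vec_part[OF f] by blast
  have gr: "vec_part es l f \<in> graded_component V es l" for l by (rule vec_part_graded[OF f])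
  have "vec_part es' k (\<phi> f) = vec_part es' k (\<phi> (\<Sum>l\<in>K. vec_part es l f))" using K(2) by simp
  also have "\<dots> = (\<Sum>l\<in>K. vec_part es' k (\<phi> (vec_part es l f)))"
    by (subst map_sum) (simp_all only: vec_part_sum graded_component_frees[OF gr])
  also have "\<dots> = (\<Sum>l\<in>K. \<phi> (if k = l then vec_part es l f else 0))"
    by (intro sum.cong) (simp_all add: vec_part_of_graded[OF map_graded[OF gr]])
  also have "\<dots> = \<phi> (\<Sum>l\<in>K. if k = l then vec_part es l f else 0)"
    by (subst map_sum) (simp_all add: graded_component_frees[OF gr])
  also have "\<dots> = \<phi> (\<Sum>l\<in>K. vec_part es k (vec_part es l f))"
    by (intro arg_cong[of _ _ \<phi>] sum.cong) (simp_all add: vec_part_of_graded[OF gr])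
  also have "\<dots> = \<phi> (vec_part es k f)" using K(2) by (simp flip: vec_part_sum)
  finally show ?thesis by simp
qed

text \<open>The part of degree \<open>k\<close> of an arbitrary preimage will do, since a graded map
  commutes with the projections.\<close>

lemma graded_preimage:
  assumes "f \<in> \<phi> ` frees V (length es)" "f \<in> graded_component V es' k"
  obtains g where "g \<in> graded_component V es k" "f = \<phi> g"
proof -
  from assms obtain g where g: "g \<in> frees V (length es)" "f = \<phi> g" by blast
  have "\<phi> (vec_part es k g) = f"
    using map_vec_part[OF g(1)] vec_part_of_graded[OF assms(2)] g(2) by simp
  then show ?thesis using that vec_part_graded[OF g(1)] by blast
qed

text \<open>For a free module \<open>F\<close>, \<open>(W) F\<close> consists of the vectors with
  coordinates in \<open>(W)\<close>; applying \<open>\<phi>\<close> gives the claim. It turns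
  membership in \<open>W Z\<close> into the choice of a suitable preimage.\<close>

lemma var_multiples_image:
  assumes "finite W" "W \<subseteq> V"
  shows "f \<in> var_multiples V es' W (\<phi> ` frees V (length es)) j \<longleftrightarrow>
    (\<exists>g\<in>graded_component V es j. (\<forall>l. in_vars W (g l)) \<and> f = \<phi> g)"
  using assms
proof (induction W arbitrary: f rule: finite_induct)
  case empty
  have "(\<forall>l. in_vars {} (g l)) \<longleftrightarrow> g = 0" for g by (auto simp: in_vars_empty fun_eq_iff)
  then have "(\<exists>g\<in>graded_component V es j. (\<forall>l. in_vars {} (g l)) \<and> f = \<phi> g) \<longleftrightarrow> f = 0"
    using map_zero graded_component_zero by metis
  then show ?case by (simp only: var_multiples_empty singleton_iff)
next
  case (insert x W)
  then have x: "x \<in> V" by simp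
  show ?case (is "?L \<longleftrightarrow> ?R")
  proof
    assume ?L
    then obtain z f' where z: "z \<in> \<phi> ` frees V (length es)" "z \<in> graded_component V es' (j - 1)"
      "f' \<in> var_multiples V es' W (\<phi> ` frees V (length es)) j" "f = vscale (mvar x) z + f'"
      unfolding var_multiples_insert[OF insert.hyps] by blast
    obtain g where g: "g \<in> graded_component V es (j - 1)" "z = \<phi> g"
      using graded_preimage z by blast
    obtain g' where g': "g' \<in> graded_component V es j" "\<forall>l. in_vars W (g' l)" "f' = \<phi> g'"
      using insert z(3) by auto
    have xg: "vscale (mvar x) g \<in> graded_component V es j" by (rule graded_component_mvar[OF x g(1)])
    have "f = \<phi> (vscale (mvar x) g + g')"
      using z(4) g g' xg x by (simp add: map_add map_vscale graded_component_frees polys_mvar)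
    moreover have "\<forall>l. in_vars (insert x W) ((vscale (mvar x) g + g') l)"
      using g'(2) by (auto intro!: in_vars_add in_vars_mvar_times intro: in_vars_mono)
    moreover have "vscale (mvar x) g + g' \<in> graded_component V es j"
      using xg g' by (simp add: graded_component_add)
    ultimately show ?R by blast
  next
    assume ?R
    then obtain g where g: "g \<in> graded_component V es j" "\<forall>l. in_vars (insert x W) (g l)" "f = \<phi> g"
      by blast
    obtain g' w where gw: "g = vscale (mvar x) g' + w" "g' \<in> graded_component V es (j - 1)"
      "w \<in> graded_component V es j" "\<forall>l. in_vars W (w l)"
      using vec_in_vars_decompose[OF g(1,2)] by blast
    have "\<phi> w \<in> var_multiples V es' W (\<phi> ` frees V (length es)) j"
      using insert gw by auto
    moreover have "f = vscale (mvar x) (\<phi> g') + \<phi> w"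
      using g gw x graded_component_mvar[OF x gw(2)]
      by (simp add: map_add map_vscale graded_component_frees polys_mvar)
    moreover have "\<phi> g' \<in> \<phi> ` frees V (length es) \<inter> graded_component V es' (j - 1)"
      using gw(2) map_graded graded_component_frees by blast
    ultimately show ?L unfolding var_multiples_insert[OF insert.hyps] by blast
  qed
qed

end

lemma graded_homI:
  assumes "\<And>f. f \<in> frees V (length es) \<Longrightarrow> \<phi> f \<in> frees V (length es')"
    and "\<And>f g. f \<in> frees V (length es) \<Longrightarrow> g \<in> frees V (length es) \<Longrightarrow> \<phi> (f + g) = \<phi> f + \<phi> g"
    and "\<And>a f. a \<in> polys V \<Longrightarrow> f \<in> frees V (length es) \<Longrightarrow> \<phi> (vscale a f) = vscale a (\<phi> f)"
    and "\<And>f k. f \<in> graded_component V es k \<Longrightarrow> \<phi> f \<in> graded_component V es' k"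
  shows "graded_hom V es es' (\<phi> :: (nat \<Rightarrow> 'a::field mpoly) \<Rightarrow> _)"
  unfolding graded_hom_def mod_hom_def mod_hom_axioms_def module_hom_def
  using assms by (auto simp: module_free_module)

lemma var_multiples_frees:
  assumes "finite W" "W \<subseteq> V"
  shows "f \<in> var_multiples V es W (frees V (length es)) j \<longleftrightarrow>
    f \<in> graded_component V es j \<and> (\<forall>l. in_vars W (f l :: 'a::field mpoly))"
proof -
  interpret graded_map V es es "\<lambda>f. f :: nat \<Rightarrow> 'a mpoly"
    by unfold_locales (rule graded_homI, auto)
  show ?thesis using var_multiples_image[OF assms, of f j] by auto
qed

lemma var_multiples_in_vars:
  assumes "f \<in> var_multiples V es W Z j" "finite W" "W \<subseteq> V"
  shows "f \<in> graded_component V es j" "\<forall>l. in_vars W (f l :: 'a::field mpoly)"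
proof -
  have "f \<in> var_multiples V es W (frees V (length es)) j"
    using assms(1) graded_component_frees unfolding var_multiples_def by blast
  then show "f \<in> graded_component V es j" "\<forall>l. in_vars W (f l)"
    using var_multiples_frees[OF assms(2,3)] by blast+
qed

section \<open>The long exact sequence of Tor on elements\<close>

context graded_map begin

definition ker :: "(nat \<Rightarrow> 'a mpoly) set" where
  "ker = {f \<in> frees V (length es). \<phi> f = 0}"

abbreviation im :: "(nat \<Rightarrow> 'a mpoly) set" where
  "im \<equiv> \<phi> ` frees V (length es)"

lemma map_in_vars:
  assumes "finite W" "W \<subseteq> V" "f \<in> graded_component V es k" "\<forall>l. in_vars W (f l)"
  shows "in_vars W (\<phi> f l)"
proof -
  have "\<phi> f \<in> var_multiples V es' W im k"
    using assms by (subst var_multiples_image) auto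
  then show ?thesis using var_multiples_in_vars(2)[of "\<phi> f"] assms by blast
qed

text \<open>Let T_i(W) be Tor_i(R/I, R/(W)), with \<open>im\<close> the i-th syzygy module and
  \<open>ker\<close> the next one. This is exactness of T_{i+1}(W)_j -> T_{i+1}(W,x)_j ->
  T_i(W)_{j-1} when both outer terms vanish.\<close>

lemma tight_ker_insert:
  assumes W: "finite W" "W \<subseteq> V" and x: "x \<in> V" "x \<notin> W"
    and K: "tight V es ker W j" and Z: "tight V es' im W (j - 1)"
  shows "tight V es ker (insert x W) j"
  unfolding tight_def
proof (intro ballI impI)
  fix f assume f: "f \<in> ker \<inter> graded_component V es j" "\<forall>l. in_vars (insert x W) (f l)"
  then obtain g w where gw: "f = vscale (mvar x) g + w" "g \<in> graded_component V es (j - 1)"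
      "w \<in> graded_component V es j" "\<forall>l. in_vars W (w l)"
    using vec_in_vars_decompose by blast
  note fr = graded_component_frees
  have xg: "vscale (mvar x) g \<in> graded_component V es j" by (rule graded_component_mvar[OF x(1) gw(2)])
  have "vscale (mvar x) (\<phi> g) + \<phi> w = 0"
    using f(1) gw xg x by (simp add: ker_def map_add map_vscale fr polys_mvar)
  then have "mvar x * \<phi> g l = - \<phi> w l" for l
    by (metis add_eq_0_iff2 fun_Compl_def plus_fun_apply vscale_apply zero_fun_apply)
  then have "in_vars W (mvar x * \<phi> g l)" for l
    using map_in_vars[OF W gw(3,4)] by (simp add: in_vars_uminus)
  then have "\<forall>l. in_vars W (\<phi> g l)" using in_vars_mvar_cancel x(2) by blast
  moreover have "\<phi> g \<in> im \<inter> graded_component V es' (j - 1)"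
    using gw(2) map_graded fr by blast
  ultimately have "\<phi> g \<in> var_multiples V es' W im (j - 1)" using Z by (auto simp: tight_def)
  then obtain w' where w': "w' \<in> graded_component V es (j - 1)" "\<forall>l. in_vars W (w' l)" "\<phi> g = \<phi> w'"
    using var_multiples_image[OF W] by blast
  \<comment> \<open>\<open>g\<close> need not lie in \<open>ker\<close>. Subtracting
    \<open>w'\<close>, which has the same image and coordinates in \<open>(W)\<close>, gives a
    kernel element and moves the error into \<open>u\<close>.\<close>
  define z where "z = g - w'"
  have z: "z \<in> ker" "z \<in> graded_component V es (j - 1)"
    using gw w' by (auto simp: z_def ker_def graded_component_diff frees_diff map_diff fr)
  define u where "u = vscale (mvar x) w' + w"
  have u: "u \<in> graded_component V es j"
    unfolding u_def by (intro graded_component_add graded_component_mvar x w' gw)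
  have fu: "f = vscale (mvar x) z + u" by (simp add: z_def u_def gw(1) vscale_simps)
  have "\<phi> f = vscale (mvar x) (\<phi> z) + \<phi> u"
    unfolding fu using z u x graded_component_mvar[OF x(1) z(2)]
    by (simp add: map_add map_vscale fr polys_mvar)
  then have "u \<in> ker" using f(1) z(1) u by (simp add: ker_def fr vscale_simps)
  moreover have "\<forall>l. in_vars W (u l)"
    using w'(2) gw(4) by (simp add: u_def in_vars_add in_vars_times)
  ultimately have "u \<in> var_multiples V es W ker j" using K u by (auto simp: tight_def)
  then show "f \<in> var_multiples V es (insert x W) ker j"
    unfolding var_multiples_insert[OF W(1) x(2)] using z fu by blast
qed

text \<open>Exactness of T_{i+1}(W,x)_{j+1} -> T_i(W)_j -> T_i(W)_{j+1}: the last term vanishes, so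
  a nonzero class of degree \<open>j\<close> comes from the first. Homological and internal degree
  both rise by one, and their difference is kept.\<close>

lemma not_tight_ker_insert:
  assumes W: "finite W" "W \<subseteq> V" and x: "x \<in> V" "x \<notin> W"
    and Z: "\<not> tight V es' im W j" "tight V es' im W (j + 1)"
  shows "\<not> tight V es ker (insert x W) (j + 1)"
proof
  note fr = graded_component_frees
  assume K: "tight V es ker (insert x W) (j + 1)"
  from Z(1) obtain p where p: "p \<in> im" "p \<in> graded_component V es' j" "\<forall>l. in_vars W (p l)"
    "p \<notin> var_multiples V es' W im j" by (auto simp: tight_def)
  obtain f where f: "f \<in> graded_component V es j" "p = \<phi> f" using graded_preimage p by blast
  have xf: "vscale (mvar x) f \<in> graded_component V es (j + 1)"
    using graded_component_mvar[OF x(1), of f es "j + 1"] f by simp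
  have xp: "\<phi> (vscale (mvar x) f) = vscale (mvar x) p"
    using f x by (simp add: map_vscale fr polys_mvar)
  then have "vscale (mvar x) p \<in> im \<inter> graded_component V es' (j + 1)"
    using xf map_graded fr by (metis IntI image_eqI)
  moreover have "\<forall>l. in_vars W (vscale (mvar x) p l)" using p(3) by (simp add: in_vars_times)
  ultimately have "vscale (mvar x) p \<in> var_multiples V es' W im (j + 1)"
    using Z(2) by (auto simp: tight_def)
  then obtain w where w: "w \<in> graded_component V es (j + 1)" "\<forall>l. in_vars W (w l)"
    "vscale (mvar x) p = \<phi> w" using var_multiples_image[OF W] by blast
  \<comment> \<open>Preimage under the connecting map: two lifts of \<open>x p\<close> are compared,
    one divisible by \<open>x\<close>, the other with coordinates in \<open>(W)\<close>.\<close>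
  define g where "g = vscale (mvar x) f - w"
  have g: "g \<in> graded_component V es (j + 1)" using xf w by (simp add: g_def graded_component_diff)
  moreover have "g \<in> ker" using xf w xp g by (simp add: ker_def g_def map_diff fr)
  moreover have "\<forall>l. in_vars (insert x W) (g l)"
    using w(2) by (auto simp: g_def intro!: in_vars_diff in_vars_mvar_times intro: in_vars_mono)
  ultimately have "g \<in> var_multiples V es (insert x W) ker (j + 1)" using K by (auto simp: tight_def)
  then obtain z u where z: "z \<in> ker" "z \<in> graded_component V es j"
    "u \<in> var_multiples V es W ker (j + 1)" "g = vscale (mvar x) z + u"
    unfolding var_multiples_insert[OF W(1) x(2)] by auto
  have u: "\<forall>l. in_vars W (u l)" using var_multiples_in_vars(2)[OF z(3) W] .
  have "mvar x * (f - z) l = (w + u) l" for l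
    using fun_cong[OF z(4), of l] by (simp add: g_def algebra_simps)
  then have "in_vars W (mvar x * (f - z) l)" for l using w(2) u by (simp add: in_vars_add)
  then have "\<forall>l. in_vars W ((f - z) l)" using in_vars_mvar_cancel x(2) by blast
  moreover have "f - z \<in> graded_component V es j" using f z by (simp add: graded_component_diff)
  moreover have "p = \<phi> (f - z)" using f z by (simp add: map_diff fr ker_def)
  ultimately have "p \<in> var_multiples V es' W im j" unfolding var_multiples_image[OF W] by blast
  with p(4) show False by blast
qed

text \<open>
  At \<open>W = V\<close> the quotient \<open>R/(W)\<close> is the residue field, and the degrees in which \<open>Tor\<close> does not
  vanish are the shifts of a minimal resolution.
\<close>

lemma tight_iff_not_shift:
  assumes V: "finite V"
    and im: "\<And>f l. f \<in> im \<Longrightarrow> in_vars V (f l)"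
    and ker: "\<And>f l. f \<in> ker \<Longrightarrow> in_vars V (f l)"
  shows "tight V es' im V j \<longleftrightarrow> j \<notin> set es"
proof
  assume t: "tight V es' im V j"
  show "j \<notin> set es"
  proof
    assume "j \<in> set es"
    then obtain l where l: "l < length es" "es ! l = j" by (auto simp: in_set_conv_nth)
    \<comment> \<open>This basis vector has a unit coordinate. Tightness would make it congruent
      modulo \<open>ker\<close> to a vector with coordinates in \<open>(V)\<close>, and by
      minimality \<open>ker\<close> contains only such vectors.\<close>
    define b :: "nat \<Rightarrow> 'a mpoly" where "b = (\<lambda>i. if i = l then 1 else 0)"
    have b: "b \<in> graded_component V es j"
      using l by (auto simp: b_def graded_component_iff frees_iff homogeneous_def)
    then have "\<phi> b \<in> im \<inter> graded_component V es' j" using map_graded graded_component_frees by blast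
    then have "\<phi> b \<in> var_multiples V es' V im j" using t im by (auto simp: tight_def)
    then obtain w where w: "w \<in> graded_component V es j" "\<forall>l. in_vars V (w l)" "\<phi> b = \<phi> w"
      using var_multiples_image[OF V] by blast
    then have "b - w \<in> ker" using b by (simp add: ker_def frees_diff graded_component_frees map_diff)
    then have "in_vars V ((b - w) l + w l)" using ker[of "b - w" l] w(2) by (intro in_vars_add) blast+
    then have "in_vars V (1 :: 'a mpoly)" by (simp add: b_def)
    then show False by (simp add: in_vars_def)
  qed
next
  assume j: "j \<notin> set es"
  show "tight V es' im V j"
    unfolding tight_def
  proof (intro ballI impI)
    fix f assume "f \<in> im \<inter> graded_component V es' j"
    then obtain g where g: "g \<in> graded_component V es j" "f = \<phi> g" using graded_preimage by blast
    have "in_vars V (g l)" for l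
    proof (cases "l < length es")
      case True
      then have "j - es ! l \<noteq> 0" using j by auto
      then show ?thesis using g True by (intro in_vars_homogeneous) (auto simp: graded_component_iff frees_iff)
    next
      case False
      then show ?thesis using g by (simp add: graded_component_iff frees_iff)
    qed
    then show "f \<in> var_multiples V es' V im j" using var_multiples_image[OF V] g by blast
  qed
qed

end

subsection \<open>Finite generation\<close>

definition module_closed :: "nat set \<Rightarrow> (nat \<Rightarrow> 'a::field mpoly) set \<Rightarrow> bool" where
  "module_closed V S \<longleftrightarrow> 0 \<in> S \<and> (\<forall>f\<in>S. \<forall>g\<in>S. f + g \<in> S) \<and> (\<forall>a\<in>polys V. \<forall>f\<in>S. vscale a f \<in> S)"

definition generates :: "nat set \<Rightarrow> (nat \<Rightarrow> 'a::field mpoly) set \<Rightarrow> (nat \<Rightarrow> 'a mpoly) set \<Rightarrow> bool" where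
  "generates V B Z \<longleftrightarrow> (\<forall>S. module_closed V S \<longrightarrow> B \<subseteq> S \<longrightarrow> Z \<subseteq> S)"

definition graded_submodule :: "nat set \<Rightarrow> int list \<Rightarrow> (nat \<Rightarrow> 'a::field mpoly) set \<Rightarrow> bool" where
  "graded_submodule V es Z \<longleftrightarrow> Z \<subseteq> frees V (length es) \<and> module_closed V Z \<and> (\<forall>f\<in>Z. \<forall>k. vec_part es k f \<in> Z)"

lemma module_closed_sum:
  assumes "module_closed V S" "\<And>i. i \<in> A \<Longrightarrow> f i \<in> S"
  shows "(\<Sum>i\<in>A. f i) \<in> S"
  using assms(2) by (induction A rule: infinite_finite_induct) (use assms(1) in \<open>auto simp: module_closed_def\<close>)

lemma lookup_const_times: "Poly_Mapping.lookup (Poly_Mapping.single 0 c * p) t = c * Poly_Mapping.lookup p t"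
  for p :: "'a::field mpoly"
  using lookup_single_times_add[of 0 c p t] by simp

lemma polys_const: "Poly_Mapping.single 0 c \<in> polys V"
  by (simp add: polys_single)

text \<open>
  Elimination on the finitely many places at which a coefficient may be nonzero; this replaces
  the finite-dimensionality of the graded components.
\<close>

lemma finite_spanning_set:
  fixes Z :: "(nat \<Rightarrow> 'a::field mpoly) set" and T :: "(nat \<times> (nat \<Rightarrow>\<^sub>0 nat)) set"
  assumes "finite T"
    and "\<And>f l t. f \<in> Z \<Longrightarrow> (l, t) \<notin> T \<Longrightarrow> Poly_Mapping.lookup (f l) t = 0"
    and "\<And>f g c. f \<in> Z \<Longrightarrow> g \<in> Z \<Longrightarrow> f + vscale (Poly_Mapping.single 0 c) g \<in> Z"
  shows "\<exists>B\<subseteq>Z. finite B \<and> generates V B Z"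
  using assms
proof (induction T arbitrary: Z rule: finite_induct)
  case empty
  have "f = 0" if "f \<in> Z" for f
    using empty(1)[OF that] by (auto simp: fun_eq_iff intro: poly_mapping_eqI)
  then have "Z \<subseteq> {0}" by blast
  then show ?case by (intro exI[of _ "{}"]) (auto simp: generates_def module_closed_def)
next
  case (insert \<tau> T)
  obtain l\<^sub>0 t\<^sub>0 where \<tau>: "\<tau> = (l\<^sub>0, t\<^sub>0)" by (cases \<tau>)
  define Z' where "Z' = {f \<in> Z. Poly_Mapping.lookup (f l\<^sub>0) t\<^sub>0 = 0}"
  have "\<exists>B\<subseteq>Z'. finite B \<and> generates V B Z'"
  proof (rule insert.IH)
    show "Poly_Mapping.lookup (f l) t = 0" if "f \<in> Z'" "(l, t) \<notin> T" for f l t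
      using that insert.prems(1)[of f l t] by (cases "(l, t) = \<tau>") (auto simp: Z'_def \<tau>)
    show "f + vscale (Poly_Mapping.single 0 c) g \<in> Z'" if fg: "f \<in> Z'" "g \<in> Z'" for f g c
    proof -
      have "f + vscale (Poly_Mapping.single 0 c) g \<in> Z"
        by (rule insert.prems(2)) (use fg in \<open>simp_all add: Z'_def\<close>)
      then show ?thesis using fg by (simp add: Z'_def lookup_add lookup_const_times)
    qed
  qed
  then obtain B where B: "B \<subseteq> Z'" "finite B" "generates V B Z'" by blast
  show ?case
  proof (cases "Z = Z'")
    case True
    then show ?thesis using B by blast
  next
    case False
    then obtain g where g: "g \<in> Z" "Poly_Mapping.lookup (g l\<^sub>0) t\<^sub>0 \<noteq> 0" by (auto simp: Z'_def)
    have "Z \<subseteq> S" if S: "module_closed V S" "insert g B \<subseteq> S" for S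
    proof
      fix f assume f: "f \<in> Z"
      \<comment> \<open>With this \<open>c\<close> and the pivot \<open>g\<close>, the coefficient
        at the place \<open>\<tau>\<close> is eliminated.\<close>
      define c where "c = Poly_Mapping.lookup (f l\<^sub>0) t\<^sub>0 / Poly_Mapping.lookup (g l\<^sub>0) t\<^sub>0"
      have "f + vscale (Poly_Mapping.single 0 (- c)) g \<in> Z" by (rule insert.prems(2)[OF f g(1)])
      then have "f + vscale (Poly_Mapping.single 0 (- c)) g \<in> Z'"
        using g(2) by (simp add: Z'_def lookup_add lookup_const_times c_def)
      then have "f + vscale (Poly_Mapping.single 0 (- c)) g \<in> S"
        using B(3) S by (auto simp: generates_def)
      moreover have "vscale (Poly_Mapping.single 0 c) g \<in> S"
        using S by (auto simp: module_closed_def polys_const)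
      ultimately have "f + vscale (Poly_Mapping.single 0 (- c)) g + vscale (Poly_Mapping.single 0 c) g \<in> S"
        using S(1) unfolding module_closed_def by blast
      moreover have "f + vscale (Poly_Mapping.single 0 (- c)) g + vscale (Poly_Mapping.single 0 c) g = f"
        by (simp add: add.assoc single_uminus flip: vscale_simps(3)) (simp add: vscale_simps)
      ultimately show "f \<in> S" by simp
    qed
    then have "generates V (insert g B) Z" by (simp add: generates_def)
    moreover have "insert g B \<subseteq> Z" "finite (insert g B)" using B g by (auto simp: Z'_def)
    ultimately show ?thesis by blast
  qed
qed

lemma graded_component_finite_support:
  assumes "finite V"
  obtains T where "finite T"
    "\<And>f :: nat \<Rightarrow> 'a::field mpoly. \<And>l t. f \<in> graded_component V es k \<Longrightarrow> (l, t) \<notin> T \<Longrightarrow> Poly_Mapping.lookup (f l) t = 0"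
proof -
  \<comment> \<open>For a negative degree \<open>nat\<close> yields 0, which merely enlarges
    \<open>T\<close>.\<close>
  define T where "T = (SIGMA l:{..<length es}.
    {t :: nat \<Rightarrow>\<^sub>0 nat. Poly_Mapping.keys t \<subseteq> V \<and> monomial_degree t = nat (k - es ! l)})"
  have "finite T" unfolding T_def using finite_exponents[OF assms] by blast
  moreover have "Poly_Mapping.lookup (f l) t = 0"
    if "f \<in> graded_component V es k" "(l, t) \<notin> T" for f :: "nat \<Rightarrow> 'a mpoly" and l t
  proof (rule ccontr)
    assume "Poly_Mapping.lookup (f l) t \<noteq> 0"
    then have t: "t \<in> Poly_Mapping.keys (f l)" by (simp add: in_keys_iff)
    then have "f l \<noteq> 0" by auto
    then have "l < length es" using that(1) by (meson graded_component_iff frees_iff linorder_not_le)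
    then show False using t that
      by (force simp: T_def graded_component_iff frees_iff polys_iff homogeneous_def)
  qed
  ultimately show ?thesis using that by blast
qed

lemma graded_component_neg:
  assumes "f \<in> graded_component V es k" "\<forall>e\<in>set es. 0 \<le> e" "k < 0"
  shows "f = 0"
proof
  fix l
  show "f l = 0 l"
  proof (cases "l < length es")
    case True
    then have "es ! l \<in> set es" by simp
    then have "k - es ! l < 0" using assms by force
    moreover have "homogeneous (k - es ! l) (f l)" using assms(1) True by (simp add: graded_component_iff)
    ultimately have "f l = 0" by (rule homogeneous_neg[rotated])
    then show ?thesis by simp
  next
    case False
    then show ?thesis using assms(1) by (simp add: graded_component_iff frees_iff)
  qed
qed

definition homogeneous_generators ::
  "nat set \<Rightarrow> int list \<Rightarrow> (nat \<Rightarrow> 'a::field mpoly) set \<Rightarrow> (int \<times> (nat \<Rightarrow> 'a mpoly)) list \<Rightarrow> bool" where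
  "homogeneous_generators V es Z ps \<longleftrightarrow>
    (\<forall>(k, g)\<in>set ps. 0 \<le> k \<and> g \<in> Z \<inter> graded_component V es k) \<and> generates V (snd ` set ps) Z"

text \<open>Graded Nakayama in place of Hilbert's basis theorem: beyond \<open>D\<close> every
  homogeneous element is a combination of indeterminates times elements of lower degree, so
  generators of the components of degrees 0 to \<open>D\<close> suffice.\<close>

lemma finitely_generated:
  fixes Z :: "(nat \<Rightarrow> 'a::field mpoly) set"
  assumes V: "finite V" and es: "\<forall>e\<in>set es. 0 \<le> e" and Z: "graded_submodule V es Z"
    and vars: "\<And>f l. f \<in> Z \<Longrightarrow> in_vars V (f l)" and D: "\<And>j. D < j \<Longrightarrow> tight V es Z V j"
  shows "\<exists>ps. homogeneous_generators V es Z ps"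
proof -
  have "\<exists>B\<subseteq>Z \<inter> graded_component V es k. finite B \<and> generates V B (Z \<inter> graded_component V es k)" for k
  proof -
    obtain T where T: "finite T"
      "\<And>f :: nat \<Rightarrow> 'a mpoly. \<And>l t. f \<in> graded_component V es k \<Longrightarrow> (l, t) \<notin> T \<Longrightarrow> Poly_Mapping.lookup (f l) t = 0"
      using graded_component_finite_support[OF V] by blast
    show ?thesis
    proof (rule finite_spanning_set[OF T(1)])
      fix f g c assume fg: "f \<in> Z \<inter> graded_component V es k" "g \<in> Z \<inter> graded_component V es k"
      have "homogeneous 0 (Poly_Mapping.single 0 c :: 'a mpoly)" by (simp add: homogeneous_single)
      then have "vscale (Poly_Mapping.single 0 c) g \<in> Z \<inter> graded_component V es k"
        using fg Z graded_component_vscale[of "Poly_Mapping.single 0 c" V 0 g es k]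
        by (auto simp: graded_submodule_def module_closed_def polys_const)
      then show "f + vscale (Poly_Mapping.single 0 c) g \<in> Z \<inter> graded_component V es k"
        using fg Z by (auto simp: graded_submodule_def module_closed_def graded_component_add)
    qed (use T(2) in blast)
  qed
  then obtain B where B: "\<And>k. B k \<subseteq> Z \<inter> graded_component V es k" "\<And>k. finite (B k)"
    "\<And>k. generates V (B k) (Z \<inter> graded_component V es k)" by metis
  have "finite (SIGMA k:{0..D}. B k)" using B(2) by blast
  then obtain ps where ps: "set ps = (SIGMA k:{0..D}. B k)" using finite_list by blast
  have "Z \<subseteq> S" if S: "module_closed V S" "snd ` set ps \<subseteq> S" for S
  proof
    have deg: "Z \<inter> graded_component V es (int n) \<subseteq> S" for n
    proof (induction n rule: less_induct)
      case (less n)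
      show ?case
      proof (cases "int n \<le> D")
        case True
        have "b \<in> S" if "b \<in> B (int n)" for b
        proof -
          have "(int n, b) \<in> set ps" using that True by (simp add: ps)
          then show ?thesis using S(2) by force
        qed
        then have "B (int n) \<subseteq> S" by blast
        then show ?thesis using B(3) S(1) by (simp add: generates_def)
      next
        case False
        show ?thesis
        proof
          fix f assume f: "f \<in> Z \<inter> graded_component V es (int n)"
          have "tight V es Z V (int n)" using D False by simp
          then have "f \<in> var_multiples V es V Z (int n)" using f vars unfolding tight_def by blast
          then obtain z where z: "\<forall>w\<in>V. z w \<in> Z \<inter> graded_component V es (int n - 1)"
            "f = (\<Sum>w\<in>V. vscale (mvar w) (z w))" by (auto simp: var_multiples_def)
          have "z w \<in> S" if "w \<in> V" for w
          proof (cases n)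
            case 0
            \<comment> \<open>In degree 0 the factors have degree -1 and vanish, all shifts being
              nonnegative.\<close>
            then have "z w = 0" using z(1) that es by (intro graded_component_neg[of _ V es "-1"]) auto
            then show ?thesis using S(1) by (simp add: module_closed_def)
          next
            case (Suc m)
            then show ?thesis using less[of m] z(1) that by auto
          qed
          then show "f \<in> S" unfolding z(2)
            using S(1) by (intro module_closed_sum[OF S(1)]) (auto simp: module_closed_def polys_mvar)
        qed
      qed
    qed
    fix f assume f: "f \<in> Z"
    then have fr: "f \<in> frees V (length es)" using Z by (auto simp: graded_submodule_def)
    have part: "vec_part es k f \<in> S" for k
    proof (cases "k < 0")
      case True
      then have "vec_part es k f = 0" using graded_component_neg[OF vec_part_graded[OF fr] es] by blast
      then show ?thesis using S(1) by (simp add: module_closed_def)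
    next
      case False
      then show ?thesis using deg[of "nat k"] vec_part_graded[OF fr, of k] f Z
        by (auto simp: graded_submodule_def)
    qed
    obtain K where "f = (\<Sum>k\<in>K. vec_part es k f)" using sum_vec_part[OF fr] by blast
    then show "f \<in> S" using module_closed_sum[OF S(1), of K "\<lambda>k. vec_part es k f"] part by simp
  qed
  then have "homogeneous_generators V es Z ps"
    using B(1) by (auto simp: homogeneous_generators_def generates_def ps)
  then show ?thesis ..
qed

section \<open>Minimal presentations of graded submodules\<close>

definition linear_comb :: "(nat \<Rightarrow> 'a::field mpoly) list \<Rightarrow> (nat \<Rightarrow> 'a mpoly) \<Rightarrow> (nat \<Rightarrow> 'a mpoly)" where
  "linear_comb gs f = (\<Sum>l<length gs. vscale (f l) (gs ! l))"

lemma graded_component_sum: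
  "(\<And>i. i \<in> A \<Longrightarrow> f i \<in> graded_component V es k) \<Longrightarrow> (\<Sum>i\<in>A. f i) \<in> graded_component V es k"
  by (induction A rule: infinite_finite_induct) (simp_all add: graded_component_add)

lemma linear_comb_graded_hom:
  fixes gs :: "(nat \<Rightarrow> 'a::field mpoly) list"
  assumes len: "length gs = length es'" and gs: "\<And>l. l < length es' \<Longrightarrow> gs ! l \<in> graded_component V es (es' ! l)"
  shows "graded_hom V es' es (linear_comb gs)"
proof (rule graded_homI)
  fix f g :: "nat \<Rightarrow> 'a mpoly" and a k
  show "f \<in> frees V (length es') \<Longrightarrow> linear_comb gs f \<in> frees V (length es)"
    unfolding linear_comb_def len
    by (intro frees_sum frees_vscale graded_component_frees[OF gs]) (auto simp: frees_iff)
  show "linear_comb gs (f + g) = linear_comb gs f + linear_comb gs g"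
    by (simp add: linear_comb_def vscale_simps sum.distrib)
  show "linear_comb gs (vscale a f) = vscale a (linear_comb gs f)"
    by (simp add: linear_comb_def vscale_simps vscale_sum)
  assume f: "f \<in> graded_component V es' k"
  show "linear_comb gs f \<in> graded_component V es k"
    unfolding linear_comb_def len
  proof (rule graded_component_sum)
    fix l assume "l \<in> {..<length es'}"
    then show "vscale (f l) (gs ! l) \<in> graded_component V es k"
      using f graded_component_vscale[of "f l" V "k - es' ! l" "gs ! l" es "es' ! l"] gs[of l]
      by (auto simp: graded_component_iff[of f] frees_iff)
  qed
qed

text \<open>A list of homogeneous generators of least length does it: a relation with a nonzero
  constant term in one coordinate would express that generator through the others.\<close>

lemma minimal_presentation:
  fixes Z :: "(nat \<Rightarrow> 'a::field mpoly) set"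
  assumes V: "finite V" and es: "\<forall>e\<in>set es. 0 \<le> e" and Z: "graded_submodule V es Z"
    and vars: "\<And>f l. f \<in> Z \<Longrightarrow> in_vars V (f l)" and D: "\<And>j. D < j \<Longrightarrow> tight V es Z V j"
  obtains es' \<phi> where "graded_hom V es' es \<phi>" "\<forall>e\<in>set es'. 0 \<le> e" "\<phi> ` frees V (length es') = Z"
    "\<And>f l. f \<in> frees V (length es') \<Longrightarrow> \<phi> f = 0 \<Longrightarrow> in_vars V (f l)"
proof -
  have "\<exists>ps. homogeneous_generators V es Z ps"
    by (rule finitely_generated[OF V es Z, of D]) (use vars D in blast)+
  then obtain ps where ps: "homogeneous_generators V es Z ps"
    "\<And>qs. homogeneous_generators V es Z qs \<Longrightarrow> length ps \<le> length qs"
    by (metis ex_has_least_nat[of "homogeneous_generators V es Z" _ length])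
  define es' gs where "es' = map fst ps" and "gs = map snd ps"
  have len: "length gs = length es'" "length ps = length es'" by (simp_all add: es'_def gs_def)
  have gen: "generates V (set gs) Z" using ps(1) by (simp add: homogeneous_generators_def gs_def)
  have gsl: "gs ! l \<in> Z" "gs ! l \<in> graded_component V es (es' ! l)" "0 \<le> es' ! l" if "l < length es'" for l
  proof -
    have "ps ! l \<in> set ps" using that len by simp
    moreover have "ps ! l = (es' ! l, gs ! l)" using that by (simp add: es'_def gs_def)
    ultimately have "0 \<le> es' ! l \<and> gs ! l \<in> Z \<inter> graded_component V es (es' ! l)"
      using ps(1) unfolding homogeneous_generators_def by (metis (mono_tags, lifting) case_prodD)
    then show "gs ! l \<in> Z" "gs ! l \<in> graded_component V es (es' ! l)" "0 \<le> es' ! l" by auto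
  qed
  have hom: "graded_hom V es' es (linear_comb gs)" by (rule linear_comb_graded_hom[OF len(1) gsl(2)])
  interpret graded_map V es' es "linear_comb gs" by unfold_locales (rule hom)
  have Zc: "module_closed V Z" using Z by (simp add: graded_submodule_def)
  have "im \<subseteq> Z"
    unfolding linear_comb_def using Zc gsl(1) len
    by (auto intro!: module_closed_sum simp: frees_iff module_closed_def)
  moreover have "Z \<subseteq> im"
  proof -
    have "module_closed V im"
      unfolding module_closed_def
    proof (intro conjI ballI)
      show "0 \<in> im" by (rule image_eqI[where x = 0]) simp_all
      show "f + g \<in> im" if "f \<in> im" "g \<in> im" for f g
        using that by (auto simp flip: map_add intro: frees_add)
      show "vscale a f \<in> im" if "a \<in> polys V" "f \<in> im" for a f
        using that by (auto simp flip: map_vscale intro: frees_vscale)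
    qed
    moreover have "set gs \<subseteq> im"
    proof
      fix g assume "g \<in> set gs"
      then obtain l where l: "l < length gs" "g = gs ! l" by (auto simp: in_set_conv_nth)
      define b :: "nat \<Rightarrow> 'a mpoly" where "b = (\<lambda>i. if i = l then 1 else 0)"
      have "linear_comb gs b = (\<Sum>i<length gs. if i = l then gs ! i else 0)"
        unfolding linear_comb_def b_def by (intro sum.cong) (auto simp: vscale_simps)
      then have "linear_comb gs b = g" using l by simp
      moreover have "b \<in> frees V (length es')" using l len by (auto simp: b_def frees_iff)
      ultimately show "g \<in> im" by blast
    qed
    ultimately show ?thesis using gen by (simp add: generates_def)
  qed
  ultimately have im: "im = Z" by blast
  have min: "in_vars V (c l)" if c: "c \<in> frees V (length es')" "linear_comb gs c = 0" for c l
  proof (rule ccontr)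
    assume nv: "\<not> in_vars V (c l)"
    then have "c l \<noteq> 0" by auto
    then have l: "l < length es'" using c(1) by (meson frees_iff linorder_not_le)
    \<comment> \<open>Restricting the relation to the degree of the \<open>l\<close>-th generator
      reduces the \<open>l\<close>-th coordinate to the constant \<open>a\<close>.\<close>
    define c' where "c' = vec_part es' (es' ! l) c"
    have c': "c' \<in> frees V (length es')" "linear_comb gs c' = 0"
      using graded_component_frees[OF vec_part_graded[OF c(1)]] map_vec_part[OF c(1)] c(2)
      by (simp_all add: c'_def)
    obtain t where t: "t \<in> Poly_Mapping.keys (c l)" "Poly_Mapping.keys t \<inter> V = {}"
      using nv by (auto simp: in_vars_def)
    moreover have "Poly_Mapping.keys t \<subseteq> V" using t(1) c(1) by (auto simp: frees_iff polys_iff)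
    ultimately have "Poly_Mapping.keys t = {}" by blast
    then have "t = 0" by simp
    define a where "a = Poly_Mapping.lookup (c l) 0"
    have a: "a \<noteq> 0" using t(1) \<open>t = 0\<close> by (simp add: a_def in_keys_iff)
    have c'l: "c' l = Poly_Mapping.single 0 a"
      using l by (intro poly_mapping_eqI)
        (auto simp: c'_def vec_part_def lookup_hom_part lookup_single when_def a_def monomial_degree_eq_0)
    define qs where "qs = take l ps @ drop (Suc l) ps"
    have "generates V (snd ` set qs) Z"
      unfolding generates_def
    proof (intro allI impI)
      fix S assume S: "module_closed V S" "snd ` set qs \<subseteq> S"
      have other: "gs ! i \<in> S" if i: "i < length es'" "i \<noteq> l" for i
      proof -
        have "ps ! i \<in> set qs"
        proof (cases "i < l")
          case True
          then have "take l ps ! i \<in> set (take l ps)" using i l len by (intro nth_mem) simp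
          then show ?thesis using True by (simp add: qs_def)
        next
          case False
          then have "drop (Suc l) ps ! (i - Suc l) \<in> set (drop (Suc l) ps)"
            using i len by (intro nth_mem) simp
          then show ?thesis using False i len by (simp add: qs_def)
        qed
        moreover have "gs ! i = snd (ps ! i)" using i len by (simp add: gs_def)
        ultimately show ?thesis using S(2) by auto
      qed
      define R where "R = (\<Sum>i\<in>{..<length es'} - {l}. vscale (c' i) (gs ! i))"
      have R: "R \<in> S" unfolding R_def
        using other S(1) c'(1) by (intro module_closed_sum[OF S(1)]) (auto simp: module_closed_def frees_iff)
      have "vscale (Poly_Mapping.single 0 a) (gs ! l) + R = 0"
        using c'(2) l len unfolding linear_comb_def R_def
        by (subst (asm) sum.remove[of _ l]) (auto simp: c'l)
      then have "R = - vscale (Poly_Mapping.single 0 a) (gs ! l)" by (simp add: eq_neg_iff_add_eq_0 add.commute)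
      then have "vscale (Poly_Mapping.single 0 (- inverse a)) R = gs ! l"
        using a by (auto simp: fun_eq_iff single_uminus mult.assoc[symmetric] mult_single)
      then have "gs ! l \<in> S" using R S(1) polys_const unfolding module_closed_def by metis
      then have "set gs \<subseteq> S" using other len by (metis in_set_conv_nth subsetI)
      then show "Z \<subseteq> S" using gen S(1) by (simp add: generates_def)
    qed
    moreover have "set qs \<subseteq> set ps" using set_take_subset[of l ps] set_drop_subset[of "Suc l" ps] by (simp add: qs_def)
    ultimately have "homogeneous_generators V es Z qs" using ps(1) by (auto simp: homogeneous_generators_def)
    then have "length ps \<le> length qs" by (rule ps(2))
    then show False using l len by (simp add: qs_def)
  qed
  have "\<forall>e\<in>set es'. 0 \<le> e" using gsl(3) by (metis in_set_conv_nth)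
  then show ?thesis using that[OF hom _ im] min by blast
qed

lemma (in graded_map) graded_submodule_ker: "graded_submodule V es ker"
  by (auto simp: graded_submodule_def module_closed_def ker_def frees_add frees_vscale map_add
      map_vscale vscale_simps map_vec_part graded_component_frees[OF vec_part_graded])

subsection \<open>Regularity from the first syzygies\<close>

definition ideal_module :: "nat set \<Rightarrow> 'a::field mpoly set \<Rightarrow> (nat \<Rightarrow> 'a mpoly) set" where
  "ideal_module V I = {f \<in> frees V 1. f 0 \<in> I}"

text \<open>The last three assumptions concern Tor_1(R/I, R/(W)) only: a degree bound once
  \<open>W\<close> contains both parameters, total vanishing for \<open>{z}\<close> (that is,
  \<open>z\<close> is a nonzerodivisor on R/I), and a nonzero class for \<open>{y, z}\<close> at the
  bound. The regularity turns out to be \<open>r\<close>.\<close>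

locale regular_ideal =
  fixes V :: "nat set" and I :: "'a::field mpoly set" and y z :: nat and r :: int
  assumes finite_V: "finite V" and yz: "y \<in> V" "z \<in> V" "y \<noteq> z"
    and ideal_I: "ideal I (mpoly_ring V)"
    and hom_part_I: "p \<in> I \<Longrightarrow> hom_part k p \<in> I"
    and in_vars_I: "p \<in> I \<Longrightarrow> in_vars V p"
    and tight_I: "{y, z} \<subseteq> W \<Longrightarrow> W \<subseteq> V \<Longrightarrow> r + 1 < j \<Longrightarrow> tight V [0] (ideal_module V I) W j"
    and tight_I_single: "tight V [0] (ideal_module V I) {z} j"
    and not_tight_I: "\<not> tight V [0] (ideal_module V I) {y, z} (r + 1)"
begin

text \<open>The clause \<open>card W < i\<close> reflects that the Koszul complex on
  \<open>W\<close> has length \<open>card W\<close>. The last clause is the nonzerodivisor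
  \<open>z\<close>, needed to get past \<open>i = 1\<close>.\<close>

definition tight_range :: "nat \<Rightarrow> int list \<Rightarrow> (nat \<Rightarrow> 'a mpoly) set \<Rightarrow> bool" where
  "tight_range i es Z \<longleftrightarrow> (\<forall>W j. W \<subseteq> V \<longrightarrow>
     {y, z} \<subseteq> W \<and> r + int i < j \<or> card W < i \<or> i = 1 \<and> W = {z} \<longrightarrow> tight V es Z W j)"

lemma tight_range_I: "tight_range 1 [0] (ideal_module V I)"
proof -
  have "W = {}" if "W \<subseteq> V" "card W < 1" for W
    using that finite_V by (meson card_0_eq finite_subset less_one)
  then show ?thesis unfolding tight_range_def
    using tight_I tight_I_single tight_empty by (metis of_nat_1)
qed

text \<open>Indeterminates are removed from \<open>W\<close> one at a time by
  \<open>tight_ker_insert\<close>. Where the degree bound is used, \<open>y\<close> and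
  \<open>z\<close> are kept to the end, since the bound is available only for sets containing
  both.\<close>

lemma tight_range_ker:
  assumes gm: "graded_map V es es' \<phi>" and i: "1 \<le> i" and Z: "tight_range i es' (\<phi> ` frees V (length es))"
  shows "tight_range (Suc i) es (graded_map.ker V es \<phi>)"
proof -
  interpret graded_map V es es' \<phi> by (rule gm)
  have "\<forall>j. {y, z} \<subseteq> W \<and> r + int (Suc i) < j \<or> card W < Suc i \<longrightarrow> tight V es ker W j"
    if "finite W" "W \<subseteq> V" for W
    using that
  proof (induction W rule: finite_psubset_induct)
    case (psubset W)
    show ?case
    proof (intro allI impI)
      fix j assume j: "{y, z} \<subseteq> W \<and> r + int (Suc i) < j \<or> card W < Suc i"
      show "tight V es ker W j"
      proof (cases "W = {}")
        case True
        then show ?thesis by (simp add: tight_empty)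
      next
        case False
        obtain x where x: "x \<in> W" "card W < Suc i \<or> W = {y, z} \<and> x = y \<or> {y, z} \<subseteq> W - {x} \<and> r + int (Suc i) < j"
          using False j by (cases "W = {y, z}") blast+
        let ?W = "W - {x}"
        have W: "W = insert x ?W" "finite ?W" "?W \<subset> W" "?W \<subseteq> V" "x \<in> V" "x \<notin> ?W"
          using x psubset by auto
        have card: "card ?W < card W" using W(3) psubset by (simp add: psubset_card_mono)
        have "tight V es ker ?W j \<and> tight V es' im ?W (j - 1)"
          using x(2)
        proof (elim disjE conjE)
          assume "card W < Suc i"
          then have "card ?W < i" using card by simp
          then show ?thesis using psubset.IH[OF W(3,4)] Z W(4) unfolding tight_range_def by auto
        next
          assume "W = {y, z}" "x = y"
          then have z: "?W = {z}" using yz by auto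
          then have c: "card ?W = 1" by simp
          then have "card ?W < Suc i" using i by linarith
          \<comment> \<open>For \<open>i = 1\<close> the set \<open>{z}\<close> is too large for the
            cardinality clause, and the nonzerodivisor clause takes over.\<close>
          moreover have "card ?W < i \<or> i = 1 \<and> ?W = {z}" using i z c by linarith
          ultimately show ?thesis using psubset.IH[OF W(3,4)] Z W(4) unfolding tight_range_def by blast
        next
          assume a: "{y, z} \<subseteq> ?W" "r + int (Suc i) < j"
          then have "r + int i < j - 1" by simp
          with a show ?thesis using psubset.IH[OF W(3,4)] Z W(4) unfolding tight_range_def by blast
        qed
        then have "tight V es ker (insert x ?W) j" using tight_ker_insert[OF W(2,4,5,6)] by blast
        then show ?thesis by (simp only: W(1)[symmetric])
      qed
    qed
  qed
  moreover have "finite W" if "W \<subseteq> V" for W using that finite_V finite_subset by blast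
  ultimately show ?thesis using i unfolding tight_range_def by auto
qed

section \<open>The shifts of an arbitrary minimal resolution\<close>

lemma card_V: "2 \<le> card V"
  using card_mono[OF finite_V, of "{y, z}"] yz by simp

lemma graded_submodule_I: "graded_submodule V [0] (ideal_module V I)"
proof -
  interpret R: cring "mpoly_ring V :: 'a mpoly ring" by (rule cring_mpoly_ring)
  interpret J: ideal I "mpoly_ring V" by (rule ideal_I)
  have "0 \<in> I" using J.zero_closed by simp
  moreover have "p + q \<in> I" if "p \<in> I" "q \<in> I" for p q using J.a_closed[OF that] by simp
  moreover have "p * q \<in> I" if "p \<in> polys V" "q \<in> I" for p q using J.I_l_closed[OF that(2,1)] by simp
  moreover have "vec_part [0] k f \<in> ideal_module V I" if f: "f \<in> ideal_module V I" for f k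
    using f hom_part_I graded_component_frees[OF vec_part_graded[of f V "[0]" k]]
    by (simp add: ideal_module_def vec_part_def)
  ultimately show ?thesis
    by (auto simp: graded_submodule_def module_closed_def ideal_module_def frees_add frees_vscale)
qed

text \<open>Removes the quotient ring: the augmentation is always onto and its kernel is the ideal,
  so the right end of the sequence only says that \<open>\<phi> 1\<close> maps onto the
  ideal.\<close>

lemma graded_free_resolution_iff:
  "graded_free_resolution V I p e \<phi> \<longleftrightarrow> e 0 = [0] \<and> (\<forall>i>p. e i = []) \<and>
     (\<forall>i\<ge>1. graded_hom V (e i) (e (i - 1)) (\<phi> i)) \<and>
     \<phi> 1 ` frees V (length (e 1)) = ideal_module V I \<and>
     (\<forall>i\<ge>1. graded_map.ker V (e i) (\<phi> i) = \<phi> (i + 1) ` frees V (length (e (i + 1))))"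
proof -
  interpret cring "mpoly_ring V :: 'a mpoly ring" by (rule cring_mpoly_ring)
  interpret I: ideal I "mpoly_ring V" by (rule ideal_I)
  have surj: "augmentation V I ` frees V (length [0::int]) = carrier (mpoly_ring V Quot I)"
  proof -
    have f: "\<exists>f\<in>frees V 1. f 0 = p" if "p \<in> polys V" for p :: "'a mpoly"
      using that by (intro bexI[of _ "\<lambda>j. if j = 0 then p else 0"]) (auto simp: frees_iff)
    have "carrier (mpoly_ring V Quot I) = (+>\<^bsub>mpoly_ring V\<^esub>) I ` polys V"
      by (auto simp: FactRing_def A_RCOSETS_def')
    also have "\<dots> = (\<lambda>f. I +>\<^bsub>mpoly_ring V\<^esub> f 0) ` frees V 1"
    proof -
      have "polys V = (\<lambda>f. f 0 :: 'a mpoly) ` frees V 1" using f by (force simp: frees_iff)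
      then show ?thesis by (simp add: image_image)
    qed
    finally show ?thesis by (simp add: augmentation_def[abs_def])
  qed
  have "I +>\<^bsub>mpoly_ring V\<^esub> q = I \<longleftrightarrow> q \<in> I" if "q \<in> polys V" for q
    using that I.a_rcos_const I.a_rcos_self by auto
  then have kern: "a_kernel (free_module V (length [0::int])) (mpoly_ring V Quot I) (augmentation V I) = ideal_module V I"
    by (auto simp: a_kernel_def' augmentation_def ideal_module_def FactRing_def frees_iff)
  have ker: "a_kernel (free_module V (length (e i))) (free_module V (length (e (i - 1)))) (\<phi> i) =
      graded_map.ker V (e i) (\<phi> i)" if "graded_hom V (e i) (e (i - 1)) (\<phi> i)" for i
  proof -
    interpret graded_map V "e i" "e (i - 1)" "\<phi> i" by unfold_locales (rule that)
    show ?thesis by (simp add: a_kernel_def' ker_def)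
  qed
  show ?thesis
    unfolding graded_free_resolution_def Let_def using surj kern ker by auto
qed

text \<open>At \<open>W = V\<close>, \<open>tight_range\<close> excludes shifts above
  \<open>r + i\<close>. Conversely, the nonzero class of Tor_1 in degree \<open>r + 1\<close> is
  carried along while \<open>W\<close> grows from \<open>{y, z}\<close> to \<open>V\<close>, one
  indeterminate per syzygy module; hence \<open>r\<close> is attained in homological degree
  \<open>card V - 1\<close>.\<close>

lemma Max_shifts:
  assumes "minimal_graded_free_resolution V I p e \<phi>"
  shows "Max {e i ! j - int i | i j. 1 \<le> i \<and> i \<le> p \<and> j < length (e i)} = r"
proof -
  define Z where "Z i = \<phi> i ` frees V (length (e i))" for i
  from assms have res: "e 0 = [0]" "\<And>i. p < i \<Longrightarrow> e i = []" "Z 1 = ideal_module V I"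
    "\<And>i. 1 \<le> i \<Longrightarrow> graded_hom V (e i) (e (i - 1)) (\<phi> i)"
    "\<And>i. 1 \<le> i \<Longrightarrow> graded_map.ker V (e i) (\<phi> i) = Z (Suc i)"
    unfolding minimal_graded_free_resolution_def graded_free_resolution_iff Z_def by simp_all
  have min: "in_vars V (\<phi> i f j)" if i: "1 \<le> i" and f: "f \<in> frees V (length (e i))" for i j and f :: "nat \<Rightarrow> 'a mpoly"
  proof -
    interpret graded_map V "e i" "e (i - 1)" "\<phi> i" by unfold_locales (rule res(4)[OF i])
    show "in_vars V (\<phi> i f j)"
    proof (cases "j < length (e (i - 1))")
      case True
      then have "\<phi> i f j \<in> Idl\<^bsub>mpoly_ring V\<^esub> (mvar ` V)"
        using assms i f unfolding minimal_graded_free_resolution_def by blast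
      then show ?thesis by (simp add: genideal_mvar finite_V)
    next
      case False
      then show ?thesis using closed[OF f] by (simp add: frees_iff)
    qed
  qed
  have gm: "graded_map V (e i) (e (i - 1)) (\<phi> i)" if "1 \<le> i" for i
    using res(4)[OF that] by unfold_locales
  have range: "tight_range (Suc i) (e i) (Z (Suc i))" for i
  proof (induction i)
    case 0
    then show ?case using tight_range_I res(1,3) by simp
  next
    case (Suc i)
    then show ?case
      using tight_range_ker[OF gm, of "Suc i" "Suc i"] res(5)[of "Suc i"] by (simp add: Z_def)
  qed
  have not_tight: "i + 2 \<le> card V \<Longrightarrow> \<exists>W. {y, z} \<subseteq> W \<and> W \<subseteq> V \<and> card W = i + 2 \<and>
      \<not> tight V (e i) (Z (Suc i)) W (r + int (Suc i))" for i
  proof (induction i)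
    case 0
    then show ?case using not_tight_I res(1,3) yz by (intro exI[of _ "{y, z}"]) simp
  next
    case (Suc i)
    then obtain W where W: "{y, z} \<subseteq> W" "W \<subseteq> V" "card W = i + 2"
      "\<not> tight V (e i) (Z (Suc i)) W (r + int (Suc i))" by auto
    have "W \<noteq> V" using W(3) Suc.prems by auto
    then obtain x where x: "x \<in> V" "x \<notin> W" using W(2) by blast
    have fin: "finite W" using W(2) finite_V finite_subset by blast
    have t: "tight V (e i) (Z (Suc i)) W (r + int (Suc i) + 1)"
      using range[of i] W(1,2) unfolding tight_range_def by simp
    interpret graded_map V "e (Suc i)" "e i" "\<phi> (Suc i)" using gm[of "Suc i"] by simp
    have "\<not> tight V (e (Suc i)) ker (insert x W) (r + int (Suc i) + 1)"
      using W(4) t unfolding Z_def by (intro not_tight_ker_insert[OF fin W(2) x])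
    then have "\<not> tight V (e (Suc i)) (Z (Suc (Suc i))) (insert x W) (r + int (Suc i) + 1)"
      using res(5)[of "Suc i"] by simp
    then show ?case using W x fin by (intro exI[of _ "insert x W"]) (simp add: algebra_simps)
  qed
  have shift: "tight V (e i) (Z (Suc i)) V j \<longleftrightarrow> j \<notin> set (e (Suc i))" for i j
  proof -
    interpret graded_map V "e (Suc i)" "e i" "\<phi> (Suc i)" using gm[of "Suc i"] by simp
    have "in_vars V (f l)" if "f \<in> im" for f l using that min[of "Suc i"] by auto
    moreover have "in_vars V (f l)" if "f \<in> ker" for f l
      using that res(5)[of "Suc i"] min[of "Suc (Suc i)"] by (auto simp: Z_def)
    ultimately show ?thesis unfolding Z_def using tight_iff_not_shift[OF finite_V] by blast
  qed
  let ?S = "{e i ! j - int i | i j. 1 \<le> i \<and> i \<le> p \<and> j < length (e i)}"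
  have "?S = (\<lambda>(i, j). e i ! j - int i) ` (SIGMA i:{1..p}. {..<length (e i)})" by force
  then have fin: "finite ?S" by simp
  have upper: "s \<le> r" if "s \<in> ?S" for s
  proof -
    from that obtain i j where ij: "s = e i ! j - int i" "1 \<le> i" "j < length (e i)" by blast
    then obtain i' where i': "i = Suc i'" by (cases i) auto
    have "e i ! j \<in> set (e i)" using ij by simp
    then have "\<not> tight V (e i') (Z i) V (e i ! j)" using shift i' by blast
    then have "\<not> r + int i < e i ! j"
      using range[of i'] yz unfolding tight_range_def i' by blast
    then show ?thesis using ij by simp
  qed
  have "r \<in> ?S"
  proof -
    define i where "i = card V - 2"
    obtain W where W: "W \<subseteq> V" "card W = i + 2" "\<not> tight V (e i) (Z (Suc i)) W (r + int (Suc i))"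
      using not_tight[of i] card_V unfolding i_def by (metis le_add_diff_inverse2 order_refl)
    then have "W = V" using card_V finite_V by (simp add: i_def card_subset_eq)
    then have "r + int (Suc i) \<in> set (e (Suc i))" using W(3) shift by blast
    then obtain j where j: "j < length (e (Suc i))" "e (Suc i) ! j = r + int (Suc i)"
      by (auto simp: in_set_conv_nth)
    then have "Suc i \<le> p" using res(2)[of "Suc i"] by (metis linorder_not_le list.size(3) not_less_zero)
    moreover have "r = e (Suc i) ! j - int (Suc i)" using j by simp
    ultimately show ?thesis using j(1) by (intro CollectI exI[of _ "Suc i"] exI[of _ j]) simp
  qed
  then show ?thesis using fin upper by (intro Max_eqI) auto
qed

section \<open>Existence of a finite minimal resolution\<close>

definition syzygy_invariant :: "nat \<Rightarrow> int list \<Rightarrow> (nat \<Rightarrow> 'a mpoly) set \<Rightarrow> bool" where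
  "syzygy_invariant i es Z \<longleftrightarrow> (\<forall>e\<in>set es. 0 \<le> e) \<and> graded_submodule V es Z \<and>
     (\<forall>f\<in>Z. \<forall>l. in_vars V (f l)) \<and> tight_range i es Z"

text \<open>A minimal cover of \<open>Z\<close> hands the invariant on to its kernel. Termination
  comes from the clause \<open>card W < i\<close> at \<open>W = V\<close>: no degree is left for a
  generator, a form of Hilbert's syzygy theorem.\<close>

lemma syzygy_step:
  assumes "syzygy_invariant i es Z" "1 \<le> i"
  obtains es' \<phi> where "graded_hom V es' es \<phi>" "\<phi> ` frees V (length es') = Z"
    "syzygy_invariant (Suc i) es' (graded_map.ker V es' \<phi>)" "card V < i \<Longrightarrow> es' = []"
proof -
  have inv: "\<forall>e\<in>set es. 0 \<le> e" "graded_submodule V es Z" "\<And>f l. f \<in> Z \<Longrightarrow> in_vars V (f l)"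
    "tight_range i es Z" using assms by (auto simp: syzygy_invariant_def)
  have "tight V es Z V j" if "r + int i < j" for j
    using inv(4) that yz unfolding tight_range_def by blast
  then obtain es' \<phi> where \<phi>: "graded_hom V es' es \<phi>" "\<forall>e\<in>set es'. 0 \<le> e" "\<phi> ` frees V (length es') = Z"
    "\<And>f l. f \<in> frees V (length es') \<Longrightarrow> \<phi> f = 0 \<Longrightarrow> in_vars V (f l)"
    using minimal_presentation[OF finite_V inv(1,2), of "r + int i"] inv(3) by blast
  interpret graded_map V es' es \<phi> by unfold_locales (rule \<phi>(1))
  have "syzygy_invariant (Suc i) es' ker"
    using \<phi> graded_submodule_ker tight_range_ker[OF graded_map_axioms assms(2)] inv(4)
    by (auto simp: syzygy_invariant_def ker_def)
  moreover have "es' = []" if "card V < i"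
  proof -
    have "tight V es im V j" for j using inv(4) that \<phi>(3) unfolding tight_range_def by blast
    moreover have "tight V es im V j \<longleftrightarrow> j \<notin> set es'" for j
      by (rule tight_iff_not_shift[OF finite_V]) (use inv(3) \<phi>(3,4) in \<open>auto simp: ker_def\<close>)
    ultimately show ?thesis by (metis list.set_intros(1) neq_Nil_conv)
  qed
  ultimately show ?thesis using that \<phi> by blast
qed

lemma minimal_resolution_exists: "\<exists>p e \<phi>. minimal_graded_free_resolution V I p e \<phi>"
proof -
  \<comment> \<open>A state at stage \<open>n\<close> holds the shifts of F_n, the submodule
    \<open>Z\<close> of F_n to be covered, and its cover by F_{n+1}; \<open>Q\<close> glues
    consecutive states, so that dependent choice yields the whole resolution.\<close>
  define P where "P n s \<longleftrightarrow> (case s of (es, Z, es', \<phi>) \<Rightarrow>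
    syzygy_invariant (Suc n) es Z \<and> (n = 0 \<longrightarrow> es = [0] \<and> Z = ideal_module V I) \<and>
    graded_hom V es' es \<phi> \<and> \<phi> ` frees V (length es') = Z \<and>
    syzygy_invariant (Suc (Suc n)) es' (graded_map.ker V es' \<phi>) \<and> (card V < Suc n \<longrightarrow> es' = []))"
    for n :: nat and s
  define Q where "Q n s s' \<longleftrightarrow> (case s of (es, Z, es', \<phi>) \<Rightarrow>
    fst s' = es' \<and> fst (snd s') = graded_map.ker V es' \<phi>)"
    for n :: nat and s s' :: "int list \<times> (nat \<Rightarrow> 'a mpoly) set \<times> int list \<times> ((nat \<Rightarrow> 'a mpoly) \<Rightarrow> nat \<Rightarrow> 'a mpoly)"
  have inv1: "syzygy_invariant 1 [0] (ideal_module V I)"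
    using graded_submodule_I tight_range_I in_vars_I
    by (auto simp: syzygy_invariant_def ideal_module_def frees_iff) (metis gr0I in_vars_zero Suc_leI)
  obtain es\<^sub>1 \<phi>\<^sub>1 where "graded_hom V es\<^sub>1 [0] \<phi>\<^sub>1" "\<phi>\<^sub>1 ` frees V (length es\<^sub>1) = ideal_module V I"
    "syzygy_invariant (Suc 1) es\<^sub>1 (graded_map.ker V es\<^sub>1 \<phi>\<^sub>1)" "card V < 1 \<Longrightarrow> es\<^sub>1 = []"
    using syzygy_step[OF inv1 order_refl] by blast
  then have "P 0 ([0], ideal_module V I, es\<^sub>1, \<phi>\<^sub>1)" using inv1 by (simp add: P_def)
  then have start: "\<exists>s. P 0 s" ..
  have step: "\<exists>s'. P (Suc n) s' \<and> Q n s s'" if "P n s" for n s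
  proof -
    obtain es Z es' \<phi> where s: "s = (es, Z, es', \<phi>)" by (cases s)
    then have inv: "syzygy_invariant (Suc (Suc n)) es' (graded_map.ker V es' \<phi>)" using that by (simp add: P_def)
    obtain es'' \<psi> where "graded_hom V es'' es' \<psi>" "\<psi> ` frees V (length es'') = graded_map.ker V es' \<phi>"
      "syzygy_invariant (Suc (Suc (Suc n))) es'' (graded_map.ker V es'' \<psi>)" "card V < Suc (Suc n) \<Longrightarrow> es'' = []"
      using syzygy_step[OF inv] by auto
    then show ?thesis using inv
      by (intro exI[of _ "(es', graded_map.ker V es' \<phi>, es'', \<psi>)"]) (simp add: P_def Q_def s)
  qed
  obtain S where S: "\<And>n. P n (S n)" "\<And>n. Q n (S n) (S (Suc n))"
    using dependent_nat_choice[of P Q] start step by blast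
  define e where "e n = fst (S n)" for n
  define Z where "Z n = fst (snd (S n))" for n
  define \<phi> where "\<phi> n = snd (snd (snd (S (n - 1))))" for n
  have Sn: "S n = (e n, Z n, e (Suc n), \<phi> (Suc n))" for n
    using S(2)[of n] by (cases "S n") (simp add: e_def Z_def \<phi>_def Q_def)
  have Z: "Z (Suc n) = graded_map.ker V (e (Suc n)) (\<phi> (Suc n))" for n
    using S(2)[of n] by (simp add: Q_def Sn)
  have P: "syzygy_invariant (Suc n) (e n) (Z n)" "n = 0 \<Longrightarrow> e n = [0] \<and> Z n = ideal_module V I"
    "graded_hom V (e (Suc n)) (e n) (\<phi> (Suc n))" "\<phi> (Suc n) ` frees V (length (e (Suc n))) = Z n"
    "card V < Suc n \<Longrightarrow> e (Suc n) = []" for n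
    using S(1)[of n] by (simp_all add: P_def Sn)
  have "graded_free_resolution V I (card V) e \<phi>"
    unfolding graded_free_resolution_iff
  proof (intro conjI allI impI)
    show "e 0 = [0]" using P(2) by simp
    show "e i = []" if "card V < i" for i using P(5)[of "i - 1"] that by simp
    show "graded_hom V (e i) (e (i - 1)) (\<phi> i)" if "1 \<le> i" for i using P(3)[of "i - 1"] that by simp
    show "\<phi> 1 ` frees V (length (e 1)) = ideal_module V I" using P(2,4)[of 0] by simp
    show "graded_map.ker V (e i) (\<phi> i) = \<phi> (i + 1) ` frees V (length (e (i + 1)))" if "1 \<le> i" for i
      using P(4)[of i] Z[of "i - 1"] that by simp
  qed
  moreover have "\<phi> i f j \<in> Idl\<^bsub>mpoly_ring V\<^esub> (mvar ` V)"
    if i: "1 \<le> i" and f: "f \<in> frees V (length (e i))" for i f j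
  proof -
    obtain n where n: "i = Suc n" using i by (cases i) auto
    have "\<phi> i f \<in> Z n" using P(4)[of n] f n by blast
    then have "in_vars V (\<phi> i f j)" "\<phi> i f \<in> frees V (length (e n))"
      using P(1)[of n] by (auto simp: syzygy_invariant_def graded_submodule_def)
    then show ?thesis by (simp add: genideal_mvar finite_V frees_iff)
  qed
  ultimately have "minimal_graded_free_resolution V I (card V) e \<phi>"
    by (simp add: minimal_graded_free_resolution_def)
  then show ?thesis by blast
qed

theorem regularity_eq: "regularity V I = r"
  unfolding regularity_def
proof (rule the_equality)
  obtain p e \<phi> where "minimal_graded_free_resolution V I p e \<phi>" using minimal_resolution_exists by blast
  then show "\<exists>p e \<phi>. minimal_graded_free_resolution V I p e \<phi> \<and>
      r = Max {e i ! j - int i | i j. 1 \<le> i \<and> i \<le> p \<and> j < length (e i)}"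
    by (intro exI conjI) (assumption, rule Max_shifts[symmetric])
next
  fix s assume "\<exists>p e \<phi>. minimal_graded_free_resolution V I p e \<phi> \<and>
    s = Max {e i ! j - int i | i j. 1 \<le> i \<and> i \<le> p \<and> j < length (e i)}"
  then show "s = r" by (elim exE conjE) (simp only: Max_shifts)
qed

end

subsection \<open>Toric ideals\<close>

locale toric =
  fixes V :: "nat set" and \<omega> :: "nat \<Rightarrow> nat"
  assumes finite_V: "finite V"
begin

definition weight :: "(nat \<Rightarrow>\<^sub>0 nat) \<Rightarrow> nat" where
  "weight t = (\<Sum>i\<in>Poly_Mapping.keys t. Poly_Mapping.lookup t i * \<omega> i)"

text \<open>The coefficient of the image of \<open>p\<close> in the semigroup ring at the element
  \<open>(v, D)\<close>; the toric ideal is the kernel of the map to that ring.\<close>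

definition fibre_sum :: "nat \<Rightarrow> nat \<Rightarrow> 'a::field mpoly \<Rightarrow> 'a" where
  "fibre_sum v D p = (\<Sum>t\<in>Poly_Mapping.keys p.
     if weight t = v \<and> monomial_degree t = D then Poly_Mapping.lookup p t else 0)"

definition toric_ideal :: "'a::field mpoly set" where
  "toric_ideal = {p \<in> polys V. \<forall>v D. fibre_sum v D p = 0}"

definition attained :: "nat \<Rightarrow> nat \<Rightarrow> bool" where
  "attained v D \<longleftrightarrow> (\<exists>t. Poly_Mapping.keys t \<subseteq> V \<and> weight t = v \<and> monomial_degree t = D)"

lemma weight_superset:
  "finite A \<Longrightarrow> Poly_Mapping.keys t \<subseteq> A \<Longrightarrow> weight t = (\<Sum>i\<in>A. Poly_Mapping.lookup t i * \<omega> i)"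
  unfolding weight_def by (rule sum.mono_neutral_left) (auto simp: in_keys_iff)

lemma weight_add: "weight (s + t) = weight s + weight t"
proof -
  let ?A = "Poly_Mapping.keys s \<union> Poly_Mapping.keys t"
  have "weight u = (\<Sum>i\<in>?A. Poly_Mapping.lookup u i * \<omega> i)" if "Poly_Mapping.keys u \<subseteq> ?A" for u
    using that by (intro weight_superset) auto
  then show ?thesis by (simp add: keys_add_nat lookup_add sum.distrib algebra_simps)
qed

lemma weight_single [simp]: "weight (Poly_Mapping.single x c) = c * \<omega> x"
  by (simp add: weight_def)

lemma fibre_sum_superset:
  "finite A \<Longrightarrow> Poly_Mapping.keys p \<subseteq> A \<Longrightarrow>
    fibre_sum v D p = (\<Sum>t\<in>A. if weight t = v \<and> monomial_degree t = D then Poly_Mapping.lookup p t else 0)"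
  unfolding fibre_sum_def by (rule sum.mono_neutral_left) (auto simp: in_keys_iff)

lemma fibre_sum_zero [simp]: "fibre_sum v D 0 = 0"
  by (simp add: fibre_sum_def)

lemma fibre_sum_add: "fibre_sum v D (p + q) = fibre_sum v D p + fibre_sum v D q"
proof -
  let ?A = "Poly_Mapping.keys p \<union> Poly_Mapping.keys q"
  have "fibre_sum v D p = (\<Sum>t\<in>?A. if weight t = v \<and> monomial_degree t = D then Poly_Mapping.lookup p t else 0)"
    "fibre_sum v D q = (\<Sum>t\<in>?A. if weight t = v \<and> monomial_degree t = D then Poly_Mapping.lookup q t else 0)"
    by (rule fibre_sum_superset; simp)+
  then have "fibre_sum v D p + fibre_sum v D q =
      (\<Sum>t\<in>?A. if weight t = v \<and> monomial_degree t = D then Poly_Mapping.lookup (p + q) t else 0)"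
    by (simp add: lookup_add flip: sum.distrib) (intro sum.cong; simp add: lookup_add)
  also have "\<dots> = fibre_sum v D (p + q)"
    by (rule fibre_sum_superset[symmetric]) (simp_all add: Poly_Mapping.keys_add)
  finally show ?thesis by simp
qed

lemma fibre_sum_uminus: "fibre_sum v D (- p) = - fibre_sum v D p"
  using fibre_sum_add[of v D p "- p"] by (simp add: eq_neg_iff_add_eq_0 add.commute)

lemma fibre_sum_diff: "fibre_sum v D (p - q) = fibre_sum v D p - fibre_sum v D q"
  using fibre_sum_add[of v D p "- q"] by (simp add: fibre_sum_uminus)

lemma fibre_sum_sum: "fibre_sum v D (\<Sum>i\<in>A. p i) = (\<Sum>i\<in>A. fibre_sum v D (p i))"
  by (induction A rule: infinite_finite_induct) (simp_all add: fibre_sum_add)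

lemma fibre_sum_single:
  "fibre_sum v D (Poly_Mapping.single t c) = (if weight t = v \<and> monomial_degree t = D then c else 0)"
  by (simp add: fibre_sum_def)

text \<open>Multiplication by a term translates fibres. The guards exclude fibres that no multiple
  of \<open>s\<close> meets, where the differences would be truncated.\<close>

lemma fibre_sum_single_times:
  "fibre_sum v D (Poly_Mapping.single s c * p) =
    (if weight s \<le> v \<and> monomial_degree s \<le> D then c * fibre_sum (v - weight s) (D - monomial_degree s) p else 0)"
proof -
  have "Poly_Mapping.single s c * p =
      (\<Sum>t\<in>Poly_Mapping.keys p. Poly_Mapping.single (s + t) (c * Poly_Mapping.lookup p t))"
    by (subst poly_mapping_sum_keys[of p]) (simp add: sum_distrib_left mult_single)
  then have "fibre_sum v D (Poly_Mapping.single s c * p) = (\<Sum>t\<in>Poly_Mapping.keys p.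
      if weight s + weight t = v \<and> monomial_degree s + monomial_degree t = D then c * Poly_Mapping.lookup p t else 0)"
    by (simp add: fibre_sum_sum fibre_sum_single weight_add monomial_degree_add)
  also have "\<dots> = (\<Sum>t\<in>Poly_Mapping.keys p. if weight s \<le> v \<and> monomial_degree s \<le> D then
      c * (if weight t = v - weight s \<and> monomial_degree t = D - monomial_degree s then Poly_Mapping.lookup p t else 0) else 0)"
    by (intro sum.cong) auto
  also have "\<dots> = (if weight s \<le> v \<and> monomial_degree s \<le> D then c * fibre_sum (v - weight s) (D - monomial_degree s) p else 0)"
    by (auto simp: fibre_sum_def sum_distrib_left intro!: sum.neutral)
  finally show ?thesis .
qed

lemma fibre_sum_mvar_times:
  "fibre_sum (v + \<omega> x) (Suc D) (mvar x * p) = fibre_sum v D p"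
  by (simp add: mvar_def fibre_sum_single_times)

lemma toric_ideal_polys: "p \<in> toric_ideal \<Longrightarrow> p \<in> polys V"
  by (simp add: toric_ideal_def)

lemma toric_ideal_zero [simp]: "0 \<in> toric_ideal"
  by (simp add: toric_ideal_def)

lemma toric_ideal_add: "p \<in> toric_ideal \<Longrightarrow> q \<in> toric_ideal \<Longrightarrow> p + q \<in> toric_ideal"
  by (simp add: toric_ideal_def polys_add fibre_sum_add)

lemma toric_ideal_uminus: "p \<in> toric_ideal \<Longrightarrow> - p \<in> toric_ideal"
  by (simp add: toric_ideal_def polys_uminus fibre_sum_uminus)

lemma toric_ideal_times:
  assumes "p \<in> toric_ideal" "q \<in> polys V"
  shows "q * p \<in> toric_ideal"
proof -
  have "q * p = (\<Sum>s\<in>Poly_Mapping.keys q. Poly_Mapping.single s (Poly_Mapping.lookup q s) * p)"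
    by (subst poly_mapping_sum_keys[of q]) (simp add: sum_distrib_right)
  then have "fibre_sum v D (q * p) = 0" for v D
    using assms(1) by (simp add: fibre_sum_sum fibre_sum_single_times toric_ideal_def sum.neutral)
  then show ?thesis using assms by (simp add: toric_ideal_def polys_mult)
qed

lemma toric_ideal_times_right: "p \<in> toric_ideal \<Longrightarrow> q \<in> polys V \<Longrightarrow> p * q \<in> toric_ideal"
  using toric_ideal_times[of p q] by (simp only: mult.commute)

lemma ideal_toric_ideal: "ideal toric_ideal (mpoly_ring V :: 'a::field mpoly ring)"
proof -
  interpret R: cring "mpoly_ring V :: 'a mpoly ring" by (rule cring_mpoly_ring)
  show ?thesis
  proof (rule idealI[OF R.ring_axioms])
    have inv: "\<ominus>\<^bsub>mpoly_ring V\<^esub> p = - p" if "p \<in> polys V" for p :: "'a mpoly"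
      using that R.minus_equality[of "- p" p] by (simp add: polys_uminus)
    show "subgroup toric_ideal (add_monoid (mpoly_ring V :: 'a mpoly ring))"
    proof (rule R.add.subgroupI)
      show "(toric_ideal :: 'a mpoly set) \<noteq> {}" using toric_ideal_zero by blast
    qed (auto simp: inv a_inv_def[symmetric] toric_ideal_polys toric_ideal_uminus toric_ideal_add)
  qed (simp_all add: toric_ideal_times toric_ideal_times_right)
qed

lemma fibre_sum_hom_part: "fibre_sum v D (hom_part k p) = (if int D = k then fibre_sum v D p else 0)"
proof -
  have "fibre_sum v D (hom_part k p) = (\<Sum>t\<in>Poly_Mapping.keys p.
      if weight t = v \<and> monomial_degree t = D then Poly_Mapping.lookup (hom_part k p) t else 0)"
    by (rule fibre_sum_superset) (simp_all add: keys_hom_part)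
  also have "\<dots> = (\<Sum>t\<in>Poly_Mapping.keys p. if int D = k then
      if weight t = v \<and> monomial_degree t = D then Poly_Mapping.lookup p t else 0 else 0)"
    by (intro sum.cong) (auto simp: lookup_hom_part)
  finally show ?thesis by (simp add: fibre_sum_def)
qed

lemma toric_ideal_hom_part: "p \<in> toric_ideal \<Longrightarrow> hom_part k p \<in> toric_ideal"
  by (simp add: toric_ideal_def hom_part_polys fibre_sum_hom_part)

text \<open>The monomial 1 is alone in its fibre, so the vanishing of that fibre sum kills the
  constant term.\<close>

lemma toric_ideal_in_vars:
  assumes "p \<in> toric_ideal"
  shows "in_vars V p"
  unfolding in_vars_def
proof
  fix t assume t: "t \<in> Poly_Mapping.keys p"
  have "t \<noteq> 0"
  proof
    assume "t = 0"
    have "fibre_sum 0 0 p = (\<Sum>t\<in>Poly_Mapping.keys p. if t = 0 then Poly_Mapping.lookup p t else 0)"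
      unfolding fibre_sum_def by (intro sum.cong) (auto simp: monomial_degree_eq_0 weight_def)
    then have "fibre_sum 0 0 p = Poly_Mapping.lookup p 0" using t \<open>t = 0\<close> by simp
    then show False using assms t \<open>t = 0\<close> by (simp add: toric_ideal_def in_keys_iff)
  qed
  then have "Poly_Mapping.keys t \<noteq> {}" by simp
  moreover have "Poly_Mapping.keys t \<subseteq> V" using t toric_ideal_polys[OF assms] by (simp add: polys_iff)
  ultimately show "Poly_Mapping.keys t \<inter> V \<noteq> {}" by blast
qed

lemma binomial_toric_ideal:
  assumes "Poly_Mapping.keys s \<subseteq> V" "Poly_Mapping.keys t \<subseteq> V" "weight s = weight t"
    "monomial_degree s = monomial_degree t"
  shows "Poly_Mapping.single s c - Poly_Mapping.single t c \<in> toric_ideal"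
  using assms by (simp add: toric_ideal_def polys_diff polys_single fibre_sum_diff fibre_sum_single)

text \<open>Multiplication by an indeterminate translates fibre sums without mixing them, so each
  indeterminate is a nonzerodivisor modulo the toric ideal.\<close>

lemma toric_ideal_mvar_cancel:
  assumes "mvar x * p \<in> toric_ideal" "p \<in> polys V"
  shows "p \<in> toric_ideal"
proof -
  have "fibre_sum v D p = 0" for v D
  proof -
    have "fibre_sum (v + \<omega> x) (Suc D) (mvar x * p) = 0" using assms(1) by (simp add: toric_ideal_def)
    then show ?thesis by (simp only: fibre_sum_mvar_times)
  qed
  then show ?thesis using assms(2) by (simp add: toric_ideal_def)
qed

section \<open>Tightness for toric ideals in terms of polynomials\<close>

definition multiples :: "nat set \<Rightarrow> int \<Rightarrow> 'a::field mpoly set" where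
  "multiples W j = {p. \<exists>q. (\<forall>w\<in>W. q w \<in> toric_ideal \<and> homogeneous (j - 1) (q w)) \<and> p = (\<Sum>w\<in>W. mvar w * q w)}"

lemma multiples_zero: "0 \<in> multiples W j"
  unfolding multiples_def by (intro CollectI exI[of _ "\<lambda>_. 0"]) simp

lemma multiples_add:
  assumes "p \<in> multiples W j" "q \<in> multiples W j"
  shows "p + q \<in> multiples W j"
proof -
  from assms obtain p' q' where "\<forall>w\<in>W. p' w \<in> toric_ideal \<and> homogeneous (j - 1) (p' w)"
    "p = (\<Sum>w\<in>W. mvar w * p' w)" "\<forall>w\<in>W. q' w \<in> toric_ideal \<and> homogeneous (j - 1) (q' w)"
    "q = (\<Sum>w\<in>W. mvar w * q' w)" unfolding multiples_def by blast
  then show ?thesis unfolding multiples_def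
    by (intro CollectI exI[of _ "\<lambda>w. p' w + q' w"])
      (simp add: toric_ideal_add homogeneous_add distrib_left sum.distrib)
qed

lemma multiples_sum: "(\<And>i. i \<in> A \<Longrightarrow> p i \<in> multiples W j) \<Longrightarrow> (\<Sum>i\<in>A. p i) \<in> multiples W j"
  by (induction A rule: infinite_finite_induct) (simp_all add: multiples_zero multiples_add)

lemma multiples_mvar:
  assumes "finite W" "w \<in> W" "q \<in> toric_ideal" "homogeneous (j - 1) q"
  shows "mvar w * q \<in> multiples W j"
proof -
  have "(\<Sum>i\<in>W. mvar i * (if i = w then q else 0)) = (\<Sum>i\<in>W. if i = w then mvar w * q else 0)"
    by (intro sum.cong) auto
  then have "mvar w * q = (\<Sum>i\<in>W. mvar i * (if i = w then q else 0))" using assms by simp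
  then show ?thesis unfolding multiples_def using assms
    by (intro CollectI exI[of _ "\<lambda>i. if i = w then q else 0"]) simp
qed

lemma tight_toric_iff:
  "tight V [0] (ideal_module V (toric_ideal :: 'a::field mpoly set)) W j \<longleftrightarrow>
    (\<forall>p \<in> toric_ideal :: 'a mpoly set. homogeneous j p \<longrightarrow> in_vars W p \<longrightarrow> p \<in> multiples W j)"
proof -
  define e where "e p = (\<lambda>l::nat. if l = 0 then p else 0 :: 'a mpoly)" for p
  have e: "f \<in> ideal_module V toric_ideal \<inter> graded_component V [0] k \<longleftrightarrow>
      (\<exists>p\<in>toric_ideal. homogeneous k p \<and> f = e p)" for f k
  proof
    assume f: "f \<in> ideal_module V toric_ideal \<inter> graded_component V [0] k"
    then have "f = e (f 0)" by (auto simp: e_def fun_eq_iff ideal_module_def frees_iff)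
    then show "\<exists>p\<in>toric_ideal. homogeneous k p \<and> f = e p"
      using f by (intro bexI[of _ "f 0"]) (auto simp: ideal_module_def graded_component_iff)
  qed (auto simp: e_def ideal_module_def graded_component_iff frees_iff toric_ideal_polys)
  have vm: "e p \<in> var_multiples V [0] W (ideal_module V toric_ideal) k \<longleftrightarrow> p \<in> multiples W k" for p k
  proof
    assume "e p \<in> var_multiples V [0] W (ideal_module V toric_ideal) k"
    then obtain f where f: "\<forall>w\<in>W. f w \<in> ideal_module V toric_ideal \<inter> graded_component V [0] (k - 1)"
      "e p = (\<Sum>w\<in>W. vscale (mvar w) (f w))" unfolding var_multiples_def by blast
    have "p = (\<Sum>w\<in>W. mvar w * f w 0)"
      using fun_cong[OF f(2), of 0] by (simp add: e_def sum_fun_apply)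
    moreover have "\<forall>w\<in>W. f w 0 \<in> toric_ideal \<and> homogeneous (k - 1) (f w 0)"
      using f(1) by (auto simp: ideal_module_def graded_component_iff)
    ultimately show "p \<in> multiples W k"
      unfolding multiples_def by (intro CollectI exI[of _ "\<lambda>w. f w 0"] conjI)
  next
    assume "p \<in> multiples W k"
    then obtain q where q: "\<forall>w\<in>W. q w \<in> toric_ideal \<and> homogeneous (k - 1) (q w)"
      "p = (\<Sum>w\<in>W. mvar w * q w)" unfolding multiples_def by blast
    have "e p = (\<Sum>w\<in>W. vscale (mvar w) (e (q w)))"
      by (auto simp: fun_eq_iff sum_fun_apply q(2) e_def)
    moreover have "\<forall>w\<in>W. e (q w) \<in> ideal_module V toric_ideal \<inter> graded_component V [0] (k - 1)"
      using q(1) e by blast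
    ultimately show "e p \<in> var_multiples V [0] W (ideal_module V toric_ideal) k"
      unfolding var_multiples_def by (intro CollectI exI[of _ "\<lambda>w. e (q w)"] conjI)
  qed
  have "(\<forall>l. in_vars W (e p l)) \<longleftrightarrow> in_vars W p" for p by (auto simp: e_def)
  then show ?thesis unfolding tight_def using e vm by metis
qed

end

text \<open>\<open>decompose\<close> is the vanishing of Tor_0 with R/(y, z) above degree
  \<open>r\<close>. In the semigroup ring \<open>y\<close> times \<open>(v, j)\<close> equals
  \<open>z\<close> times \<open>(v + \<omega> y, j)\<close>; \<open>lower\<close> makes such
  relations trivial, which is Tor_1 above degree \<open>r + 1\<close>, and \<open>extremal\<close>
  gives a nontrivial one in degree \<open>r + 1\<close>. For \<open>r = 0\<close> its last conjunct
  is vacuous.\<close>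

locale toric_regularity = toric +
  fixes y z r :: nat
  assumes yz: "y \<in> V" "z \<in> V" "y \<noteq> z" and z_weight: "\<omega> z = 0"
    and decompose: "\<And>v D. r < Suc D \<Longrightarrow> attained v (Suc D) \<Longrightarrow>
      attained v D \<or> (\<exists>v'. v = v' + \<omega> y \<and> attained v' D)"
    and lower: "\<And>v D. r < Suc D \<Longrightarrow> attained v (Suc D) \<Longrightarrow> attained (v + \<omega> y) (Suc D) \<Longrightarrow> attained v D"
    and extremal: "\<exists>v. attained v r \<and> attained (v + \<omega> y) r \<and> (\<forall>D. r = Suc D \<longrightarrow> \<not> attained v D)"
begin

definition same_fibre :: "(nat \<Rightarrow>\<^sub>0 nat) \<Rightarrow> (nat \<Rightarrow>\<^sub>0 nat) \<Rightarrow> bool" where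
  "same_fibre s t \<longleftrightarrow> Poly_Mapping.keys s \<subseteq> V \<and> Poly_Mapping.keys t \<subseteq> V \<and> weight s = weight t \<and>
     monomial_degree s = monomial_degree t"

abbreviation unit_exp :: "nat \<Rightarrow> (nat \<Rightarrow>\<^sub>0 nat)" where
  "unit_exp x \<equiv> Poly_Mapping.single x 1"

lemma binomial_multiple:
  assumes "finite W" "w \<in> W" "same_fibre s t" "monomial_degree s + 1 = D"
  shows "Poly_Mapping.single (s + unit_exp w) c - Poly_Mapping.single (t + unit_exp w) c \<in> multiples W (int D)"
proof -
  have "Poly_Mapping.single s c - Poly_Mapping.single t c \<in> toric_ideal"
    using assms(3) by (simp add: same_fibre_def binomial_toric_ideal)
  moreover have "homogeneous (int D - 1) (Poly_Mapping.single s c - Poly_Mapping.single t c)"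
    using assms(3,4) by (intro homogeneous_diff homogeneous_single) (auto simp: same_fibre_def)
  ultimately have "mvar w * (Poly_Mapping.single s c - Poly_Mapping.single t c) \<in> multiples W (int D)"
    using assms(1,2) by (intro multiples_mvar)
  then show ?thesis by (simp add: right_diff_distrib mvar_times_single)
qed

lemma binomial_reduce:
  assumes W: "{y, z} \<subseteq> W" "W \<subseteq> V" and s: "Poly_Mapping.keys s \<subseteq> V" "Poly_Mapping.keys s \<inter> W \<noteq> {}"
    "monomial_degree s = D" and D: "r + 1 < D"
  obtains u x where "x \<in> {y, z}" "same_fibre s (u + unit_exp x)"
    "\<And>c :: 'a::field. Poly_Mapping.single s c - Poly_Mapping.single (u + unit_exp x) c \<in> multiples W (int D)"
proof -
  have fin: "finite W" using W finite_V finite_subset by blast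
  from s obtain w where w: "w \<in> W" "w \<in> Poly_Mapping.keys s" by blast
  then obtain s' where s': "s = s' + unit_exp w" using exponent_split by blast
  have s'V: "Poly_Mapping.keys s' \<subseteq> V" using s(1) s' by (auto simp: keys_add_nat)
  obtain E where E: "D = Suc (Suc E)" "r < Suc E" using D by (metis Suc_eq_plus1 Suc_lessD less_imp_Suc_add add_Suc_right Suc_less_eq)
  have deg: "monomial_degree s' = Suc E" using s(3) s' E by (simp add: monomial_degree_add)
  have "attained (weight s') (Suc E)" using s'V deg unfolding attained_def by blast
  from decompose[OF E(2) this] obtain u x where x: "x \<in> {y, z}" "Poly_Mapping.keys u \<subseteq> V"
    "weight u + \<omega> x = weight s'" "monomial_degree u = E"
    using z_weight unfolding attained_def by (metis add_0_right insertI1 insertI2)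
  then have sf: "same_fibre s' (u + unit_exp x)"
    using s'V deg yz by (auto simp: same_fibre_def keys_add_nat weight_add monomial_degree_add)
  have "same_fibre s ((u + unit_exp w) + unit_exp x)"
    using sf s' w W s(1) by (auto simp: same_fibre_def keys_add_nat weight_add monomial_degree_add)
  moreover have "Poly_Mapping.single s c - Poly_Mapping.single ((u + unit_exp w) + unit_exp x) c \<in> multiples W (int D)" for c
    using binomial_multiple[OF fin w(1) sf, of D c] deg E s' by (simp add: ac_simps)
  ultimately show ?thesis using that[of x "u + unit_exp w"] x(1) by blast
qed

lemma binomial_in_multiples:
  fixes c :: "'a::field"
  assumes W: "{y, z} \<subseteq> W" "W \<subseteq> V" and st: "same_fibre s t"
    and "Poly_Mapping.keys s \<inter> W \<noteq> {}" "Poly_Mapping.keys t \<inter> W \<noteq> {}"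
    and D: "monomial_degree s = D" "r + 1 < D"
  shows "Poly_Mapping.single s c - Poly_Mapping.single t c \<in> multiples W (int D)"
proof -
  have fin: "finite W" using W finite_V finite_subset by blast
  \<comment> \<open>\<open>lower\<close> supplies \<open>u\<close> with \<open>u z\<close> in the
    fibre of \<open>a\<close>, and then
    \<open>a y - b z = y (a - u z) + z (u y - b)\<close>.\<close>
  have mixed: "Poly_Mapping.single (a + unit_exp y) c - Poly_Mapping.single (b + unit_exp z) c \<in> multiples W (int D)"
    if ab: "same_fibre (a + unit_exp y) (b + unit_exp z)" "monomial_degree (a + unit_exp y) = D"
    for a b and c :: 'a
  proof -
    obtain E where E: "D = Suc (Suc E)" "r < Suc E"
      using D by (metis Suc_eq_plus1 Suc_lessD less_imp_Suc_add add_Suc_right Suc_less_eq)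
    have V: "Poly_Mapping.keys a \<subseteq> V" "Poly_Mapping.keys b \<subseteq> V"
      using ab by (auto simp: same_fibre_def keys_add_nat)
    have deg: "monomial_degree a = Suc E" "monomial_degree b = Suc E"
      using ab E by (auto simp: same_fibre_def monomial_degree_add)
    have w: "weight b = weight a + \<omega> y" using ab z_weight by (simp add: same_fibre_def weight_add)
    have "attained (weight a) (Suc E)" "attained (weight a + \<omega> y) (Suc E)"
      using V deg w unfolding attained_def by blast+
    then obtain u where u: "Poly_Mapping.keys u \<subseteq> V" "weight u = weight a" "monomial_degree u = E"
      using lower[OF E(2)] unfolding attained_def by blast
    have sf: "same_fibre a (u + unit_exp z)" "same_fibre (u + unit_exp y) b"
      using V deg w u yz z_weight by (auto simp: same_fibre_def keys_add_nat weight_add monomial_degree_add)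
    have "Poly_Mapping.single (a + unit_exp y) c - Poly_Mapping.single (u + unit_exp z + unit_exp y) c \<in> multiples W (int D)"
      using W deg E by (intro binomial_multiple[OF fin _ sf(1)]) auto
    moreover have "Poly_Mapping.single (u + unit_exp y + unit_exp z) c - Poly_Mapping.single (b + unit_exp z) c \<in> multiples W (int D)"
      using W u E by (intro binomial_multiple[OF fin _ sf(2)]) (auto simp: monomial_degree_add)
    moreover have "u + unit_exp y + unit_exp z = u + unit_exp z + unit_exp y" by (simp add: ac_simps)
    ultimately show ?thesis using multiples_add by fastforce
  qed
  have swap: "p \<in> multiples W (int D)" if "- p \<in> multiples W (int D)" for p :: "'a mpoly"
  proof -
    from that obtain q where q: "\<forall>w\<in>W. q w \<in> toric_ideal \<and> homogeneous (int D - 1) (q w)"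
      "- p = (\<Sum>w\<in>W. mvar w * q w)" unfolding multiples_def by blast
    have "p = (\<Sum>w\<in>W. mvar w * (- q w))" using arg_cong[OF q(2), of uminus] by (simp add: sum_negf)
    then show ?thesis unfolding multiples_def
      using q(1) by (intro CollectI exI[of _ "\<lambda>w. - q w"]) (simp add: toric_ideal_uminus homogeneous_uminus)
  qed
  obtain a x where a: "x \<in> {y, z}" "same_fibre s (a + unit_exp x)"
    "\<And>c :: 'a. Poly_Mapping.single s c - Poly_Mapping.single (a + unit_exp x) c \<in> multiples W (int D)"
    using binomial_reduce[OF W _ assms(4) D] st unfolding same_fibre_def by metis
  obtain b x' where b: "x' \<in> {y, z}" "same_fibre t (b + unit_exp x')"
    "\<And>c :: 'a. Poly_Mapping.single t c - Poly_Mapping.single (b + unit_exp x') c \<in> multiples W (int D)"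
    using binomial_reduce[OF W _ assms(5) _ D(2)] st D(1) unfolding same_fibre_def by metis
  have ab: "same_fibre (a + unit_exp x) (b + unit_exp x')" "monomial_degree (a + unit_exp x) = D"
    "same_fibre (b + unit_exp x') (a + unit_exp x)" "monomial_degree (b + unit_exp x') = D"
    using a(2) b(2) st D(1) unfolding same_fibre_def by argo+
  have mid: "Poly_Mapping.single (a + unit_exp x) c - Poly_Mapping.single (b + unit_exp x') c \<in> multiples W (int D)"
  proof (cases "x = x'")
    case True
    then have "same_fibre a b" "monomial_degree a + 1 = D"
      using ab(1,2) by (auto simp: same_fibre_def keys_add_nat weight_add monomial_degree_add)
    then show ?thesis using binomial_multiple[OF fin] a(1) W(1) True by blast
  next
    case False
    then consider "x = y" "x' = z" | "x = z" "x' = y" using a(1) b(1) by blast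
    then show ?thesis
    proof cases
      case 1
      show ?thesis using mixed[of a b c] ab(1,2) unfolding 1 by blast
    next
      case 2
      have "Poly_Mapping.single (b + unit_exp x') c - Poly_Mapping.single (a + unit_exp x) c \<in> multiples W (int D)"
        using mixed[of b a c] ab(3,4) unfolding 2 by blast
      then show ?thesis by - (rule swap, simp only: minus_diff_eq)
    qed
  qed
  have "Poly_Mapping.single (b + unit_exp x') c - Poly_Mapping.single t c \<in> multiples W (int D)"
    using b(3)[of c] by - (rule swap, simp only: minus_diff_eq)
  then have "(Poly_Mapping.single s c - Poly_Mapping.single (a + unit_exp x) c) +
      (Poly_Mapping.single (a + unit_exp x) c - Poly_Mapping.single (b + unit_exp x') c) +
      (Poly_Mapping.single (b + unit_exp x') c - Poly_Mapping.single t c) \<in> multiples W (int D)"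
    by (intro multiples_add a(3) mid)
  moreover have "p - p\<^sub>1 + (p\<^sub>1 - p\<^sub>2) + (p\<^sub>2 - p\<^sub>3) = p - p\<^sub>3" for p p\<^sub>1 p\<^sub>2 p\<^sub>3 :: "'a mpoly" by simp
  ultimately show ?thesis by (simp only:)
qed

text \<open>An element of the ideal is a combination of binomials within fibres, and
  \<open>binomial_in_multiples\<close> handles each of them.\<close>

lemma tight_toric:
  assumes W: "{y, z} \<subseteq> W" "W \<subseteq> V" and j: "int r + 1 < j"
  shows "tight V [0] (ideal_module V (toric_ideal :: 'a::field mpoly set)) W j"
  unfolding tight_toric_iff
proof (intro ballI impI)
  fix p :: "'a mpoly" assume p: "p \<in> toric_ideal" "homogeneous j p" "in_vars W p"
  define D where "D = nat j"
  have D: "j = int D" "r + 1 < D" using j by (simp_all add: D_def)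
  have deg: "monomial_degree t = D" and kV: "Poly_Mapping.keys t \<subseteq> V" and kW: "Poly_Mapping.keys t \<inter> W \<noteq> {}"
    if "t \<in> Poly_Mapping.keys p" for t
    using p that toric_ideal_polys[OF p(1)] by (auto simp: homogeneous_def D(1) polys_iff in_vars_def)
  \<comment> \<open>Representatives are taken among the monomials of \<open>p\<close>, so that they
    meet \<open>W\<close> as well. As the degree is fixed, the weight alone determines the
    fibre.\<close>
  define rep where "rep v = (SOME t. t \<in> Poly_Mapping.keys p \<and> weight t = v)" for v
  have rep: "rep (weight t) \<in> Poly_Mapping.keys p" "weight (rep (weight t)) = weight t"
    if "t \<in> Poly_Mapping.keys p" for t
    using someI[of "\<lambda>s. s \<in> Poly_Mapping.keys p \<and> weight s = weight t" t] that by (simp_all add: rep_def)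
  \<comment> \<open>The coefficient collected at a representative is a fibre sum of
    \<open>p\<close>, hence zero.\<close>
  have reps: "(\<Sum>t\<in>Poly_Mapping.keys p. Poly_Mapping.single (rep (weight t)) (Poly_Mapping.lookup p t)) = 0"
  proof (rule poly_mapping_eqI)
    fix s
    have "Poly_Mapping.lookup (\<Sum>t\<in>Poly_Mapping.keys p. Poly_Mapping.single (rep (weight t)) (Poly_Mapping.lookup p t)) s =
        (\<Sum>t\<in>Poly_Mapping.keys p. if rep (weight s) = s then
          if weight t = weight s \<and> monomial_degree t = D then Poly_Mapping.lookup p t else 0 else 0)"
      unfolding lookup_sum lookup_single
    proof (intro sum.cong refl)
      fix t assume "t \<in> Poly_Mapping.keys p"
      then show "(Poly_Mapping.lookup p t when rep (weight t) = s) = (if rep (weight s) = s then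
          if weight t = weight s \<and> monomial_degree t = D then Poly_Mapping.lookup p t else 0 else 0)"
        using rep(2)[of t] deg[of t] by (auto simp: when_def)
    qed
    also have "\<dots> = (if rep (weight s) = s then fibre_sum (weight s) D p else 0)"
      by (simp add: fibre_sum_def)
    finally show "Poly_Mapping.lookup (\<Sum>t\<in>Poly_Mapping.keys p. Poly_Mapping.single (rep (weight t)) (Poly_Mapping.lookup p t)) s
        = Poly_Mapping.lookup 0 s"
      using p(1) by (simp add: toric_ideal_def)
  qed
  have "p = (\<Sum>t\<in>Poly_Mapping.keys p. Poly_Mapping.single t (Poly_Mapping.lookup p t) -
      Poly_Mapping.single (rep (weight t)) (Poly_Mapping.lookup p t))"
    by (subst poly_mapping_sum_keys) (simp add: sum_subtractf reps)
  also have "\<dots> \<in> multiples W j"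
    unfolding D(1)
  proof (intro multiples_sum binomial_in_multiples[OF W])
    fix t assume t: "t \<in> Poly_Mapping.keys p"
    show "same_fibre t (rep (weight t))"
      using t rep[OF t] kV deg by (simp add: same_fibre_def)
    show "Poly_Mapping.keys t \<inter> W \<noteq> {}" "Poly_Mapping.keys (rep (weight t)) \<inter> W \<noteq> {}"
      "monomial_degree t = D" using t rep(1)[OF t] kW deg by auto
  qed (rule D(2))
  finally show "p \<in> multiples W j" .
qed

lemma tight_toric_single: "tight V [0] (ideal_module V (toric_ideal :: 'a::field mpoly set)) {x} j"
  unfolding tight_toric_iff
proof (intro ballI impI)
  fix p :: "'a mpoly" assume p: "p \<in> toric_ideal" "homogeneous j p" "in_vars {x} p"
  obtain g w where g: "p = mvar x * g + w" "g \<in> polys V" "homogeneous (j - 1) g" "in_vars {} w"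
    using in_vars_insert_decompose[OF toric_ideal_polys[OF p(1)] p(2), of x "{}"] p(3) by blast
  then have pg: "p = mvar x * g" by (simp add: in_vars_empty)
  then have "g \<in> toric_ideal" using toric_ideal_mvar_cancel p(1) g(2) by blast
  then show "p \<in> multiples {x} j" unfolding pg using g(3) by (intro multiples_mvar) auto
qed

text \<open>The binomial \<open>y s - z t\<close> of the two monomials from \<open>extremal\<close>
  is the obstruction. Writing it by multiples would make \<open>s - q y\<close> divisible by
  \<open>z\<close>; its fibre sum at \<open>(v, r)\<close> is still 1, so a monomial of this fibre
  would be divisible by \<open>z\<close> and \<open>(v, r - 1)\<close> attained.\<close>

lemma not_tight_toric: "\<not> tight V [0] (ideal_module V (toric_ideal :: 'a::field mpoly set)) {y, z} (int r + 1)"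
proof
  assume tight: "tight V [0] (ideal_module V (toric_ideal :: 'a mpoly set)) {y, z} (int r + 1)"
  obtain v where v: "attained v r" "attained (v + \<omega> y) r" "\<And>D. r = Suc D \<Longrightarrow> \<not> attained v D"
    using extremal by blast
  obtain s t where st: "Poly_Mapping.keys s \<subseteq> V" "weight s = v" "monomial_degree s = r"
    "Poly_Mapping.keys t \<subseteq> V" "weight t = v + \<omega> y" "monomial_degree t = r"
    using v(1,2) unfolding attained_def by blast
  define p :: "'a mpoly" where "p = mvar y * Poly_Mapping.single s 1 - mvar z * Poly_Mapping.single t 1"
  have "p \<in> toric_ideal"
    unfolding p_def mvar_times_single using st yz z_weight
    by (intro binomial_toric_ideal) (auto simp: keys_add_nat weight_add monomial_degree_add)
  moreover have "homogeneous (int r + 1) p"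
    unfolding p_def mvar_times_single using st
    by (intro homogeneous_diff homogeneous_single) (auto simp: monomial_degree_add)
  moreover have "in_vars {y, z} p"
    unfolding p_def by (intro in_vars_diff in_vars_mvar_times) auto
  ultimately have "p \<in> multiples {y, z} (int r + 1)" using tight unfolding tight_toric_iff by blast
  then obtain q where q: "q y \<in> toric_ideal" "q z \<in> toric_ideal" "p = mvar y * q y + mvar z * q z"
    using yz(3) unfolding multiples_def by auto
  define g where "g = Poly_Mapping.single s 1 - q y"
  have "mvar y * g = mvar z * (Poly_Mapping.single t 1 + q z)"
    using q(3) unfolding p_def g_def by (simp add: algebra_simps)
  then have "in_vars {z} (mvar y * g)" by (simp add: in_vars_mvar_times)
  then have gz: "in_vars {z} g" using in_vars_mvar_cancel yz(3) by blast
  have gV: "g \<in> polys V" using st q(1) by (simp add: g_def polys_diff polys_single toric_ideal_polys)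
  have "\<not> (weight u = v \<and> monomial_degree u = r)" if u: "u \<in> Poly_Mapping.keys g" for u
  proof
    assume *: "weight u = v \<and> monomial_degree u = r"
    have "z \<in> Poly_Mapping.keys u" using gz u by (auto simp: in_vars_def)
    then obtain u' where u': "u = u' + unit_exp z" using exponent_split by blast
    have "Poly_Mapping.keys u \<subseteq> V" using gV u by (simp add: polys_iff)
    then have "attained v (monomial_degree u')"
      using * u' z_weight unfolding attained_def
      by (intro exI[of _ u']) (auto simp: keys_add_nat weight_add)
    moreover have "r = Suc (monomial_degree u')" using * u' by (simp add: monomial_degree_add)
    ultimately show False using v(3) by blast
  qed
  then have "fibre_sum v r g = 0" unfolding fibre_sum_def by (intro sum.neutral) auto
  moreover have "fibre_sum v r g = 1"
    using st q(1) by (simp add: g_def fibre_sum_diff fibre_sum_single toric_ideal_def)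
  ultimately show False by simp
qed

lemma regularity_toric_ideal: "regularity V (toric_ideal :: 'a::field mpoly set) = int r"
proof -
  interpret regular_ideal V "toric_ideal :: 'a mpoly set" y z "int r"
    by (rule regular_ideal.intro)
      (use finite_V yz ideal_toric_ideal toric_ideal_hom_part toric_ideal_in_vars
        tight_toric tight_toric_single not_tight_toric in simp_all)
  show ?thesis by (rule regularity_eq)
qed

end

subsection \<open>The semigroup of a generalized arithmetic sequence\<close>

text \<open>Here \<open>a\<close> is m_1, \<open>k\<close> is n - 1 and \<open>h * D\<close> is d,
  so that m_{i+1} = h a + i h D for i from 1 to k.\<close>

locale arith_semigroup =
  fixes k a h D :: int
  assumes k_ge2: "2 \<le> k" and a_pos: "1 \<le> a" and h_ge2: "2 \<le> h" and D_pos: "1 \<le> D"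
    and coprime_a: "coprime a (h * D)"
begin

text \<open>\<open>c\<close> counts the summands m_1, \<open>t\<close> the other ones, and
  \<open>I\<close> is the sum of the indices i of the latter, each between 1 and \<open>k\<close>.
  The slack \<open>j - c - t\<close> belongs to the indeterminate of weight 0.\<close>

definition reach :: "int \<Rightarrow> int \<Rightarrow> bool" where
  "reach v j \<longleftrightarrow> (\<exists>c t I. 0 \<le> c \<and> 0 \<le> t \<and> t \<le> I \<and> I \<le> k * t \<and>
     v = (c + h * t) * a + I * (h * D) \<and> c + t \<le> j)"

text \<open>
  The pairs \<open>(Y, I)\<close> and \<open>(Y - h D, I + a)\<close> give the same value \<open>Y a + I h D\<close>. A pair is admissible
  iff \<open>0 \<le> I \<le> k (Y div h)\<close>; the last condition says that \<open>I\<close> cannot be increased any more, which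
  minimises the number of summands.
\<close>

definition canonical :: "int \<Rightarrow> int \<Rightarrow> int \<Rightarrow> int \<Rightarrow> bool" where
  "canonical v \<tau> c I \<longleftrightarrow> v = (h * \<tau> + c) * a + I * (h * D) \<and> 0 \<le> c \<and> c < h \<and>
     0 \<le> I \<and> I \<le> k * \<tau> \<and> k * (\<tau> - D) - a < I"

text \<open>Of the \<open>h * \<tau> + c\<close> copies of \<open>a\<close>,
  \<open>min I \<tau>\<close> blocks of \<open>h\<close> are absorbed by generators other than m_1,
  one summand each; a remaining block takes \<open>h\<close> summands m_1, and \<open>c\<close>
  copies are left over.\<close>

definition cost :: "int \<Rightarrow> int \<Rightarrow> int \<Rightarrow> int" where
  "cost \<tau> c I = c + \<tau> + (h - 1) * max 0 (\<tau> - I)"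

definition reg :: int where
  "reg = (if k dvd a then (a - 1) div k * h + h * D + h else (a - 1) div k * h + h * D + h - 1)"

lemma reach_mono: "reach v j \<Longrightarrow> j \<le> j' \<Longrightarrow> reach v j'"
  unfolding reach_def by force

lemma reach_nonneg:
  assumes "reach v j"
  shows "0 \<le> v \<and> 0 \<le> j"
proof -
  from assms obtain c t I where *: "0 \<le> c" "0 \<le> t" "t \<le> I" "v = (c + h * t) * a + I * (h * D)" "c + t \<le> j"
    unfolding reach_def by blast
  have "0 \<le> (c + h * t) * a" "0 \<le> I * (h * D)" using * h_ge2 a_pos D_pos by simp_all
  then show ?thesis using * by linarith
qed

lemma canonical_nonneg: "canonical v \<tau> c I \<Longrightarrow> 0 \<le> \<tau>"
proof -
  assume "canonical v \<tau> c I"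
  then have "0 \<le> k * \<tau>" by (simp add: canonical_def)
  then show "0 \<le> \<tau>" using k_ge2 by (simp add: zero_le_mult_iff)
qed

lemma canonical_reach:
  assumes "canonical v \<tau> c I"
  shows "reach v (cost \<tau> c I)"
proof -
  define t where "t = min I \<tau>"
  have \<tau>: "0 \<le> \<tau>" using assms by (rule canonical_nonneg)
  have t: "0 \<le> t" "t \<le> I" "t \<le> \<tau>" using assms \<tau> by (auto simp: t_def canonical_def)
  have It: "I \<le> k * t"
  proof (cases "I \<le> \<tau>")
    case True
    have "1 * I \<le> k * I" using k_ge2 assms by (intro mult_right_mono) (auto simp: canonical_def)
    then show ?thesis using True by (simp add: t_def)
  next
    case False
    then show ?thesis using assms by (simp add: t_def canonical_def)
  qed
  have "0 \<le> h * (\<tau> - t)" using t h_ge2 by simp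
  moreover have "cost \<tau> c I = c + h * (\<tau> - t) + t"
    by (simp add: cost_def t_def min_def max_def algebra_simps)
  moreover have "v = (c + h * (\<tau> - t) + h * t) * a + I * (h * D)"
    using assms by (simp add: canonical_def algebra_simps)
  ultimately show ?thesis
    unfolding reach_def using t It assms
    by (intro exI[of _ "c + h * (\<tau> - t)"] exI[of _ t] exI[of _ I]) (auto simp: canonical_def)
qed

text \<open>By coprimality the only freedom is to trade \<open>a\<close> units of \<open>I\<close>
  against \<open>h * D\<close> copies of \<open>a\<close>.\<close>

lemma same_value:
  assumes "Y * a + I * (h * D) = Y' * a + I' * (h * D)"
  obtains l where "I' = I + l * a" "Y' = Y - l * (h * D)"
proof -
  have eq: "(Y - Y') * a = (I' - I) * (h * D)" using assms by (simp add: algebra_simps)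
  then have "a dvd (I' - I) * (h * D)" by (metis dvd_triv_right)
  then have "a dvd I' - I" using coprime_a by (simp add: coprime_dvd_mult_left_iff)
  then obtain l where l: "I' - I = a * l" by (elim dvdE)
  with eq have "(Y - Y') * a = (l * (h * D)) * a" by (simp add: algebra_simps)
  then have "Y - Y' = l * (h * D)" using a_pos by simp
  with l that[of l] show ?thesis by (simp add: algebra_simps)
qed

text \<open>As \<open>I\<close> admits no increase in the canonical pair, any other representation
  has smaller \<open>I\<close> and larger \<open>\<tau>\<close>: there are more blocks and fewer of
  them can be absorbed.\<close>

lemma cost_le:
  assumes can: "canonical v \<tau> c I" and "reach v j"
  shows "cost \<tau> c I \<le> j"
proof -
  from \<open>reach v j\<close> obtain c' t I' where *: "0 \<le> c'" "0 \<le> t" "t \<le> I'" "I' \<le> k * t"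
    "v = (c' + h * t) * a + I' * (h * D)" "c' + t \<le> j" unfolding reach_def by blast
  from can have v: "v = (h * \<tau> + c) * a + I * (h * D)" by (simp add: canonical_def)
  obtain l where l: "I' = I + l * a" "c' + h * t = h * \<tau> + c - l * (h * D)"
    using same_value[of "h * \<tau> + c" I "c' + h * t" I'] v *(5) by auto
  \<comment> \<open>The trade shifts the number of copies of \<open>a\<close> by a multiple of
    \<open>h\<close>, so the remainder \<open>c\<close> persists and only \<open>\<tau>\<close>
    moves, by \<open>l * D\<close>.\<close>
  define \<tau>' where "\<tau>' = \<tau> - l * D"
  have Y': "c' + h * t = h * \<tau>' + c" using l(2) by (simp add: \<tau>'_def algebra_simps)
  have t: "t \<le> \<tau>'"
  proof (rule ccontr)
    assume "\<not> t \<le> \<tau>'"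
    then have "h * (\<tau>' + 1) \<le> h * t" using h_ge2 by (intro mult_left_mono) auto
    then have "h * \<tau>' + h \<le> h * t" by (simp add: algebra_simps)
    then show False using Y' *(1) can by (simp add: canonical_def)
  qed
  have "l \<le> 0"
  proof (rule ccontr)
    assume "\<not> l \<le> 0"
    then have l1: "1 \<le> l" by simp
    have "k * t \<le> k * \<tau>'" using t k_ge2 by simp
    then have "I + l * a \<le> k * (\<tau> - l * D)" using * l(1) by (simp add: \<tau>'_def)
    moreover have "1 * (a + k * D) \<le> l * (a + k * D)"
      using l1 a_pos k_ge2 D_pos by (intro mult_right_mono) auto
    ultimately show False using can by (simp add: canonical_def algebra_simps)
  qed
  have lD: "l * D \<le> 0" "l * a \<le> 0" using \<open>l \<le> 0\<close> D_pos a_pos by (simp_all add: mult_nonpos_nonneg)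
  have "max 0 (\<tau> - I) \<le> \<tau>' - t"
    using lD t *(3) l(1) by (simp add: \<tau>'_def)
  then have "(h - 1) * max 0 (\<tau> - I) \<le> (h - 1) * (\<tau>' - t)"
    using h_ge2 by (intro mult_left_mono) auto
  moreover have "(h - 1) * (\<tau>' - t) = c' + t - c - \<tau>'"
    using Y' by (simp add: algebra_simps)
  ultimately show ?thesis using *(6) lD unfolding cost_def \<tau>'_def by linarith
qed

text \<open>The largest admissible \<open>I\<close> is taken; it exists because
  \<open>I \<le> v\<close>. If the last condition of \<open>canonical\<close> failed,
  \<open>I + a\<close> would be admissible too.\<close>

lemma canonical_exists:
  assumes "reach v j"
  obtains \<tau> c I where "canonical v \<tau> c I"
proof -
  define P where "P n \<longleftrightarrow> (\<exists>\<tau> c. v = (h * \<tau> + c) * a + int n * (h * D) \<and> 0 \<le> c \<and> c < h \<and>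
    int n \<le> k * \<tau>)" for n :: nat
  have ex: "\<exists>n. P n"
  proof -
    from assms obtain c t I where *: "0 \<le> c" "0 \<le> t" "t \<le> I" "I \<le> k * t"
      "v = (c + h * t) * a + I * (h * D)" unfolding reach_def by blast
    define Y where "Y = c + h * t"
    have "t \<le> Y div h"
      using *(1) h_ge2 by (simp add: Y_def pos_imp_zdiv_nonneg_iff)
    then have "k * t \<le> k * (Y div h)" using k_ge2 by simp
    then have "I \<le> k * (Y div h)" using * by linarith
    moreover have "v = (h * (Y div h) + Y mod h) * a + I * (h * D)"
      using * unfolding Y_def by (simp only: mult_div_mod_eq)
    moreover have "0 \<le> Y mod h" "Y mod h < h" using h_ge2 by simp_all
    moreover have "int (nat I) = I" using * by simp
    ultimately have "P (nat I)" unfolding P_def by metis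
    then show ?thesis ..
  qed
  have bound: "\<forall>n. P n \<longrightarrow> n < Suc (nat v)"
  proof (intro allI impI)
    fix n assume "P n"
    then obtain \<tau> c where *: "v = (h * \<tau> + c) * a + int n * (h * D)" "0 \<le> c" "int n \<le> k * \<tau>"
      unfolding P_def by blast
    have "0 \<le> k * \<tau>" using *(3) by linarith
    then have "0 \<le> \<tau>" using k_ge2 by (simp add: zero_le_mult_iff)
    then have "0 \<le> (h * \<tau> + c) * a" using * h_ge2 a_pos by simp
    moreover have "int n * 1 \<le> int n * (h * D)"
      using h_ge2 D_pos mult_mono[of 1 h 1 D] by (intro mult_left_mono) auto
    ultimately show "n < Suc (nat v)" using *(1) by linarith
  qed
  from ex obtain n\<^sub>0 where "P n\<^sub>0" ..
  from ex_has_greatest_nat[of P n\<^sub>0 "\<lambda>x. x", OF this bound]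
  obtain n where n: "P n" "\<forall>m. P m \<longrightarrow> m \<le> n" by (elim exE conjE)
  then obtain \<tau> c where *: "v = (h * \<tau> + c) * a + int n * (h * D)" "0 \<le> c" "c < h" "int n \<le> k * \<tau>"
    unfolding P_def by blast
  have "k * (\<tau> - D) - a < int n"
  proof (rule ccontr)
    assume "\<not> ?thesis"
    then have "int (n + nat a) \<le> k * (\<tau> - D)" using a_pos by simp
    moreover have "v = (h * (\<tau> - D) + c) * a + int (n + nat a) * (h * D)"
      using *(1) a_pos by (simp add: algebra_simps)
    ultimately have "P (n + nat a)" using * unfolding P_def by blast
    then show False using n(2) a_pos by fastforce
  qed
  then have "canonical v \<tau> c (int n)" using * by (simp add: canonical_def)
  then show ?thesis using that by blast
qed

text \<open>\<open>h * a + k * (h * D)\<close> is the last generator m_n. Adding it raises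
  \<open>\<tau>\<close> by 1, and \<open>I\<close>, \<open>k * \<tau>\<close> and the canonical
  lower bound all by \<open>k\<close>.\<close>

lemma canonical_shift:
  "canonical v \<tau> c I \<Longrightarrow> canonical (v + (h * a + k * (h * D))) (\<tau> + 1) c (I + k)"
  using k_ge2 by (simp add: canonical_def algebra_simps)

lemma canonical_unshift:
  "canonical v \<tau> c I \<Longrightarrow> k \<le> I \<Longrightarrow> canonical (v - (h * a + k * (h * D))) (\<tau> - 1) c (I - k)"
  by (simp add: canonical_def algebra_simps)

text \<open>If \<open>I \<ge> \<tau> + k - 1\<close>, removing m_n saves exactly one summand; the
  remaining pairs determine the regularity. In the notation of the proof the canonical condition is
  \<open>I > k * (\<tau> - E) - \<rho>\<close>, and the cost peaks at \<open>\<tau> = E\<close>,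
  \<open>I = 0\<close> or, if \<open>\<rho> = k\<close>, at \<open>\<tau> = E + 1\<close>,
  \<open>I = 1\<close>, in both cases with \<open>c = h - 1\<close>.\<close>

lemma cost_le_reg:
  assumes can: "canonical v \<tau> c I" and I: "I < \<tau> + k - 1"
  shows "cost \<tau> c I \<le> reg"
proof -
  \<comment> \<open>Dividing \<open>a - 1\<close> makes the remainder of \<open>a\<close> run from 1
    to \<open>k\<close>, so divisibility of \<open>a\<close> by \<open>k\<close> becomes
    \<open>\<rho> = k\<close>.\<close>
  define q \<rho> E where "q = (a - 1) div k" and "\<rho> = (a - 1) mod k + 1" and "E = D + q"
  have \<rho>: "1 \<le> \<rho>" "\<rho> \<le> k" using k_ge2 pos_mod_bound[of k "a - 1"] unfolding \<rho>_def by (simp, linarith)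
  have a: "a = k * q + \<rho>" by (simp add: q_def \<rho>_def)
  have q: "0 \<le> q" using a_pos k_ge2 by (simp add: q_def pos_imp_zdiv_nonneg_iff)
  have E: "1 \<le> E" using q D_pos by (simp add: E_def)
  have dvd: "k dvd a \<longleftrightarrow> \<rho> = k"
  proof
    assume "k dvd a"
    then have "k dvd \<rho>" using a by (metis dvd_add_right_iff dvd_triv_left)
    then show "\<rho> = k" using \<rho> zdvd_imp_le[of k \<rho>] by simp
  qed (simp add: a)
  have reg: "reg = h * E + h - 1 + (if \<rho> = k then 1 else 0)"
    by (simp add: reg_def dvd E_def q_def algebra_simps)
  have low: "k * \<tau> - k * E - \<rho> < I"
  proof -
    have "k * (\<tau> - D) - a < I" using can by (simp add: canonical_def)
    moreover have "k * E = k * D + k * q" by (simp add: E_def algebra_simps)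
    ultimately show ?thesis using a by (simp add: right_diff_distrib)
  qed
  have I0: "0 \<le> I" and c: "c \<le> h - 1" using can by (simp_all add: canonical_def)
  show ?thesis
  proof (cases "\<tau> \<le> I")
    case True
    have hE: "2 * E \<le> h * E" using h_ge2 E by (intro mult_right_mono) auto
    have le: "(k - 1) * \<tau> \<le> k * E + \<rho> + k - 3" using low I by (simp add: algebra_simps)
    \<comment> \<open>Here the cost is \<open>c + \<tau>\<close>, and \<open>2 * E\<close> is
      affordable because \<open>h \<ge> 2\<close>.\<close>
    have "\<tau> \<le> 2 * E + (if \<rho> = k then 1 else 0)"
    proof (rule ccontr)
      assume "\<not> ?thesis"
      then have "2 * E + (if \<rho> = k then 2 else 1) \<le> \<tau>" by (simp split: if_splits)
      then have "(k - 1) * (2 * E + (if \<rho> = k then 2 else 1)) \<le> (k - 1) * \<tau>"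
        using k_ge2 by (intro mult_left_mono) auto
      with le have le2: "(k - 1) * (2 * E + (if \<rho> = k then 2 else 1)) \<le> k * E + \<rho> + k - 3" by linarith
      have "1 * (k - 2) \<le> E * (k - 2)" using E k_ge2 by (intro mult_right_mono) auto
      then show False using le2 \<rho> k_ge2 by (simp add: algebra_simps split: if_splits)
    qed
    then show ?thesis using True c hE by (simp add: cost_def reg split: if_splits)
  next
    case False
    have cost: "cost \<tau> c I = c + h * \<tau> - (h - 1) * I" using False by (simp add: cost_def algebra_simps)
    show ?thesis
    proof (cases "\<tau> \<le> E")
      case True
      have "h * \<tau> \<le> h * E" using True h_ge2 by simp
      moreover have "0 \<le> (h - 1) * I" using I0 h_ge2 by simp
      ultimately show ?thesis using c unfolding cost reg by simp
    next
      case False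
      define l where "l = \<tau> - E - 1"
      have l: "0 \<le> l" "\<tau> = E + 1 + l" using False by (simp_all add: l_def)
      have "k * l + (k - \<rho>) + 1 \<le> I" using low l by (simp add: algebra_simps)
      then have "(h - 1) * (k * l + (k - \<rho>) + 1) \<le> (h - 1) * I" using h_ge2 by (intro mult_left_mono) auto
      \<comment> \<open>Each further step of \<open>\<tau>\<close> adds \<open>h\<close> to the cost
        but forces \<open>k\<close> more units of \<open>I\<close>, which save
        \<open>(h - 1) * k \<ge> h\<close>.\<close>
      moreover have "h * l \<le> (h - 1) * (k * l)"
      proof -
        have "(h - 1) * (2 * l) \<le> (h - 1) * (k * l)"
          using h_ge2 k_ge2 l by (intro mult_left_mono mult_right_mono) auto
        moreover have "h * l \<le> (h - 1) * (2 * l)"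
          using h_ge2 l mult_right_mono[of h "(h-1) * 2" l] by (simp add: algebra_simps)
        ultimately show ?thesis by linarith
      qed
      moreover have "(h - 1) * (if \<rho> = k then 0 else 1) \<le> (h - 1) * (k - \<rho>)"
        using h_ge2 \<rho> by (intro mult_left_mono) auto
      ultimately have "h * \<tau> - (h - 1) * I \<le> h * E + 1 - (h - 1) * (if \<rho> = k then 0 else 1)"
        unfolding l(2) by (simp only: distrib_left mult_1_right)
      then show ?thesis using c h_ge2 unfolding cost reg by (simp split: if_splits)
    qed
  qed
qed

text \<open>If the cost is below \<open>j\<close>, a summand is to spare. If it equals
  \<open>j > reg\<close>, then \<open>I \<ge> \<tau> + k - 1\<close>, and removing m_n saves exactly
  one summand.\<close>

lemma reach_decompose:
  assumes "reach v j" "reg < j"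
  shows "reach v (j - 1) \<or> reach (v - (h * a + k * (h * D))) (j - 1)"
proof -
  obtain \<tau> c I where can: "canonical v \<tau> c I" using canonical_exists assms(1) by blast
  have le: "cost \<tau> c I \<le> j" using cost_le can assms(1) by blast
  show ?thesis
  proof (cases "cost \<tau> c I = j")
    case True
    then have I: "\<tau> + k - 1 \<le> I" using cost_le_reg[OF can] assms(2) by force
    have "I \<le> k * \<tau>" using can by (simp add: canonical_def)
    have "0 \<le> \<tau>" using can by (rule canonical_nonneg)
    have "\<tau> \<noteq> 0" using I k_ge2 \<open>I \<le> k * \<tau>\<close> by auto
    then have "k \<le> I" using I \<open>0 \<le> \<tau>\<close> by simp
    from canonical_reach[OF canonical_unshift[OF can this]]
    have "reach (v - (h * a + k * (h * D))) (cost (\<tau> - 1) c (I - k))" .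
    moreover have "max 0 (\<tau> - 1 - (I - k)) = 0" "max 0 (\<tau> - I) = 0" using I k_ge2 by linarith+
    then have "cost (\<tau> - 1) c (I - k) = j - 1" using True by (simp add: cost_def)
    ultimately show ?thesis by simp
  next
    case False
    then show ?thesis using le reach_mono[OF canonical_reach[OF can], of "j - 1"] by auto
  qed
qed

text \<open>Only a value of cost exactly \<open>j\<close> could fail. Above \<open>reg\<close>
  adding m_n raises the cost by one, so the shifted value would need more than \<open>j\<close>
  summands.\<close>

lemma reach_lower:
  assumes "reach v j" "reach (v + (h * a + k * (h * D))) j" "reg < j"
  shows "reach v (j - 1)"
proof -
  obtain \<tau> c I where can: "canonical v \<tau> c I" using canonical_exists assms(1) by blast
  have le: "cost \<tau> c I \<le> j" using cost_le can assms(1) by blast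
  have le': "cost (\<tau> + 1) c (I + k) \<le> j" using cost_le canonical_shift[OF can] assms(2) by blast
  have "cost \<tau> c I \<noteq> j"
  proof
    assume eq: "cost \<tau> c I = j"
    then have "\<tau> + k - 1 \<le> I" using cost_le_reg[OF can] assms(3) by force
    then show False using eq le' k_ge2 by (simp add: cost_def)
  qed
  then show ?thesis using le reach_mono[OF canonical_reach[OF can], of "j - 1"] by auto
qed

text \<open>The maximiser of the cost is used. Since \<open>I < \<tau>\<close> there, adding m_n
  allows at least one more block to be absorbed; the saving of at least \<open>h - 1\<close> pays
  for the new summand.\<close>

lemma reach_extremal:
  obtains v where "reach v reg" "\<not> reach v (reg - 1)" "reach (v + (h * a + k * (h * D))) reg"
proof -
  define q where "q = (a - 1) div k"
  have q: "0 \<le> q" using a_pos k_ge2 by (simp add: q_def pos_imp_zdiv_nonneg_iff)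
  have a: "a = k * q + (a - 1) mod k + 1" by (simp add: q_def)
  have md: "0 \<le> (a - 1) mod k" "(a - 1) mod k < k" using k_ge2 by simp_all
  \<comment> \<open>The least \<open>I\<close> that is canonical: 1 at
    \<open>\<tau> = D + q + 1\<close> if \<open>k\<close> divides \<open>a\<close>, otherwise 0 at
    \<open>\<tau> = D + q\<close>.\<close>
  obtain \<tau> I where \<tau>: "I < \<tau>" "0 \<le> I" "I \<le> k * \<tau>" "k * (\<tau> - D) - a < I" "cost \<tau> (h - 1) I = reg"
  proof (cases "k dvd a")
    case True
    then have "k dvd (a - 1) mod k + 1" by (subst (asm) a) (metis add.assoc dvd_add_right_iff dvd_triv_left)
    then have "k = (a - 1) mod k + 1" using md zdvd_imp_le[of k "(a - 1) mod k + 1"] by simp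
    then have ak: "a = k * q + k" using a by linarith
    have "1 \<le> k * (D + q + 1)" using k_ge2 q D_pos mult_mono[of 1 k 1 "D + q + 1"] by simp
    moreover have "k * (D + q + 1 - D) - a < 1" by (simp add: ak algebra_simps)
    moreover have "cost (D + q + 1) (h - 1) 1 = reg"
      using True q D_pos unfolding cost_def reg_def by (simp add: q_def[symmetric] algebra_simps)
    ultimately show ?thesis using that[of 1 "D + q + 1"] q D_pos by simp
  next
    case False
    have "0 \<le> k * (D + q)" using k_ge2 q D_pos by simp
    moreover have "k * (D + q - D) - a < 0" using a md(1) by (simp add: algebra_simps)
    moreover have "cost (D + q) (h - 1) 0 = reg"
      using False q D_pos unfolding cost_def reg_def by (simp add: q_def[symmetric] algebra_simps)
    ultimately show ?thesis using that[of 0 "D + q"] q D_pos by simp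
  qed
  define v where "v = (h * \<tau> + (h - 1)) * a + I * (h * D)"
  have can: "canonical v \<tau> (h - 1) I" using \<tau> h_ge2 by (simp add: canonical_def v_def)
  have "max 0 (\<tau> + 1 - (I + k)) \<le> \<tau> - I - 1" using \<tau>(1) k_ge2 by simp
  then have "(h - 1) * max 0 (\<tau> + 1 - (I + k)) \<le> (h - 1) * (\<tau> - I - 1)"
    using h_ge2 by (intro mult_left_mono) auto
  then have "cost (\<tau> + 1) (h - 1) (I + k) \<le> cost \<tau> (h - 1) I"
    using \<tau>(1) h_ge2 by (simp add: cost_def algebra_simps)
  then have "reach (v + (h * a + k * (h * D))) reg"
    using reach_mono[OF canonical_reach[OF canonical_shift[OF can]]] \<tau>(5) by simp
  moreover have "\<not> reach v (reg - 1)" using cost_le[OF can] \<tau>(5) by force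
  moreover have "reach v reg" using canonical_reach[OF can] \<tau>(5) by simp
  ultimately show ?thesis using that by blast
qed

lemma reg_nonneg: "0 \<le> reg"
proof -
  have "0 \<le> (a - 1) div k" using a_pos k_ge2 by (simp add: pos_imp_zdiv_nonneg_iff)
  then have "0 \<le> (a - 1) div k * h" "0 \<le> h * D" using h_ge2 D_pos by simp_all
  then show ?thesis using h_ge2 unfolding reg_def by (simp split: if_splits)
qed

end

subsection \<open>The curve\<close>

text \<open>Greedy choice: \<open>b\<close> is the largest index that leaves at least 1 for each of
  the other \<open>t\<close> summands.\<close>

lemma exponent_with_index_sum:
  "t \<le> I \<Longrightarrow> I \<le> (n - 1) * t \<Longrightarrow> \<exists>u :: nat \<Rightarrow>\<^sub>0 nat. Poly_Mapping.keys u \<subseteq> {2..n} \<and>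
    (\<Sum>i\<in>{2..n}. Poly_Mapping.lookup u i) = t \<and> (\<Sum>i\<in>{2..n}. Poly_Mapping.lookup u i * (i - 1)) = I"
proof (induction t arbitrary: I)
  case 0
  then show ?case by (intro exI[of _ 0]) simp
next
  case (Suc t)
  define b where "b = min (n - 1) (I - t)"
  have n: "1 \<le> n - 1" using Suc.prems by (cases "n - 1") auto
  have b: "1 \<le> b" "b \<le> n - 1" using Suc.prems(1) n by (auto simp: b_def)
  have "t \<le> I - b" "I - b \<le> (n - 1) * t"
  proof -
    show "t \<le> I - b" using Suc.prems(1) by (auto simp: b_def)
    show "I - b \<le> (n - 1) * t"
    proof (cases "n - 1 \<le> I - t")
      case True
      then show ?thesis using Suc.prems(2) by (simp add: b_def)
    next
      case False
      moreover have "1 * t \<le> (n - 1) * t" using n by (rule mult_right_mono) simp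
      ultimately show ?thesis using Suc.prems(1) by (simp add: b_def)
    qed
  qed
  from Suc.IH[OF this] obtain u where u: "Poly_Mapping.keys u \<subseteq> {2..n}"
    "(\<Sum>i\<in>{2..n}. Poly_Mapping.lookup u i) = t" "(\<Sum>i\<in>{2..n}. Poly_Mapping.lookup u i * (i - 1)) = I - b" by blast
  let ?u = "u + Poly_Mapping.single (b + 1) 1"
  have mem: "b + 1 \<in> {2..n}" using b by simp
  have "(\<Sum>i\<in>{2..n}. Poly_Mapping.lookup ?u i) = (\<Sum>i\<in>{2..n}. Poly_Mapping.lookup u i) + (\<Sum>i\<in>{2..n}. if i = b + 1 then 1 else 0)"
    unfolding sum.distrib[symmetric] by (intro sum.cong) (auto simp: lookup_add lookup_single when_def)
  also have "(\<Sum>i\<in>{2..n}. if i = b + 1 then 1 else 0::nat) = 1" using mem by (subst sum.delta) auto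
  finally have 1: "(\<Sum>i\<in>{2..n}. Poly_Mapping.lookup ?u i) = Suc t" using u by simp
  have "(\<Sum>i\<in>{2..n}. Poly_Mapping.lookup ?u i * (i - 1)) =
      (\<Sum>i\<in>{2..n}. Poly_Mapping.lookup u i * (i - 1)) + (\<Sum>i\<in>{2..n}. if i = b + 1 then b else 0)"
    unfolding sum.distrib[symmetric] by (intro sum.cong) (auto simp: lookup_add lookup_single when_def algebra_simps)
  also have "(\<Sum>i\<in>{2..n}. if i = b + 1 then b else 0) = b" using mem by (subst sum.delta) auto
  finally have 2: "(\<Sum>i\<in>{2..n}. Poly_Mapping.lookup ?u i * (i - 1)) = I"
    using u(3) Suc.prems(1) by (simp add: b_def)
  have "Poly_Mapping.keys ?u \<subseteq> {2..n}" using u(1) mem by (auto simp: keys_add_nat)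
  then show ?case using 1 2 by blast
qed

section \<open>The vanishing ideal of the curve as a toric ideal\<close>

locale monomial_curve =
  fixes n :: nat and m :: "nat \<Rightarrow> nat"
  assumes m_le: "\<And>i. 1 \<le> i \<Longrightarrow> i \<le> n \<Longrightarrow> m i \<le> m n" and m_n_pos: "0 < m n"
begin

definition first_exp :: "nat \<Rightarrow> nat" where
  "first_exp i = (if i = n + 1 then 0 else m i)"

sublocale toric "{1..n + 1}" first_exp
  by unfold_locales simp

definition image_exp :: "(nat \<Rightarrow>\<^sub>0 nat) \<Rightarrow> (nat \<Rightarrow>\<^sub>0 nat)" where
  "image_exp t = (\<Sum>i\<in>Poly_Mapping.keys t. Poly_Mapping.single 1 (Poly_Mapping.lookup t i * first_exp i) +
     Poly_Mapping.single 2 (Poly_Mapping.lookup t i * (m n - first_exp i)))"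

lemma mvar_power: "mvar x ^ k = (Poly_Mapping.single (Poly_Mapping.single x k) 1 :: 'a::field mpoly)"
  by (induction k) (simp_all add: mvar_def mult_single flip: single_add)

lemma curve_param_power:
  "curve_param n m i ^ k = (Poly_Mapping.single (Poly_Mapping.single 1 (k * first_exp i) +
     Poly_Mapping.single 2 (k * (m n - first_exp i))) 1 :: 'a::field mpoly)"
proof -
  have "curve_param n m i = (mvar 1 ^ first_exp i * mvar 2 ^ (m n - first_exp i) :: 'a mpoly)"
    by (simp add: curve_param_def first_exp_def)
  then have "curve_param n m i ^ k = (mvar 1 ^ (k * first_exp i) * mvar 2 ^ (k * (m n - first_exp i)) :: 'a mpoly)"
    by (simp add: power_mult_distrib power_mult[symmetric] mult.commute)
  then show ?thesis by (simp add: mvar_power mult_single)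
qed

lemma prod_single: "finite A \<Longrightarrow> (\<Prod>i\<in>A. Poly_Mapping.single (f i) 1) = (Poly_Mapping.single (\<Sum>i\<in>A. f i) 1 :: 'a::field mpoly)"
  by (induction A rule: finite_induct) (simp_all add: mult_single)

lemma mpoly_subst_curve_param:
  "mpoly_subst (curve_param n m) p =
    (\<Sum>t\<in>Poly_Mapping.keys p. Poly_Mapping.single (image_exp t) (Poly_Mapping.lookup p t) :: 'a::field mpoly)"
  by (simp add: mpoly_subst_def curve_param_power prod_single image_exp_def mult_single)

lemma image_exp_lookup:
  "Poly_Mapping.lookup (image_exp t) 1 = weight t"
  "Poly_Mapping.lookup (image_exp t) 2 = (\<Sum>i\<in>Poly_Mapping.keys t. Poly_Mapping.lookup t i * (m n - first_exp i))"
  "x \<noteq> 1 \<Longrightarrow> x \<noteq> 2 \<Longrightarrow> Poly_Mapping.lookup (image_exp t) x = 0"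
  by (simp_all add: image_exp_def lookup_sum lookup_add lookup_single when_def weight_def)

lemma image_exp_degree:
  assumes "Poly_Mapping.keys t \<subseteq> {1..n + 1}"
  shows "Poly_Mapping.lookup (image_exp t) 1 + Poly_Mapping.lookup (image_exp t) 2 = m n * monomial_degree t"
proof -
  have "Poly_Mapping.lookup (image_exp t) 1 + Poly_Mapping.lookup (image_exp t) 2 =
      (\<Sum>i\<in>Poly_Mapping.keys t. Poly_Mapping.lookup t i * first_exp i + Poly_Mapping.lookup t i * (m n - first_exp i))"
    by (simp only: image_exp_lookup weight_def sum.distrib)
  also have "\<dots> = (\<Sum>i\<in>Poly_Mapping.keys t. m n * Poly_Mapping.lookup t i)"
  proof (intro sum.cong refl)
    fix i assume "i \<in> Poly_Mapping.keys t"
    then have "first_exp i \<le> m n" using assms m_le[of i] by (auto simp: first_exp_def)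
    then show "Poly_Mapping.lookup t i * first_exp i + Poly_Mapping.lookup t i * (m n - first_exp i) = m n * Poly_Mapping.lookup t i"
      by (simp add: mult.commute flip: distrib_left)
  qed
  finally show ?thesis by (simp add: monomial_degree_def sum_distrib_left)
qed

text \<open>All indeterminates map to monomials of degree \<open>m n > 0\<close>, so the exponents
  of u and v carry the same information as weight and degree.\<close>

lemma image_exp_eq_iff:
  assumes "Poly_Mapping.keys s \<subseteq> {1..n + 1}" "Poly_Mapping.keys t \<subseteq> {1..n + 1}"
  shows "image_exp s = image_exp t \<longleftrightarrow> weight s = weight t \<and> monomial_degree s = monomial_degree t"
proof
  assume eq: "image_exp s = image_exp t"
  then have "m n * monomial_degree s = m n * monomial_degree t"
    using image_exp_degree[OF assms(1)] image_exp_degree[OF assms(2)] by simp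
  then show "weight s = weight t \<and> monomial_degree s = monomial_degree t"
    using eq m_n_pos image_exp_lookup(1) by (metis mult_cancel1 not_less_zero)
next
  assume eq: "weight s = weight t \<and> monomial_degree s = monomial_degree t"
  then have 1: "Poly_Mapping.lookup (image_exp s) 1 = Poly_Mapping.lookup (image_exp t) 1"
    and "m n * monomial_degree s = m n * monomial_degree t" by (simp_all only: image_exp_lookup(1))
  then have 2: "Poly_Mapping.lookup (image_exp s) 2 = Poly_Mapping.lookup (image_exp t) 2"
    using image_exp_degree[OF assms(1)] image_exp_degree[OF assms(2)] by linarith
  have "Poly_Mapping.lookup (image_exp s) x = Poly_Mapping.lookup (image_exp t) x" for x
    using 1 2 image_exp_lookup(3)[of x] by metis
  then show "image_exp s = image_exp t" by (rule poly_mapping_eqI)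
qed

text \<open>A coefficient of the image of \<open>p\<close> is a fibre sum of \<open>p\<close>, or
  zero where no monomial of \<open>p\<close> is sent.\<close>

lemma vanishing_ideal_eq_toric: "vanishing_ideal n m = (toric_ideal :: 'a::field mpoly set)"
proof -
  have "mpoly_subst (curve_param n m) p = 0 \<longleftrightarrow> (\<forall>v D. fibre_sum v D p = 0)"
    if p: "p \<in> polys {1..n + 1}" for p :: "'a mpoly"
  proof -
    have keys: "Poly_Mapping.keys t \<subseteq> {1..n + 1}" if "t \<in> Poly_Mapping.keys p" for t
      using p that by (simp add: polys_iff)
    have lk: "Poly_Mapping.lookup (mpoly_subst (curve_param n m) p) e =
        (\<Sum>t\<in>Poly_Mapping.keys p. if image_exp t = e then Poly_Mapping.lookup p t else 0)" for e
      by (simp add: mpoly_subst_curve_param lookup_sum lookup_single when_def)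
    have at: "Poly_Mapping.lookup (mpoly_subst (curve_param n m) p) (image_exp s) =
        fibre_sum (weight s) (monomial_degree s) p" if "s \<in> Poly_Mapping.keys p" for s
      unfolding lk fibre_sum_def using image_exp_eq_iff keys that by (intro sum.cong) auto
    show ?thesis
    proof
      assume 0: "mpoly_subst (curve_param n m) p = 0"
      show "\<forall>v D. fibre_sum v D p = 0"
      proof (intro allI)
        fix v D
        show "fibre_sum v D p = 0"
        proof (cases "\<exists>s\<in>Poly_Mapping.keys p. weight s = v \<and> monomial_degree s = D")
          case True
          then show ?thesis using at 0 by fastforce
        next
          case False
          then show ?thesis unfolding fibre_sum_def by (intro sum.neutral) auto
        qed
      qed
    next
      assume 0: "\<forall>v D. fibre_sum v D p = 0"
      show "mpoly_subst (curve_param n m) p = 0"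
      proof (rule poly_mapping_eqI)
        fix e
        show "Poly_Mapping.lookup (mpoly_subst (curve_param n m) p) e = Poly_Mapping.lookup 0 e"
        proof (cases "\<exists>s\<in>Poly_Mapping.keys p. image_exp s = e")
          case True
          then show ?thesis using at 0 by auto
        next
          case False
          then show ?thesis unfolding lk by (simp add: sum.neutral)
        qed
      qed
    qed
  qed
  then show ?thesis unfolding vanishing_ideal_def a_kernel_def' toric_ideal_def by auto
qed

end

section \<open>Curves of generalized arithmetic sequences\<close>

locale gen_arith_curve =
  fixes n h d :: nat and m :: "nat \<Rightarrow> nat"
  assumes n_ge3: "3 \<le> n" and m1_pos: "0 < m 1" and h_gt1: "1 < h" and d_pos: "0 < d"
    and seq: "\<And>i. i \<in> {2..n} \<Longrightarrow> m i = h * m 1 + (i - 1) * d"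
    and coprime_m1: "coprime (m 1) d" and h_dvd: "h dvd d"
begin

sublocale monomial_curve n m
proof
  show "m i \<le> m n" if "1 \<le> i" "i \<le> n" for i
  proof (cases "i = 1")
    case True
    have "m n = h * m 1 + (n - 1) * d" using seq[of n] n_ge3 by simp
    moreover have "m 1 \<le> h * m 1" using h_gt1 by simp
    ultimately show ?thesis unfolding True by linarith
  next
    case False
    then have "m i = h * m 1 + (i - 1) * d" "m n = h * m 1 + (n - 1) * d"
      using that seq[of i] seq[of n] by simp_all
    moreover have "(i - 1) * d \<le> (n - 1) * d" using that by (intro mult_le_mono1 diff_le_mono)
    ultimately show ?thesis by linarith
  qed
  show "0 < m n" using seq[of n] n_ge3 m1_pos h_gt1 by simp
qed

lemma hD: "int h * int (d div h) = int d"
  using h_dvd by (simp flip: of_nat_mult)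

sublocale semi: arith_semigroup "int (n - 1)" "int (m 1)" "int h" "int (d div h)"
proof
  show "2 \<le> int (n - 1)" "1 \<le> int (m 1)" "2 \<le> int h" using n_ge3 m1_pos h_gt1 by simp_all
  have "0 < d div h" using h_dvd d_pos h_gt1 by (simp add: div_greater_zero_iff dvd_imp_le)
  then show "1 \<le> int (d div h)" by simp
  show "coprime (int (m 1)) (int h * int (d div h))" using coprime_m1 by (simp add: hD coprime_int_iff)
qed

lemma weight_eq:
  assumes "Poly_Mapping.keys t \<subseteq> {1..n + 1}"
  shows "weight t = (Poly_Mapping.lookup t 1 + h * (\<Sum>i\<in>{2..n}. Poly_Mapping.lookup t i)) * m 1 +
      (\<Sum>i\<in>{2..n}. Poly_Mapping.lookup t i * (i - 1)) * d"
    and "monomial_degree t = Poly_Mapping.lookup t 1 + (\<Sum>i\<in>{2..n}. Poly_Mapping.lookup t i) + Poly_Mapping.lookup t (n + 1)"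
proof -
  have split: "(\<Sum>i\<in>{1..n + 1}. g i) = g 1 + (\<Sum>i\<in>{2..n}. g i) + g (n + 1)" for g :: "nat \<Rightarrow> nat"
  proof -
    have "{1..n + 1} = insert 1 (insert (n + 1) {2..n})" using n_ge3 by auto
    moreover have "sum g (insert 1 (insert (n + 1) {2..n})) = g 1 + sum g (insert (n + 1) {2..n})"
      using n_ge3 by (intro sum.insert) auto
    moreover have "sum g (insert (n + 1) {2..n}) = g (n + 1) + sum g {2..n}" by (intro sum.insert) auto
    ultimately show ?thesis by simp
  qed
  have "weight t = Poly_Mapping.lookup t 1 * m 1 + (\<Sum>i\<in>{2..n}. Poly_Mapping.lookup t i * first_exp i)"
    using n_ge3 by (subst weight_superset[OF _ assms], simp, subst split) (simp add: first_exp_def)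
  also have "(\<Sum>i\<in>{2..n}. Poly_Mapping.lookup t i * first_exp i) =
      (\<Sum>i\<in>{2..n}. Poly_Mapping.lookup t i * (h * m 1) + Poly_Mapping.lookup t i * (i - 1) * d)"
  proof (intro sum.cong refl)
    fix i assume i: "i \<in> {2..n}"
    then have "first_exp i = h * m 1 + (i - 1) * d" using seq[OF i] by (simp add: first_exp_def)
    then show "Poly_Mapping.lookup t i * first_exp i =
      Poly_Mapping.lookup t i * (h * m 1) + Poly_Mapping.lookup t i * (i - 1) * d" by (simp add: algebra_simps)
  qed
  also have "\<dots> = (\<Sum>i\<in>{2..n}. Poly_Mapping.lookup t i) * (h * m 1) + (\<Sum>i\<in>{2..n}. Poly_Mapping.lookup t i * (i - 1)) * d"
    by (simp only: sum.distrib sum_distrib_right)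
  finally show "weight t = (Poly_Mapping.lookup t 1 + h * (\<Sum>i\<in>{2..n}. Poly_Mapping.lookup t i)) * m 1 +
      (\<Sum>i\<in>{2..n}. Poly_Mapping.lookup t i * (i - 1)) * d" by (simp add: algebra_simps)
  show "monomial_degree t = Poly_Mapping.lookup t 1 + (\<Sum>i\<in>{2..n}. Poly_Mapping.lookup t i) + Poly_Mapping.lookup t (n + 1)"
    by (subst monomial_degree_superset[OF _ assms], simp, rule split)
qed

lemma attained_iff_reach: "attained v j \<longleftrightarrow> semi.reach (int v) (int j)"
proof
  assume "attained v j"
  then obtain t where t: "Poly_Mapping.keys t \<subseteq> {1..n + 1}" "weight t = v" "monomial_degree t = j"
    unfolding attained_def by blast
  define T I where "T = (\<Sum>i\<in>{2..n}. Poly_Mapping.lookup t i)"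
    and "I = (\<Sum>i\<in>{2..n}. Poly_Mapping.lookup t i * (i - 1))"
  have "Poly_Mapping.lookup t i * 1 \<le> Poly_Mapping.lookup t i * (i - 1)" if "i \<in> {2..n}" for i
    using that by (intro mult_left_mono) auto
  then have TI: "T \<le> I" unfolding T_def I_def by (intro sum_mono) simp
  have "I \<le> (n - 1) * T" unfolding T_def I_def sum_distrib_left
  proof (intro sum_mono)
    fix i assume "i \<in> {2..n}"
    then have "i - 1 \<le> n - 1" by auto
    then show "Poly_Mapping.lookup t i * (i - 1) \<le> (n - 1) * Poly_Mapping.lookup t i"
      by (subst mult.commute) (rule mult_le_mono1)
  qed
  then have "int I \<le> int (n - 1) * int T" by (simp only: of_nat_le_iff flip: of_nat_mult)
  moreover have "v = (Poly_Mapping.lookup t 1 + h * T) * m 1 + I * d"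
    using weight_eq(1)[OF t(1)] t(2) by (simp add: T_def I_def)
  then have "int v = (int (Poly_Mapping.lookup t 1) + int h * int T) * int (m 1) + int I * (int h * int (d div h))"
    by (simp add: hD)
  moreover have "int (Poly_Mapping.lookup t 1) + int T \<le> int j"
    using weight_eq(2)[OF t(1)] t(3) by (simp add: T_def)
  ultimately show "semi.reach (int v) (int j)"
    unfolding semi.reach_def using TI by (intro exI[of _ "int (Poly_Mapping.lookup t 1)"] exI[of _ "int T"] exI[of _ "int I"]) simp
next
  assume "semi.reach (int v) (int j)"
  then obtain c' t' I' where *: "0 \<le> c'" "0 \<le> t'" "t' \<le> I'" "I' \<le> int (n - 1) * t'"
    "int v = (c' + int h * t') * int (m 1) + I' * int d" "c' + t' \<le> int j"
    unfolding semi.reach_def hD by blast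
  define c T I where "c = nat c'" and "T = nat t'" and "I = nat I'"
  have cTI: "c' = int c" "t' = int T" "I' = int I" using * by (simp_all add: c_def T_def I_def)
  have nat: "T \<le> I" "I \<le> (n - 1) * T" "v = (c + h * T) * m 1 + I * d" "c + T \<le> j"
    using *(3-6) unfolding cTI by (simp_all only: of_nat_le_iff of_nat_eq_iff flip: of_nat_mult of_nat_add)
  obtain u where u: "Poly_Mapping.keys u \<subseteq> {2..n}" "(\<Sum>i\<in>{2..n}. Poly_Mapping.lookup u i) = T"
    "(\<Sum>i\<in>{2..n}. Poly_Mapping.lookup u i * (i - 1)) = I" using exponent_with_index_sum[OF nat(1,2)] by blast
  define s where "s = u + Poly_Mapping.single 1 c + Poly_Mapping.single (n + 1) (j - c - T)"
  have sV: "Poly_Mapping.keys s \<subseteq> {1..n + 1}"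
    using u(1) by (force simp: s_def keys_add_nat split: if_splits)
  have su: "Poly_Mapping.lookup s i = Poly_Mapping.lookup u i" if "i \<in> {2..n}" for i
    using that by (simp add: s_def lookup_add lookup_single when_def)
  have "1 \<notin> Poly_Mapping.keys u" "n + 1 \<notin> Poly_Mapping.keys u" using u(1) by force+
  then have s1: "Poly_Mapping.lookup s 1 = c" "Poly_Mapping.lookup s (n + 1) = j - c - T"
    using n_ge3 by (simp_all add: s_def lookup_add lookup_single when_def in_keys_iff)
  have "(\<Sum>i\<in>{2..n}. Poly_Mapping.lookup s i) = T" "(\<Sum>i\<in>{2..n}. Poly_Mapping.lookup s i * (i - 1)) = I"
    unfolding u(2,3)[symmetric] using su by (auto intro!: sum.cong)
  then have "weight s = v" "monomial_degree s = j"
    using weight_eq[OF sV] s1 nat by simp_all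
  then show "attained v j" unfolding attained_def using sV by blast
qed

lemma regularity_curve: "regularity {1..n + 1} (vanishing_ideal n m :: 'a::field mpoly set) = semi.reg"
proof -
  define r where "r = nat semi.reg"
  have r: "int r = semi.reg" using semi.reg_nonneg by (simp add: r_def)
  have M: "int h * int (m 1) + int (n - 1) * (int h * int (d div h)) = int (m n)"
    unfolding hD using seq[of n] n_ge3 by simp
  have fn: "first_exp n = m n" by (simp add: first_exp_def)
  \<comment> \<open>The parameters: index \<open>n\<close> maps to u^{m_n}, and index
    \<open>n + 1\<close>, of weight 0, to v^{m_n}.\<close>
  interpret toric_regularity "{1..n + 1}" first_exp n "n + 1" r
  proof
    show "n \<in> {1..n + 1}" "n + 1 \<in> {1..n + 1}" "n \<noteq> n + 1" "first_exp (n + 1) = 0"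
      using n_ge3 by (simp_all add: first_exp_def)
    fix v D assume D: "r < Suc D" and v: "attained v (Suc D)"
    have reach: "semi.reach (int v) (int D + 1)"
      using v unfolding attained_iff_reach by (simp add: add.commute)
    have reg: "semi.reg < int D + 1" using D r by linarith
    show "attained v D \<or> (\<exists>v'. v = v' + first_exp n \<and> attained v' D)"
    proof (cases "semi.reach (int v) (int D)")
      case True
      then show ?thesis using attained_iff_reach by blast
    next
      case False
      then have "semi.reach (int v - int (m n)) (int D)"
        using semi.reach_decompose[OF reach reg] unfolding M add_diff_cancel_right' by blast
      moreover from this have "m n \<le> v" using semi.reach_nonneg by force
      ultimately have "attained (v - m n) D" unfolding attained_iff_reach by (simp only: of_nat_diff)
      then show ?thesis using \<open>m n \<le> v\<close> fn by (intro disjI2 exI[of _ "v - m n"]) simp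
    qed
    assume "attained (v + first_exp n) (Suc D)"
    then have "semi.reach (int v + int (m n)) (int D + 1)"
      unfolding attained_iff_reach fn of_nat_add of_nat_Suc by (simp only: add.commute)
    then show "attained v D"
      using semi.reach_lower[OF reach _ reg] unfolding M add_diff_cancel_right' attained_iff_reach by blast
  next
    obtain v where v: "semi.reach v semi.reg" "\<not> semi.reach v (semi.reg - 1)" "semi.reach (v + int (m n)) semi.reg"
      using semi.reach_extremal unfolding M by blast
    have nv: "int (nat v) = v" using semi.reach_nonneg[OF v(1)] by simp
    then have "attained (nat v) r" "attained (nat v + first_exp n) r"
      using v(1,3) unfolding attained_iff_reach fn of_nat_add nv r by blast+
    moreover have "\<not> attained (nat v) D" if "r = Suc D" for D
    proof -
      have "int D = semi.reg - 1" using that r by linarith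
      then show ?thesis using v(2) unfolding attained_iff_reach nv by (simp only: not_False_eq_True)
    qed
    ultimately show "\<exists>v. attained v r \<and> attained (v + first_exp n) r \<and> (\<forall>D. r = Suc D \<longrightarrow> \<not> attained v D)"
      by blast
  qed
  show ?thesis using regularity_toric_ideal by (simp add: vanishing_ideal_eq_toric r)
qed

end

theorem theorem3p14:
  fixes n h d :: nat and m :: "nat \<Rightarrow> nat" and \<delta> :: int
  assumes "infinite (UNIV :: 'a::field set)"
    and "n \<ge> 3"
    and "\<forall>i\<in>{1..n}. m i > 0"
    and "strict_mono_on {1..n} m"
    and "h > 0" and "d > 0"
    and "\<forall>i\<in>{2..n}. m i = h * m 1 + (i - 1) * d"
    and "gcd (m 1) d = 1"
    and "h > 1"
    and "h dvd d"
    and "\<delta> = int ((m 1 - 1) div (n - 1) * h + d + h)"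
  shows "regularity {1..n+1} (vanishing_ideal n m :: 'a mpoly set) =
    (if n - 1 dvd m 1 then \<delta> else \<delta> - 1)"
proof -
  interpret gen_arith_curve n h d m
  proof
    show "0 < m 1" using assms(2,3) by simp
    show "m i = h * m 1 + (i - 1) * d" if "i \<in> {2..n}" for i using assms(7) that by blast
    show "coprime (m 1) d" using assms(8) by (simp only: coprime_iff_gcd_eq_1)
  qed (use assms in simp_all)
  \<comment> \<open>\<open>m 1\<close> is positive, so the truncated difference in
    \<open>\<delta>\<close> agrees with the integer one in \<open>semi.reg\<close>.\<close>
  have "int (m 1) - 1 = int (m 1 - 1)" using m1_pos by simp
  then have "(int (m 1) - 1) div int (n - 1) = int ((m 1 - 1) div (n - 1))" by (simp only: zdiv_int)
  then have "semi.reg = (if n - 1 dvd m 1 then \<delta> else \<delta> - 1)"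
    unfolding semi.reg_def hD assms(11) by (simp only: int_dvd_int_iff of_nat_add of_nat_mult)
  then show ?thesis by (simp only: regularity_curve)
qed

end
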